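(* Let $k\ge 2$ be a fixed integer, and let $p\ge 1$ and $n_1,\dots,n_k\ge 3$ be integers, where $p$ may depend on (and grow with) the sample sizes, such that $n_i\ge p+2$ for all $i\in\{1,\dots,k\}$. Let $y_{i1},\dots,y_{in_i}$, $i\in\{1,\dots,k\}$, be mutually independent random vectors with $y_{ij}\sim N_p(\mu_i,\Lambda_i^{-1})$, where $\mu_i\in\mathbb{R}^p$ and the symmetric positive definite concentration matrices $\Lambda_i$ are all unknown. Under the null hypothesis $$H_\psi:\ \mu_1=\dots=\mu_k,\quad \Lambda_1=\dots=\Lambda_k$$ (i.e. for every common value of the means and every common positive definite value of the $\Lambda_i$), the directional $p$-value $p(\psi)$ for $H_\psi$ (defined in the context) is exactly uniformly distributed on $(0,1)$.
   Context: Notation. $y_i$ is the $n_i\times p$ data matrix of group $i$ (rows $y_{ij}^T$), $n=\sum_{i=1}^k n_i$, $\bar y_i=y_i^T1_{n_i}/n_i$ with $1_{n_i}$ the vector of ones, $\bar y=\sum_{i=1}^k n_i\bar y_i/n$, $A=\sum_{i=1}^k(y_i^Ty_i-n_i\bar y_i\bar y_i^T)$, $B=\sum_{i=1}^k n_i\bar y_i\bar y_i^T-n\bar y\bar y^T$. The unconstrained maximum likelihood estimates are $\hat\mu_i=\bar y_i$, $\hat\Lambda_i^{-1}=y_i^Ty_i/n_i-\bar y_i\bar y_i^T$; under $H_\psi$ the constrained ones are $\hat\mu_0=\bar y$ and $\hat\Lambda_0^{-1}=(A+B)/n$. The number of constraints imposed by $H_\psi$ is $d=p(p+3)(k-1)/2$.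 Directional $p$-value (general definition in a linear exponential family). Let $\varphi$ be the canonical parameter, $u$ the canonical sufficient statistic, $u^0$ its observed value, $s=u-u^0$, and $\ell(\varphi;s)=\varphi^Ts+\ell^0(\varphi)$, where $\ell^0(\varphi)$ is the observed log-likelihood. Let $\hat\varphi^0_\psi$ be the constrained maximum likelihood estimate under $H_\psi$ from the observed data, $s_\psi=-\partial\ell^0(\varphi)/\partial\varphi|_{\varphi=\hat\varphi^0_\psi}$, and $s(t)=(1-t)s_\psi$, $t\in\mathbb{R}$ (so $s(1)=0$ is the observed value and $s(0)=s_\psi$). Let $\hat\varphi(s)$ be the maximizer of $\ell(\varphi;s)$, let $J_{\varphi\varphi}(\varphi;s)=-\partial^2\ell(\varphi;s)/\partial\varphi\,\partial\varphi^T$, and let the saddlepoint approximation be $$h(s;\psi)=c\,\exp\left[\ell(\hat\varphi^0_\psi;s)-\ell\{\hat\varphi(s);s\}\right]\,|J_{\varphi\varphi}\{\hat\varphi(s);s\}|^{-1/2},$$ with $c$ a constant. Then $$p(\psi)=\frac{\int_1^{t_{sup}}t^{d-1}h\{s(t);\psi\}\,dt}{\int_0^{t_{sup}}t^{d-1}h\{s(t);\psi\}\,dt},$$ where $t_{sup}$ is the largest value (supremum) of $t$ for which the maximum likelihood estimate $\hat\varphi\{s(t)\}$ exists. In the present model, $\varphi$ has components $\xi_i=\Lambda_i\mu_i$ and the distinct entries of $\Lambda_i$, $i\in\{1,\dots,k\}$, and $\ell\{\varphi;s(t)\}=\sum_{i=1}^k\ell_i(\varphi_i;t)$ with $$\ell_i(\varphi_i;t)=n_i\xi_i^T\{t\bar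 y_i+(1-t)\bar y\}-\frac{n_i}{2}\mathrm{tr}\left[\Lambda_i\left\{\frac{t\,y_i^Ty_i}{n_i}+(1-t)(\hat\Lambda_0^{-1}+\bar y\bar y^T)\right\}\right]+\frac{n_i}{2}\log|\Lambda_i|-\frac{n_i}{2}\xi_i^T\Lambda_i^{-1}\xi_i .$$ Its maximizer corresponds to $\hat\mu_i(t)=(1-t)\bar y+t\bar y_i$ and $\hat\Lambda_i(t)^{-1}=(1-t)\hat\Lambda_0^{-1}+t\hat\Lambda_i^{-1}+t(1-t)(\bar y_i-\bar y)(\bar y_i-\bar y)^T$, and explicitly $$h\{s(t);\psi\}=c\,\exp\left\{\sum_{i=1}^k\frac{n_i-p-2}{2}\log|\hat\Lambda_i(t)^{-1}|\right\},$$ with $c$ not depending on $t$ (it cancels in $p(\psi)$); $t_{sup}$ is the largest $t$ for which all $\hat\Lambda_i(t)^{-1}$ are positive definite. *)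

theory Defs
  imports "HOL-Probability.Probability" "HOL-Library.Uprod"
begin

section \<open>Directional p-value in a linear exponential family\<close>

text \<open>
  Throughout, \<open>l0\<close> is the observed log-likelihood as a function of the canonical parameter,
  \<open>Par\<close> the canonical parameter space, \<open>Null\<close> the subset of \<open>Par\<close> allowed by the hypothesis,
  \<open>d\<close> the number of constraints, and \<open>c\<close> the constant of the saddlepoint approximation. The
  argument \<open>s\<close> is the canonical sufficient statistic centred at its observed value, so that
  \<open>s = 0\<close> is the observed data.
\<close>

definition loglik_at :: "(real^'m \<Rightarrow> real) \<Rightarrow> real^'m \<Rightarrow> real^'m \<Rightarrow> real" where
  "loglik_at l0 s \<phi> = \<phi> \<bullet> s + l0 \<phi>"

definition gradient :: "(real^'m \<Rightarrow> real) \<Rightarrow> real^'m \<Rightarrow> real^'m" where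
  "gradient f x = (THE D. GDERIV f x :> D)"

definition obs_information :: "(real^'m \<Rightarrow> real) \<Rightarrow> real^'m \<Rightarrow> real^'m^'m" where
  "obs_information f x = - jacobian (gradient f) (at x)"

definition mle_exists :: "(real^'m) set \<Rightarrow> (real^'m \<Rightarrow> real) \<Rightarrow> bool" where
  "mle_exists Par l \<longleftrightarrow> (\<exists>\<phi>. is_arg_max l (\<lambda>\<phi>. \<phi> \<in> Par) \<phi>)"

definition mle :: "(real^'m) set \<Rightarrow> (real^'m \<Rightarrow> real) \<Rightarrow> real^'m" where
  "mle Par l = arg_max l (\<lambda>\<phi>. \<phi> \<in> Par)"

definition s_psi :: "(real^'m) set \<Rightarrow> (real^'m \<Rightarrow> real) \<Rightarrow> real^'m" where
  "s_psi Null l0 = - gradient l0 (mle Null l0)"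

definition s_line :: "(real^'m) set \<Rightarrow> (real^'m \<Rightarrow> real) \<Rightarrow> real \<Rightarrow> real^'m" where
  "s_line Null l0 t = (1 - t) *\<^sub>R s_psi Null l0"

definition saddlepoint ::
  "real \<Rightarrow> (real^'m) set \<Rightarrow> (real^'m) set \<Rightarrow> (real^'m \<Rightarrow> real) \<Rightarrow> real^'m \<Rightarrow> real" where
  "saddlepoint c Par Null l0 s =
     (let l = loglik_at l0 s; \<phi>s = mle Par l
      in c * exp (l (mle Null l0) - l \<phi>s) * det (obs_information l \<phi>s) powr (- 1 / 2))"

definition t_sup :: "(real^'m) set \<Rightarrow> (real^'m) set \<Rightarrow> (real^'m \<Rightarrow> real) \<Rightarrow> ereal" where
  "t_sup Par Null l0 =
     (SUP t \<in> {t. mle_exists Par (loglik_at l0 (s_line Null l0 t))}. ereal t)"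

text \<open>
  The p-value presupposes that the constrained and unconstrained maximum likelihood estimates
  exist for the observed data; for other data it is left unspecified.
\<close>

definition directional_pvalue ::
  "real \<Rightarrow> nat \<Rightarrow> (real^'m) set \<Rightarrow> (real^'m) set \<Rightarrow> (real^'m \<Rightarrow> real) \<Rightarrow> real" where
  "directional_pvalue c d Par Null l0 =
     (if mle_exists Par l0 \<and> mle_exists Null l0
      then (LBINT t=1..t_sup Par Null l0.
              t ^ (d - 1) * saddlepoint c Par Null l0 (s_line Null l0 t))
         / (LBINT t=0..t_sup Par Null l0.
              t ^ (d - 1) * saddlepoint c Par Null l0 (s_line Null l0 t))
      else undefined)"


section \<open>Independent groups of multivariate normal vectors\<close>

definition pos_def :: "real^'p^'p \<Rightarrow> bool" where
  "pos_def S \<longleftrightarrow> transpose S = S \<and> (\<forall>x. x \<noteq> 0 \<longrightarrow> 0 < x \<bullet> (S *v x))"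

text \<open>Density of the normal distribution with mean \<open>\<mu>\<close> and covariance matrix \<open>S\<close>.\<close>

definition mvn_density :: "real^'p \<Rightarrow> real^'p^'p \<Rightarrow> real^'p \<Rightarrow> real" where
  "mvn_density \<mu> S x =
     exp (- ((x - \<mu>) \<bullet> (matrix_inv S *v (x - \<mu>))) / 2) / sqrt ((2 * pi) ^ CARD('p) * det S)"

instance uprod :: (finite) finite
  by standard simp

text \<open>
  The canonical parameter collects, for each group, the \<open>p\<close> entries of \<open>\<Lambda> \<mu>\<close> and the
  \<open>p (p + 1) / 2\<close> distinct entries of the symmetric matrix \<open>\<Lambda>\<close>. The latter are indexed by
  unordered pairs \<open>Upair a b\<close>, with \<open>a = b\<close> allowed.
\<close>

type_synonym ('k, 'p) param = "real ^ ('k \<times> ('p + 'p uprod))"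

definition xi :: "('k::finite, 'p::finite) param \<Rightarrow> 'k \<Rightarrow> real^'p" where
  "xi \<phi> i = (\<chi> a. \<phi> $ (i, Inl a))"

definition conc :: "('k::finite, 'p::finite) param \<Rightarrow> 'k \<Rightarrow> real^'p^'p" where
  "conc \<phi> i = (\<chi> a b. \<phi> $ (i, Inr (Upair a b)))"

definition mean :: "('k::finite, 'p::finite) param \<Rightarrow> 'k \<Rightarrow> real^'p" where
  "mean \<phi> i = matrix_inv (conc \<phi> i) *v xi \<phi> i"

definition H_psi :: "('k \<Rightarrow> real^'p) \<Rightarrow> ('k \<Rightarrow> real^'p^'p) \<Rightarrow> bool" where
  "H_psi \<mu> \<Lambda> \<longleftrightarrow> (\<forall>i j. \<mu> i = \<mu> j) \<and> (\<forall>i j. \<Lambda> i = \<Lambda> j)"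

definition param_space :: "('k::finite, 'p::finite) param set" where
  "param_space = {\<phi>. \<forall>i. pos_def (conc \<phi> i)}"

definition null_params :: "('k::finite, 'p::finite) param set" where
  "null_params = {\<phi> \<in> param_space. H_psi (mean \<phi>) (conc \<phi>)}"

text \<open>The observations of group \<open>i\<close> are \<open>y i 0, \<dots>, y i (n i - 1)\<close>.\<close>

definition mvn_loglik ::
  "('k \<Rightarrow> nat) \<Rightarrow> ('k \<Rightarrow> nat \<Rightarrow> real^'p) \<Rightarrow> ('k::finite, 'p::finite) param \<Rightarrow> real" where
  "mvn_loglik n y \<phi> =
     (\<Sum>i\<in>UNIV. \<Sum>j<n i. ln (mvn_density (mean \<phi> i) (matrix_inv (conc \<phi> i)) (y i j)))"

definition mvn_pvalue ::
  "real \<Rightarrow> ('k::finite \<Rightarrow> nat) \<Rightarrow> ('k \<Rightarrow> nat \<Rightarrow> real^'p::finite) \<Rightarrow> real" where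
  "mvn_pvalue c n y =
     directional_pvalue c (CARD('p) * (CARD('p) + 3) * (CARD('k) - 1) div 2)
       param_space null_params (mvn_loglik n y)"

end

theory Submission
  imports Defs "HOL-Computational_Algebra.Polynomial"
begin

text \<open>
  Write \<open>v\<close> for the moments \<open>(\<Sum> y, \<Sum> y y\<^sup>T)\<close> of the groups. The line \<open>s(t)\<close> corresponds to the ray
  \<open>t \<mapsto> pooled v + t (v - pooled v)\<close> through the pooled moments, and on it the saddlepoint
  approximation is, up to a factor not depending on \<open>t\<close>, the density \<open>\<Prod> det (cov\<^sub>i)\<^bsup>(n\<^sub>i - p - 2)/2\<^esup>\<close>
  of \<open>v\<close> under Lebesgue measure on the data. Under the hypothesis the likelihood depends on \<open>v\<close> only
  through \<open>pooled v\<close>, so it is constant on rays. In polar coordinates around \<open>pooled v\<close> the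
  Jacobian is \<open>t\<^bsup>d - 1\<^esup>\<close>; hence the p-value is the conditional survival function of the radial
  variable evaluated at that variable, and is uniform.

  The density of \<open>v\<close> comes without integrating out anything: \<open>y \<mapsto> A y + b\<close> scales
  Lebesgue measure on the data by \<open>\<bar>det A\<bar>\<^bsup>n\<^esup>\<close>, the induced action on positive definite covariances is
  transitive, and relatively invariant measures are unique up to a constant.
\<close>

section \<open>Positive definite matrices\<close>

text \<open>What makes the result exact is an agreement of exponents. Under
  \<open>y -> A y + b\<close> Lebesgue measure on the data of group i scales by |det A|^n_i and
  Lebesgue measure on its moments by |det A|^(p + 2): one power for the sum, p + 1 for the symmetric
  second moments. As det cov scales by (det A)^2, the density must be its power (n_i - p - 2)/2. In
  the saddlepoint approximation the maximized likelihood gives the power n_i/2, and the information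
  determinant, with the same p + 2, the power -(p + 2)/2. The affine group is not unimodular, so
  averaging over it in two orders leaves a factor sqrt (det cov); it is common to the data measure
  and to Lebesgue measure on the moments and cancels. Determinants on symmetric matrices are never
  expanded: scale factors are characters of GL, fixed by diagonal matrices, and the information
  operator is factored to fit. On a ray the argument needs a finite mass. Finiteness of the total
  integral gives this for almost every ray that matters, and it follows from total probability
  1.\<close>

lemma orthonormal_eigenbasis:
  fixes M :: "real^'n^'n"
  assumes sym: "transpose M = M"
    and S: "subspace S" and inv: "\<And>x. x \<in> S \<Longrightarrow> M *v x \<in> S"
  shows "\<exists>B. B \<subseteq> S \<and> pairwise orthogonal B \<and> (\<forall>x\<in>B. norm x = 1) \<and> span B = S \<and>
             (\<forall>x\<in>B. \<exists>c. M *v x = c *\<^sub>R x)"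
  using S inv
proof (induction "dim S" arbitrary: S rule: less_induct)
  case less
  have symd: "x \<bullet> (M *v y) = (M *v x) \<bullet> y" for x y
    by (metis dot_lmul_matrix matrix_transpose_mul sym transpose_matrix_vector)
  show ?case
  proof (cases "S = {0}")
    case True
    then show ?thesis by (intro exI[of _ "{}"]) auto
  next
    case False
    define K where "K = S \<inter> sphere 0 1"
    have 1: "compact K"
      unfolding K_def using less.prems(1) by (intro closed_Int_compact closed_subspace) auto
    obtain z where z: "z \<in> S" "z \<noteq> 0"
      using False less.prems(1) subspace_0 by blast
    then have "(1 / norm z) *\<^sub>R z \<in> K"
      using less.prems(1) by (auto simp: K_def subspace_scale)
    then have 2: "K \<noteq> {}" by blast
    have 3: "continuous_on K (\<lambda>x. x \<bullet> (M *v x))"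
      by (intro continuous_intros)
    \<comment> \<open>A maximizer x of the Rayleigh quotient on the unit sphere of S is an
      eigenvector: if M x had a component in S orthogonal to x, moving x in that direction would
      increase the quotient. The orthogonal complement of x in S is again invariant, which drives
      the induction on the dimension.\<close>
    from continuous_attains_sup[OF 1 2 3] obtain x where x: "x \<in> K" and max: "\<And>y. y \<in> K \<Longrightarrow> y \<bullet> (M *v y) \<le> x \<bullet> (M *v x)"
      by auto
    have xS: "x \<in> S" and nx: "norm x = 1"
      using x by (auto simp: K_def)
    have xx: "x \<bullet> x = 1" using nx by (simp add: dot_square_norm)
    define c where "c = x \<bullet> (M *v x)"
    have le: "y \<bullet> (M *v y) \<le> c * (y \<bullet> y)" if "y \<in> S" for y
    proof (cases "y = 0")
      case False
      have "(1 / norm y) *\<^sub>R y \<in> K"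
        using that False less.prems(1) by (auto simp: K_def subspace_scale)
      from max[OF this] have "(y \<bullet> (M *v y)) / (norm y)^2 \<le> c"
        by (simp add: c_def matrix_vector_mult_scaleR power2_eq_square)
      with False show ?thesis
        by (simp add: divide_le_eq dot_square_norm)
    qed simp
    have orth: "y \<bullet> (M *v x) = 0" if y: "y \<in> S" "x \<bullet> y = 0" for y
    proof (rule ccontr)
      assume nz: "y \<bullet> (M *v x) \<noteq> 0"
      define b where "b = y \<bullet> (M *v x)"
      define e where "e = c * (y \<bullet> y) - y \<bullet> (M *v y)"
      have "2 * s * b \<le> s^2 * e" for s :: real
      proof -
        have "x + s *\<^sub>R y \<in> S"
          using xS y less.prems(1) by (simp add: subspace_add subspace_scale)
        from le[OF this] have "c + 2 * s * b + s^2 * (y \<bullet> (M *v y)) \<le> c * (1 + s^2 * (y \<bullet> y))"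
          using symd[of x y] y(2)
          by (simp add: algebra_simps inner_add_left inner_add_right matrix_vector_right_distrib
              matrix_vector_mult_scaleR xx c_def b_def power2_eq_square inner_commute)
        then show ?thesis by (simp add: e_def algebra_simps)
      qed
      \<comment> \<open>For s proportional to b the linear term 2 s b beats s^2 e once the factor is
        small enough; dividing by |e| + 1 avoids a case distinction on e.\<close>
      from this[of "b / (\<bar>e\<bar> + 1)"]
      have "2 * b^2 / (\<bar>e\<bar> + 1) \<le> b^2 / (\<bar>e\<bar> + 1) ^ 2 * e"
        by (simp add: power2_eq_square)
      also have "\<dots> \<le> b^2 / (\<bar>e\<bar> + 1) ^ 2 * (\<bar>e\<bar> + 1)"
        by (intro mult_left_mono) auto
      also have "\<dots> = b^2 / (\<bar>e\<bar> + 1)"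
        by (simp add: power2_eq_square)
      finally have "b^2 / (\<bar>e\<bar> + 1) \<le> 0" by simp
      moreover have "b^2 / (\<bar>e\<bar> + 1) > 0" using nz by (simp add: b_def)
      ultimately show False by simp
    qed
    have eig: "M *v x = c *\<^sub>R x"
    proof -
      define w where "w = M *v x - c *\<^sub>R x"
      have w: "w \<in> S" "x \<bullet> w = 0"
        using less.prems xS by (auto simp: w_def subspace_diff subspace_scale inner_diff_right xx c_def)
      then have "w \<bullet> (M *v x) = 0" by (rule orth)
      then have "w \<bullet> w = 0"
        using w(2) by (simp add: w_def inner_diff_right inner_commute)
      then show ?thesis by (simp add: w_def)
    qed
    define S' where "S' = S \<inter> {y. x \<bullet> y = 0}"
    have S': "subspace S'"
      unfolding S'_def by (intro subspace_inter less.prems subspace_hyperplane)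
    have "x \<notin> S'" by (simp add: S'_def xx)
    then have "S' \<subset> S" using xS unfolding S'_def by blast
    then have "dim S' < dim S"
      using S' less.prems(1) by (metis dim_psubset span_eq_iff)
    moreover have "M *v y \<in> S'" if "y \<in> S'" for y
      using that less.prems(2) by (simp add: S'_def symd eig)
    ultimately obtain B where B: "B \<subseteq> S'" "pairwise orthogonal B" "\<forall>x\<in>B. norm x = 1" "span B = S'"
       "\<forall>x\<in>B. \<exists>c. M *v x = c *\<^sub>R x"
      using less.hyps[OF _ S'] by blast
    have "span (insert x B) = S"
    proof
      show "span (insert x B) \<subseteq> S"
        using B(1) xS less.prems(1) by (intro span_minimal) (auto simp: S'_def)
      show "S \<subseteq> span (insert x B)"
      proof
        fix y assume y: "y \<in> S"
        have "y - (x \<bullet> y) *\<^sub>R x \<in> S'"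
          using y xS less.prems(1) by (auto simp: S'_def subspace_diff subspace_scale inner_diff_right xx)
        then show "y \<in> span (insert x B)"
          using B(4) by (auto simp: span_insert)
      qed
    qed
    moreover have "pairwise orthogonal (insert x B)"
      using B(1,2) by (auto simp: pairwise_insert S'_def orthogonal_def inner_commute)
    ultimately show ?thesis
      using B xS nx eig by (intro exI[of _ "insert x B"]) (auto simp: S'_def)
  qed
qed

definition diag_mat :: "('n \<Rightarrow> real) \<Rightarrow> real^'n^'n" where
  "diag_mat d = (\<chi> i j. if i = j then d i else 0)"

lemma symmetric_matrix_diagonalizable:
  fixes M :: "real^'n^'n"
  assumes sym: "transpose M = M"
  obtains Q :: "real^'n^'n" and d where "orthogonal_matrix Q" "M = Q ** diag_mat d ** transpose Q"
proof -
  obtain B where B: "pairwise orthogonal B" "\<forall>x\<in>B. norm x = 1" "span B = UNIV"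
    "\<forall>x\<in>B. \<exists>c. M *v x = c *\<^sub>R x"
    using orthonormal_eigenbasis[OF sym subspace_UNIV] by auto
  have ind: "independent B"
    using B(1,2) by (intro pairwise_orthogonal_independent) auto
  have "card B = CARD('n)"
    using B(3) ind by (metis DIM_cart DIM_real dim_UNIV dim_eq_card dim_span mult.right_neutral)
  moreover have "finite B" using ind independent_imp_finite by blast
  ultimately obtain f where f: "bij_betw f (UNIV :: 'n set) B"
    by (metis finite_same_card_bij finite_class.finite_UNIV)
  have fB: "f i \<in> B" for i using f by (auto simp: bij_betw_def)
  have "\<exists>c. M *v f i = c *\<^sub>R f i" for i
    using B(4) fB by blast
  then obtain d where d: "M *v f i = d i *\<^sub>R f i" for i
    using choice[of "\<lambda>i c. M *v f i = c *\<^sub>R f i"] by auto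
  define Q where "Q = (\<chi> a i. f i $ a)"
  have ortho: "f i \<bullet> f j = (if i = j then 1 else 0)" for i j
  proof (cases "i = j")
    case True
    then show ?thesis using B(2) fB[of j] by (simp add: dot_square_norm)
  next
    case False
    then have "f i \<noteq> f j" using f by (auto simp: bij_betw_def inj_on_def)
    then show ?thesis using False B(1) fB by (auto simp: pairwise_def orthogonal_def)
  qed
  have QQ: "transpose Q ** Q = mat 1"
    using ortho by (simp add: vec_eq_iff matrix_matrix_mult_def transpose_def Q_def mat_def inner_vec_def)
  then have Q: "orthogonal_matrix Q" by (simp add: orthogonal_matrix)
  have "M ** Q = Q ** diag_mat d"
  proof -
    have "(M ** Q) $ a $ i = (Q ** diag_mat d) $ a $ i" for a i
    proof -
      have "(M ** Q) $ a $ i = (M *v f i) $ a"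
        by (simp add: matrix_matrix_mult_def matrix_vector_mult_def Q_def)
      also have "\<dots> = d i * f i $ a" by (simp add: d)
      also have "\<dots> = (Q ** diag_mat d) $ a $ i"
        by (simp add: matrix_matrix_mult_def Q_def diag_mat_def if_distrib[of "\<lambda>x. _ * x"] cong: if_cong)
      finally show ?thesis .
    qed
    then show ?thesis by (simp add: vec_eq_iff)
  qed
  then have "M = Q ** diag_mat d ** transpose Q"
    using Q unfolding orthogonal_matrix_def by (metis matrix_mul_assoc matrix_mul_rid)
  with Q that show ?thesis by blast
qed

section \<open>Inverses, congruence and square roots\<close>

lemma matrix_inv_unique:
  fixes A :: "real^'n^'n"
  assumes "A ** X = mat 1"
  shows "matrix_inv A = X"
proof -
  have X: "X ** A = mat 1" using assms matrix_left_right_inverse by blast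
  have "A ** matrix_inv A = mat 1"
    unfolding matrix_inv_def using someI_ex[of "\<lambda>A'. A ** A' = mat 1 \<and> A' ** A = mat 1"] assms X by blast
  then have "X ** (A ** matrix_inv A) = X" by simp
  then show ?thesis by (simp add: matrix_mul_assoc X)
qed

lemma matrix_inv_left:
  fixes A :: "real^'n^'n"
  assumes "invertible A"
  shows "matrix_inv A ** A = mat 1"
  using assms matrix_inv_unique unfolding invertible_def by metis

lemma matrix_inv_right:
  fixes A :: "real^'n^'n"
  assumes "invertible A"
  shows "A ** matrix_inv A = mat 1"
  using assms matrix_inv_unique unfolding invertible_def by metis

lemma invertible_matrix_inv:
  fixes A :: "real^'n^'n"
  assumes "invertible A"
  shows "invertible (matrix_inv A)"
  using assms matrix_inv_left matrix_inv_right unfolding invertible_def by blast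

lemma matrix_inv_matrix_inv:
  fixes A :: "real^'n^'n"
  assumes "invertible A"
  shows "matrix_inv (matrix_inv A) = A"
  by (rule matrix_inv_unique) (rule matrix_inv_left[OF assms])

lemma det_matrix_inv:
  fixes A :: "real^'n^'n"
  assumes "invertible A"
  shows "det (matrix_inv A) = 1 / det A"
  using matrix_inv_right[OF assms] assms by (metis det_I det_mul invertible_det_nz nonzero_mult_div_cancel_left)

lemma transpose_matrix_inv:
  fixes A :: "real^'n^'n"
  assumes "invertible A"
  shows "transpose (matrix_inv A) = matrix_inv (transpose A)"
  by (rule matrix_inv_unique[symmetric]) (metis assms matrix_inv_left matrix_transpose_mul transpose_mat)

lemma inner_matrix_mult_transpose:
  fixes B :: "real^'n^'m"
  shows "x \<bullet> (B *v y) = (transpose B *v x) \<bullet> y"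
  by (simp add: dot_lmul_matrix[symmetric])

lemma invertible_transpose:
  fixes A :: "real^'n^'n"
  shows "invertible A \<Longrightarrow> invertible (transpose A)"
  by (simp add: invertible_det_nz)

lemma invertible_mult_nonzero:
  fixes A :: "real^'n^'n"
  assumes "invertible A" "x \<noteq> 0"
  shows "A *v x \<noteq> 0"
  using assms matrix_left_invertible_ker[of A] unfolding invertible_def by blast

lemma pos_def_congruence:
  fixes S B :: "real^'p^'p"
  assumes S: "pos_def S" and B: "invertible B"
  shows "pos_def (B ** S ** transpose B)"
  unfolding pos_def_def
proof (intro conjI allI impI)
  show "transpose (B ** S ** transpose B) = B ** S ** transpose B"
    using S by (simp add: pos_def_def matrix_transpose_mul matrix_mul_assoc)
  fix x :: "real^'p" assume "x \<noteq> 0"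
  then have "transpose B *v x \<noteq> 0"
    using B by (intro invertible_mult_nonzero invertible_transpose)
  then have "0 < (transpose B *v x) \<bullet> (S *v (transpose B *v x))"
    using S by (simp add: pos_def_def)
  also have "\<dots> = x \<bullet> (B ** S ** transpose B *v x)"
    by (simp only: inner_matrix_mult_transpose[symmetric] matrix_vector_mul_assoc matrix_mul_assoc)
  finally show "0 < x \<bullet> (B ** S ** transpose B *v x)" .
qed

lemma pos_def_mat_1: "pos_def (mat 1)"
  by (simp add: pos_def_def)

lemma transpose_diag_mat: "transpose (diag_mat d) = diag_mat d"
  by (simp add: vec_eq_iff transpose_def diag_mat_def)

lemma det_diag_mat: "det (diag_mat d) = prod d UNIV"
  by (subst det_diagonal) (auto simp: diag_mat_def)

lemma diag_mat_mult: "diag_mat d ** diag_mat e = diag_mat (\<lambda>i. d i * e i)"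
  by (simp add: vec_eq_iff matrix_matrix_mult_def diag_mat_def if_distrib[of "\<lambda>x. _ * x"] cong: if_cong)

lemma trace_diag_mat: "trace (diag_mat d) = sum d UNIV"
  by (simp add: trace_def diag_mat_def)

lemma diag_mat_axis: "diag_mat d *v axis i 1 = d i *\<^sub>R axis i 1"
  by (simp add: vec_eq_iff matrix_vector_mult_def diag_mat_def axis_def if_distrib[of "\<lambda>x. _ * x"] cong: if_cong)

lemma pos_def_diagonalizable:
  fixes M :: "real^'p^'p"
  assumes "pos_def M"
  obtains Q :: "real^'p^'p" and d where "orthogonal_matrix Q" "M = Q ** diag_mat d ** transpose Q" "\<And>i. d i > 0"
proof -
  obtain Q :: "real^'p^'p" and d where Q: "orthogonal_matrix Q" and M: "M = Q ** diag_mat d ** transpose Q"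
    using symmetric_matrix_diagonalizable assms pos_def_def by metis
  have "d i > 0" for i
  proof -
    have inv: "invertible Q" "transpose Q ** Q = mat 1"
      using Q unfolding orthogonal_matrix_def invertible_def by blast+
    have "Q *v axis i 1 \<noteq> 0"
      using inv by (intro invertible_mult_nonzero) (auto simp: axis_eq_0_iff)
    then have "0 < (Q *v axis i 1) \<bullet> (M *v (Q *v axis i 1))"
      using assms by (simp add: pos_def_def)
    also have "M *v (Q *v axis i 1) = Q *v (diag_mat d *v axis i 1)"
      unfolding M by (metis inv(2) matrix_mul_assoc matrix_mul_rid matrix_vector_mul_assoc)
    also have "(Q *v axis i 1) \<bullet> (Q *v (diag_mat d *v axis i 1)) = axis i 1 \<bullet> (diag_mat d *v axis i 1)"
      by (metis inv(2) inner_matrix_mult_transpose matrix_vector_mul_assoc matrix_vector_mul_lid)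
    also have "\<dots> = d i"
      by (simp add: diag_mat_axis inner_axis_axis)
    finally show ?thesis .
  qed
  with Q M that show ?thesis by blast
qed

text \<open>Congruence acts transitively on positive definite matrices, with the identity as base
  point; \<open>obtain_affine_act\<close> rests on this.\<close>

lemma pos_def_root:
  fixes S :: "real^'p^'p"
  assumes "pos_def S"
  obtains B :: "real^'p^'p" where "invertible B" "S = B ** transpose B"
proof -
  obtain Q :: "real^'p^'p" and d where Q: "orthogonal_matrix Q" and M: "S = Q ** diag_mat d ** transpose Q" and d: "\<And>i. d i > 0"
    by (rule pos_def_diagonalizable[OF assms]) (rule that)
  define B where "B = Q ** diag_mat (\<lambda>i. sqrt (d i))"
  have "invertible Q"
    using Q unfolding orthogonal_matrix_def invertible_def by blast
  then have "det Q \<noteq> 0"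
    by (simp add: invertible_det_nz)
  then have "invertible B"
    using d by (simp add: invertible_det_nz B_def det_mul det_diag_mat less_imp_neq[symmetric])
  moreover have "B ** transpose B = Q ** (diag_mat (\<lambda>i. sqrt (d i)) ** diag_mat (\<lambda>i. sqrt (d i))) ** transpose Q"
    by (simp add: B_def matrix_transpose_mul transpose_diag_mat matrix_mul_assoc)
  then have "B ** transpose B = S"
    using d by (simp add: M diag_mat_mult less_imp_le)
  ultimately show ?thesis using that by blast
qed

lemma pos_def_mult_transpose: "invertible (B :: real^'p^'p) \<Longrightarrow> pos_def (B ** transpose B)"
  using pos_def_congruence[OF pos_def_mat_1, of B] by simp

lemma det_mult_transpose: "det (B ** transpose B) = (det B)^2" for B :: "real^'n^'n"
  by (simp add: det_mul power2_eq_square)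

lemma pos_def_det_pos: "pos_def S \<Longrightarrow> det S > 0"
  by (erule pos_def_root) (simp add: det_mult_transpose invertible_det_nz)

lemma pos_def_invertible: "pos_def S \<Longrightarrow> invertible S"
  using pos_def_det_pos invertible_det_nz by fastforce

lemma pos_def_matrix_inv:
  fixes S :: "real^'p^'p"
  assumes "pos_def S"
  shows "pos_def (matrix_inv S)"
proof -
  obtain B :: "real^'p^'p" where B: "invertible B" "S = B ** transpose B"
    by (rule pos_def_root[OF assms])
  define D where "D = matrix_inv (transpose B)"
  have "transpose B ** D = mat 1" "transpose D ** B = mat 1"
    using B(1) by (auto simp: D_def matrix_inv_right matrix_inv_left invertible_transpose transpose_matrix_inv)
  then have "S ** (D ** transpose D) = mat 1"
    unfolding B(2) by (metis matrix_left_right_inverse matrix_mul_assoc matrix_mul_rid)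
  then have "matrix_inv S = D ** transpose D" by (rule matrix_inv_unique)
  moreover have "invertible D" using B(1) by (simp add: D_def invertible_matrix_inv invertible_transpose)
  ultimately show ?thesis by (simp add: pos_def_mult_transpose)
qed

text \<open>With C = B B^T, the eigenvalues d of B^T L B have sum of ln d equal to ln det L + ln det
  C and sum of d equal to tr (L C). The difference of the two sides is therefore the sum of d - 1 -
  ln d, which is nonnegative and vanishes only if every d is 1. This is Gaussian maximum likelihood
  for one group, obtained without calculus.\<close>

lemma log_det_le:
  fixes L C :: "real^'p^'p"
  assumes L: "pos_def L" and C: "pos_def C"
  shows "ln (det L) - trace (L ** C) \<le> - ln (det C) - CARD('p)"
    and "ln (det L) - trace (L ** C) = - ln (det C) - CARD('p) \<Longrightarrow> L = matrix_inv C"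
proof -
  obtain B :: "real^'p^'p" where B: "invertible B" "C = B ** transpose B"
    by (rule pos_def_root[OF C])
  define M where "M = transpose B ** L ** B"
  have "pos_def M"
    unfolding M_def using pos_def_congruence[OF L invertible_transpose[OF B(1)]] by simp
  then obtain Q :: "real^'p^'p" and d where Q: "orthogonal_matrix Q" and M: "M = Q ** diag_mat d ** transpose Q" and d: "\<And>i. d i > 0"
    by (rule pos_def_diagonalizable) (rule that)
  have QQ: "Q ** transpose Q = mat 1" "transpose Q ** Q = mat 1"
    using Q by (auto simp: orthogonal_matrix_def)
  have "det M = det L * det C"
    by (simp add: M_def B(2) det_mul mult_ac)
  moreover have "det M = prod d UNIV"
  proof -
    have "det Q * det (transpose Q) = 1"
      by (simp only: det_mul[symmetric] QQ det_I)
    then show ?thesis by (simp add: M det_mul det_diag_mat)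
  qed
  ultimately have "det L * det C = prod d UNIV" by simp
  then have "ln (det L * det C) = (\<Sum>i\<in>UNIV. ln (d i))"
    using d by (simp add: ln_prod less_imp_neq[symmetric])
  then have ln: "ln (det L) + ln (det C) = (\<Sum>i\<in>UNIV. ln (d i))"
    using pos_def_det_pos[OF L] pos_def_det_pos[OF C] by (simp add: ln_mult)
  have "trace M = trace (L ** C)"
    using trace_mul_sym[of "transpose B" "L ** B"] by (simp add: M_def B(2) matrix_mul_assoc)
  moreover have "trace M = sum d UNIV"
    using trace_mul_sym[of "Q ** diag_mat d" "transpose Q"]
    by (simp add: M matrix_mul_assoc QQ trace_diag_mat)
  ultimately have tr: "trace (L ** C) = sum d UNIV" by simp
  have le: "0 \<le> d i - 1 - ln (d i)" for i
    using ln_le_minus_one[OF d[of i]] by simp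
  have eq: "ln (det L) - trace (L ** C) = - ln (det C) - CARD('p) - (\<Sum>i\<in>UNIV. d i - 1 - ln (d i))"
    using ln tr by (simp add: sum_subtractf)
  show "ln (det L) - trace (L ** C) \<le> - ln (det C) - CARD('p)"
    unfolding eq using le by (simp add: sum_nonneg)
  assume "ln (det L) - trace (L ** C) = - ln (det C) - CARD('p)"
  then have "(\<Sum>i\<in>UNIV. d i - 1 - ln (d i)) = 0" using eq by simp
  then have "d i - 1 - ln (d i) = 0" for i
    using le by (subst (asm) sum_nonneg_eq_0_iff) auto
  then have "ln (d i) = d i - 1" for i by (simp add: algebra_simps)
  then have "d i = 1" for i using ln_eq_minus_one d by blast
  then have "diag_mat d = mat 1" by (simp add: vec_eq_iff diag_mat_def mat_def)
  then have "M = mat 1" using M QQ by simp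
  then have "transpose B ** (L ** B) = mat 1" by (simp add: M_def matrix_mul_assoc)
  then have "(L ** B) ** transpose B = mat 1" using matrix_left_right_inverse by blast
  then have "L ** C = mat 1" by (simp add: B(2) matrix_mul_assoc)
  then have "C ** L = mat 1" using matrix_left_right_inverse by blast
  then show "L = matrix_inv C" using matrix_inv_unique by metis
qed

section \<open>Matrix calculus\<close>

lemma bounded_bilinear_matrix_mult: "bounded_bilinear (\<lambda>(A::real^'n^'m) (B::real^'p^'n). A ** B)"
  by (intro bilinear_conv_bounded_bilinear[THEN iffD1])
     (auto simp: bilinear_def linear_iff vec_eq_iff matrix_matrix_mult_def
        sum.distrib algebra_simps sum_distrib_left)

lemmas matrix_mult_add_left = bounded_bilinear.add_left[OF bounded_bilinear_matrix_mult]
  and matrix_mult_add_right = bounded_bilinear.add_right[OF bounded_bilinear_matrix_mult]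
  and matrix_mult_scaleR_left = bounded_bilinear.scaleR_left[OF bounded_bilinear_matrix_mult]
  and matrix_mult_scaleR_right = bounded_bilinear.scaleR_right[OF bounded_bilinear_matrix_mult]

section \<open>Continuity and measurability of determinants and inverses\<close>

lemma continuous_on_if_const:
  "continuous_on S f \<Longrightarrow> continuous_on S g \<Longrightarrow> continuous_on S (\<lambda>x. if P then f x else g x)"
  by (cases P) simp_all

lemma continuous_on_det [continuous_intros]:
  fixes f :: "'a::topological_space \<Rightarrow> real^'n^'n"
  assumes "continuous_on S f"
  shows "continuous_on S (\<lambda>x. det (f x))"
  unfolding det_def by (intro continuous_intros assms)

lemma borel_measurable_vecI:
  fixes f :: "'a \<Rightarrow> 'b::euclidean_space^'n"
  assumes "\<And>i. (\<lambda>x. f x $ i) \<in> borel_measurable M"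
  shows "f \<in> borel_measurable M"
  by (subst borel_measurable_euclidean_space) (auto simp: Basis_vec_def inner_axis intro!: borel_measurable_inner assms)

lemma borel_measurable_vec_nth [measurable (raw)]:
  fixes f :: "'a \<Rightarrow> 'b::euclidean_space^'n"
  assumes "f \<in> borel_measurable M"
  shows "(\<lambda>x. f x $ i) \<in> borel_measurable M"
  by (rule measurable_compose[OF assms borel_measurable_continuous_onI])
     (intro continuous_intros)

lemma borel_measurable_det [measurable]: "det \<in> borel_measurable (borel :: (real^'n^'n) measure)"
  by (intro borel_measurable_continuous_onI continuous_on_det continuous_on_id)

text \<open>Coincides with \<open>matrix_inv\<close> on invertible matrices, but is a quotient of
  polynomials everywhere and hence measurable on the whole space; at singular matrices
  \<open>matrix_inv\<close> is an arbitrary choice. The integrals over the affine group need a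
  measurable inverse.\<close>

definition cramer_inv :: "real^'n^'n \<Rightarrow> real^'n^'n" where
  "cramer_inv A = (\<chi> k l. det (\<chi> i j. if j = k then axis l 1 $ i else A $ i $ j) / det A)"

lemma matrix_inv_eq_cramer_inv:
  fixes A :: "real^'n^'n"
  assumes "invertible A"
  shows "matrix_inv A = cramer_inv A"
proof -
  have "A *v (matrix_inv A *v axis l 1) = axis l 1" for l
    by (simp add: matrix_vector_mul_assoc matrix_inv_right[OF assms])
  then have "matrix_inv A *v axis l 1 = (\<chi> k. det (\<chi> i j. if j = k then axis l 1 $ i else A $ i $ j) / det A)" for l
    using assms by (subst (asm) cramer) (auto simp: invertible_det_nz)
  then show ?thesis
    by (simp add: vec_eq_iff cramer_inv_def matrix_vector_mult_basis column_def)
qed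

lemma borel_measurable_cramer_inv [measurable]:
  "cramer_inv \<in> borel_measurable (borel :: (real^'n^'n) measure)"
proof -
  have "(\<lambda>A::real^'n^'n. cramer_inv A $ k $ l) \<in> borel_measurable borel" for k l :: 'n
  proof -
    have "continuous_on UNIV (\<lambda>A::real^'n^'n. det (\<chi> i j. if j = k then axis l 1 $ i else A $ i $ j))"
      by (intro continuous_on_det continuous_on_vec_lambda continuous_on_if_const continuous_intros)
    then have "(\<lambda>A::real^'n^'n. det (\<chi> i j. if j = k then axis l 1 $ i else A $ i $ j)) \<in> borel_measurable borel"
      by (rule borel_measurable_continuous_onI)
    then show ?thesis unfolding cramer_inv_def by simp
  qed
  then show ?thesis
    by (intro borel_measurable_vecI)
qed

lemma open_invertible: "open {A :: real^'n^'n. invertible A}"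
  unfolding invertible_det_nz
  by (intro open_Collect_neq continuous_on_det continuous_on_id continuous_on_const)

lemma isCont_matrix_inv:
  fixes A :: "real^'n^'n"
  assumes "invertible A"
  shows "isCont matrix_inv A"
proof -
  have "continuous_on {A :: real^'n^'n. invertible A} cramer_inv"
    unfolding cramer_inv_def
    by (intro continuous_on_vec_lambda continuous_on_divide continuous_on_det continuous_on_if_const
          continuous_intros) (auto simp: invertible_det_nz)
  then have "continuous_on {A :: real^'n^'n. invertible A} matrix_inv"
    by (subst continuous_on_cong[OF refl matrix_inv_eq_cramer_inv]) auto
  then show ?thesis
    using assms open_invertible continuous_on_eq_continuous_at by blast
qed

text \<open>With S the inverse of A, the first-order remainder is exactly -S (y - A) (y^-1 - S), so
  continuity of inversion alone makes it o(|y - A|).\<close>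

lemma has_derivative_matrix_inv:
  fixes A :: "real^'n^'n"
  assumes A: "invertible A"
  shows "(matrix_inv has_derivative (\<lambda>H. - (matrix_inv A ** H ** matrix_inv A))) (at A)"
proof -
  interpret bb: bounded_bilinear "\<lambda>(A::real^'n^'n) (B::real^'n^'n). A ** B"
    by (rule bounded_bilinear_matrix_mult)
  from bb.pos_bounded obtain K where K0: "K > 0" "\<forall>(a::real^'n^'n) (b::real^'n^'n). norm (a ** b) \<le> norm a * norm b * K"
    by auto
  note K = K0(1) K0(2)[rule_format]
  define S where "S = matrix_inv A"
  show ?thesis
    unfolding has_derivative_iff_norm S_def[symmetric]
  proof
    show "bounded_linear (\<lambda>H. - (S ** H ** S))"
      by (intro bounded_linear_minus bounded_linear_compose[OF bb.bounded_linear_left bb.bounded_linear_right])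
    have ev: "\<forall>\<^sub>F y in at A. invertible y"
      using open_invertible A by (auto simp: eventually_at_topological)
    have "((\<lambda>y. K * K * norm S * norm (matrix_inv y - S)) \<longlongrightarrow> K * K * norm S * norm (S - S)) (at A)"
      using isCont_matrix_inv[OF A] unfolding S_def by (intro tendsto_intros) (simp add: isCont_def)
    then have lim: "((\<lambda>y. K * K * norm S * norm (matrix_inv y - S)) \<longlongrightarrow> 0) (at A)" by simp
    show "((\<lambda>y. norm (matrix_inv y - S - - (S ** (y - A) ** S)) / norm (y - A)) \<longlongrightarrow> 0) (at A)"
    proof (rule Lim_null_comparison[OF _ lim])
      show "\<forall>\<^sub>F y in at A. norm (norm (matrix_inv y - S - - (S ** (y - A) ** S)) / norm (y - A))
               \<le> K * K * norm S * norm (matrix_inv y - S)"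
        using ev eventually_neq_at_within[of A A UNIV]
      proof eventually_elim
        case (elim y)
        have y: "y ** matrix_inv y = mat 1" and SA: "S ** A = mat 1"
          using elim A by (auto simp: S_def matrix_inv_right matrix_inv_left)
        have "S ** (y - A) ** (matrix_inv y - S) = S ** y ** matrix_inv y - S ** A ** matrix_inv y - S ** (y - A) ** S"
          by (simp add: bb.diff_left bb.diff_right algebra_simps)
        also have "\<dots> = - (matrix_inv y - S - - (S ** (y - A) ** S))"
          by (simp add: SA y matrix_mul_assoc[symmetric])
        finally have "norm (matrix_inv y - S - - (S ** (y - A) ** S)) = norm (S ** (y - A) ** (matrix_inv y - S))"
          by (metis norm_minus_cancel)
        also have "\<dots> \<le> norm (S ** (y - A)) * norm (matrix_inv y - S) * K" by (rule K)
        also have "\<dots> \<le> (norm S * norm (y - A) * K) * norm (matrix_inv y - S) * K"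
          by (intro mult_right_mono K) (use K in auto)
        finally show ?case using elim(2)
          by (simp add: divide_le_eq mult_ac)
      qed
    qed
  qed
qed

text \<open>Only the quadratic clause of \<open>pos_def\<close> is open among all matrices;
  \<open>conc\<close> and \<open>group_cov\<close> are symmetric by construction. The radius is the
  minimum of the form on the unit sphere divided by the bilinear bound K.\<close>

lemma open_pos_quadratic: "open {S :: real^'n^'n. \<forall>x. x \<noteq> 0 \<longrightarrow> 0 < x \<bullet> (S *v x)}"
proof (rule openI, clarify)
  fix A :: "real^'n^'n" assume A: "\<forall>x. x \<noteq> 0 \<longrightarrow> 0 < x \<bullet> (A *v x)"
  have bb: "bounded_bilinear (\<lambda>(A::real^'n^'n) (x::real^'n). A *v x)"
    by (intro bilinear_conv_bounded_bilinear[THEN iffD1])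
       (auto simp: bilinear_def linear_iff vec_eq_iff matrix_vector_mult_def sum.distrib algebra_simps sum_distrib_left)
  obtain K where K: "K > 0" "\<And>(a::real^'n^'n) (b::real^'n). norm (a *v b) \<le> norm a * norm b * K"
    using bounded_bilinear.pos_bounded[OF bb] by auto
  have 2: "sphere (0::real^'n) 1 \<noteq> {}" by (simp add: sphere_eq_empty)
  have 3: "continuous_on (sphere (0::real^'n) 1) (\<lambda>x. x \<bullet> (A *v x))"
    by (intro continuous_intros)
  from continuous_attains_inf[OF compact_sphere 2 3]
  obtain z where z: "norm z = 1" and min: "\<And>y. norm y = 1 \<Longrightarrow> z \<bullet> (A *v z) \<le> y \<bullet> (A *v y)"
    by (auto simp: dist_norm)
  define m where "m = z \<bullet> (A *v z)"
  have "z \<noteq> 0" using z by auto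
  then have m: "m > 0" using A by (auto simp: m_def)
  have "0 < x \<bullet> (B *v x)" if B: "B \<in> ball A (m / K)" and x: "x \<noteq> 0" for B x
  proof -
    define y where "y = (1 / norm x) *\<^sub>R x"
    have y: "norm y = 1" using x by (simp add: y_def)
    have "y \<bullet> ((A - B) *v y) \<le> norm y * norm ((A - B) *v y)" by (rule norm_cauchy_schwarz)
    also have "\<dots> \<le> norm (A - B) * K" using K(2)[of "A - B" y] y by simp
    also have "\<dots> < m" using B K(1) by (simp add: dist_norm field_simps)
    also have "m \<le> y \<bullet> (A *v y)" using min y by (simp add: m_def)
    finally have "0 < y \<bullet> (B *v y)"
      by (simp add: matrix_vector_mult_diff_rdistrib inner_diff_right)
    then have "0 < (x \<bullet> (B *v x)) / (norm x)^2"
      by (simp add: y_def matrix_vector_mult_scaleR power2_eq_square)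
    then show ?thesis using x by (simp add: zero_less_divide_iff)
  qed
  then show "\<exists>e>0. ball A e \<subseteq> {S. \<forall>x. x \<noteq> 0 \<longrightarrow> 0 < x \<bullet> (S *v x)}"
    using m K(1) by (intro exI[of _ "m / K"]) auto
qed

section \<open>Rank-one matrices and rank-one updates\<close>

definition outer :: "real^'n \<Rightarrow> real^'n \<Rightarrow> real^'n^'n" where
  "outer x y = (\<chi> a b. x $ a * y $ b)"

lemma outer_mult_vec: "outer x y *v z = (y \<bullet> z) *\<^sub>R x"
  by (simp add: outer_def vec_eq_iff matrix_vector_mult_def inner_vec_def sum_distrib_left mult_ac)

lemma trace_mult_outer: "trace (M ** outer x y) = y \<bullet> (M *v x)"
  unfolding trace_def matrix_matrix_mult_def matrix_vector_mult_def inner_vec_def outer_def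
  by (simp add: sum_distrib_left mult_ac)

lemma transpose_outer: "transpose (outer x y) = outer y x"
  by (simp add: outer_def transpose_def vec_eq_iff)

lemma outer_mult: "A ** outer x y ** transpose B = outer (A *v x) (B *v y)"
  by (simp add: outer_def vec_eq_iff matrix_matrix_mult_def matrix_vector_mult_def transpose_def
      sum_distrib_left sum_distrib_right mult_ac sum_product)

lemma outer_add_left: "outer (x + y) z = outer x z + outer y z"
  and outer_add_right: "outer z (x + y) = outer z x + outer z y"
  by (simp_all add: outer_def vec_eq_iff algebra_simps)

text \<open>Apply \<open>log_det_le\<close> to L and the inverse S of L + x x^T: tr (L S) = p - x .
  S x is strictly below p. The update serves to improve the likelihood in a direction x where the
  covariance is not positive.\<close>

lemma log_det_less_rank_one_update:
  fixes L :: "real^'p^'p"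
  assumes L: "pos_def L" and x: "x \<noteq> 0"
  shows "pos_def (L + outer x x)" "ln (det L) < ln (det (L + outer x x))"
proof -
  let ?L = "L + outer x x"
  have "0 < y \<bullet> (?L *v y)" if "y \<noteq> 0" for y
  proof -
    have "y \<bullet> (?L *v y) = y \<bullet> (L *v y) + (x \<bullet> y)^2"
      by (simp add: matrix_vector_mult_add_rdistrib inner_add_right outer_mult_vec power2_eq_square inner_commute)
    then show ?thesis using L that by (simp add: pos_def_def add_pos_nonneg)
  qed
  moreover have "transpose (L + outer x x) = L + outer x x"
    using L by (simp add: pos_def_def transpose_def outer_def vec_eq_iff mult.commute)
  ultimately show pd: "pos_def ?L"
    by (simp add: pos_def_def)
  define S where "S = matrix_inv ?L"
  have S: "pos_def S" unfolding S_def by (rule pos_def_matrix_inv[OF pd])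
  have "trace (L ** S) = trace ((?L ** S) - outer x x ** S)"
    by (simp add: matrix_mult_add_left)
  also have "\<dots> = CARD('p) - trace (S ** outer x x)"
    unfolding trace_sub trace_mul_sym[of "outer x x"]
    by (simp add: S_def matrix_inv_right[OF pos_def_invertible[OF pd]] trace_I)
  also have "\<dots> = CARD('p) - x \<bullet> (S *v x)" by (simp add: trace_mult_outer)
  also have "\<dots> < CARD('p)" using S x by (simp add: pos_def_def)
  finally have "trace (L ** S) < CARD('p)" .
  moreover have "ln (det S) = - ln (det ?L)"
    using pos_def_det_pos[OF pd] by (simp add: S_def det_matrix_inv pos_def_invertible[OF pd] ln_div)
  ultimately show "ln (det L) < ln (det ?L)"
    using log_det_le(1)[OF L S] by simp
qed

section \<open>Linear changes of variables\<close>

lemma nn_integral_lborel_translate: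
  fixes f :: "'a::euclidean_space \<Rightarrow> ennreal"
  assumes [measurable]: "f \<in> borel_measurable borel"
  shows "(\<integral>\<^sup>+x. f (c + x) \<partial>lborel) = (\<integral>\<^sup>+x. f x \<partial>lborel)"
  by (subst (2) lborel_distr_plus[symmetric, of c]) (simp add: nn_integral_distr)

lemma nn_integral_lborel_translate':
  fixes f :: "'a::euclidean_space \<Rightarrow> ennreal"
  assumes "f \<in> borel_measurable borel"
  shows "(\<integral>\<^sup>+x. f (x + c) \<partial>lborel) = (\<integral>\<^sup>+x. f x \<partial>lborel)"
  using nn_integral_lborel_translate[OF assms, of c] by (simp add: add.commute)

lemma nn_integral_lborel_uminus:
  fixes f :: "'a::euclidean_space \<Rightarrow> ennreal"
  assumes [measurable]: "f \<in> borel_measurable borel"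
  shows "(\<integral>\<^sup>+x. f (- x) \<partial>lborel) = (\<integral>\<^sup>+x. f x \<partial>lborel)"
  by (subst (2) lborel_affine[of "-1" 0]) (simp_all add: nn_integral_distr nn_integral_density)

lemma emeasure_lborel_open_pos:
  fixes S :: "'a::euclidean_space set"
  assumes "open S" "S \<noteq> {}"
  shows "emeasure lborel S > 0"
proof -
  obtain x e where "e > 0" "ball x e \<subseteq> S"
    using assms by (meson openE equals0I)
  then have "emeasure lborel (ball x e) \<le> emeasure lborel S"
    using assms by (intro emeasure_mono) auto
  moreover have "emeasure lborel (ball x e) > 0"
    using content_ball_pos[OF \<open>e > 0\<close>, of x] by (metis emeasure_eq_ennreal_measure emeasure_lborel_ball_finite
        ennreal_less_zero_iff infinity_ennreal_def less_irrefl)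
  ultimately show ?thesis by order
qed

text \<open>The scale factor exists because \<open>h \<mapsto> \<integral> h (f x) dx\<close> is translation invariant,
  hence a multiple of Lebesgue measure.\<close>

lemma linear_scale_exists:
  fixes f :: "'a::euclidean_space \<Rightarrow> 'a"
  assumes f: "linear f" "bij f"
  shows "\<exists>c>0. \<forall>h\<in>borel_measurable borel. (\<integral>\<^sup>+x. h x \<partial>lborel) = ennreal c * (\<integral>\<^sup>+x. h (f x) \<partial>lborel)"
proof -
  define g where "g = inv f"
  have g: "linear g"
    unfolding g_def using f by (simp add: bij_is_inj inj_linear_imp_inv_linear)
  have gf: "g (f x) = x" "f (g x) = x" for x
    using f(2) by (simp_all add: g_def bij_is_inj bij_is_surj surj_f_inv_f)
  have cont: "continuous_on UNIV f" "continuous_on UNIV g"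
    using f g by (auto intro: linear_continuous_on linear_conv_bounded_linear[THEN iffD1])
  have [measurable]: "f \<in> borel_measurable borel"
    using cont by (simp add: borel_measurable_continuous_onI)
  define k :: "'a \<Rightarrow> ennreal" where "k = indicator (ball 0 1)"
  have [measurable]: "k \<in> borel_measurable borel" unfolding k_def by (intro borel_measurable_indicator) simp
  define a where "a = (\<integral>\<^sup>+x. k x \<partial>lborel)"
  define b where "b = (\<integral>\<^sup>+x. k (- f x) \<partial>lborel)"
  \<comment> \<open>Tonelli for k y times h (f x + y). Integrating over x first uses that the result
    does not depend on y; integrating over y first uses translation invariance of
    \<open>lborel\<close>.\<close>
  have eq: "a * (\<integral>\<^sup>+x. h (f x) \<partial>lborel) = b * (\<integral>\<^sup>+x. h x \<partial>lborel)" if [measurable]: "h \<in> borel_measurable borel" for h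
  proof -
    have inv: "(\<integral>\<^sup>+x. h (f x + y) \<partial>lborel) = (\<integral>\<^sup>+x. h (f x) \<partial>lborel)" 
      if [measurable]: "h \<in> borel_measurable borel" for h :: "'a \<Rightarrow> ennreal" and y
      using nn_integral_lborel_translate'[of "\<lambda>x. h (f x)" "g y"] f(1) by (simp add: linear_add gf)
    have "a * (\<integral>\<^sup>+x. h (f x) \<partial>lborel) = (\<integral>\<^sup>+y. k y * (\<integral>\<^sup>+x. h (f x + y) \<partial>lborel) \<partial>lborel)"
      by (simp add: a_def inv nn_integral_multc)
    also have "\<dots> = (\<integral>\<^sup>+y. (\<integral>\<^sup>+x. k y * h (f x + y) \<partial>lborel) \<partial>lborel)"
      by (simp add: nn_integral_cmult)
    also have "\<dots> = (\<integral>\<^sup>+x. (\<integral>\<^sup>+y. k y * h (f x + y) \<partial>lborel) \<partial>lborel)"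
      by (rule lborel_pair.Fubini') simp
    also have "\<dots> = (\<integral>\<^sup>+x. (\<integral>\<^sup>+y. k (y + - f x) * h y \<partial>lborel) \<partial>lborel)"
      using nn_integral_lborel_translate[of "\<lambda>y. k (y + - f x) * h y" "f x" for x] by simp
    also have "\<dots> = (\<integral>\<^sup>+y. (\<integral>\<^sup>+x. k (y + - f x) * h y \<partial>lborel) \<partial>lborel)"
      by (rule lborel_pair.Fubini') simp
    also have "\<dots> = (\<integral>\<^sup>+y. (\<integral>\<^sup>+x. k (- (f x + - y)) \<partial>lborel) * h y \<partial>lborel)"
      by (simp add: nn_integral_multc)
    also have "\<dots> = b * (\<integral>\<^sup>+y. h y \<partial>lborel)"
      by (subst inv) (simp_all add: b_def nn_integral_cmult)
    finally show ?thesis .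
  qed
  have a: "a > 0" "a < \<infinity>"
    using emeasure_lborel_open_pos[of "ball (0::'a) 1"] emeasure_lborel_ball_finite[of "0::'a" 1]
    by (simp_all add: a_def k_def less_top)
  have op: "open (f -` ball 0 1)" using cont(1) by (intro open_vimage) auto
  have "b = (\<integral>\<^sup>+x. indicator (f -` ball 0 1) x \<partial>lborel)"
    unfolding b_def k_def by (intro nn_integral_cong) (simp add: indicator_def)
  then have b_eq: "b = emeasure lborel (f -` ball 0 1)"
    using op by simp
  have "0 \<in> f -` ball 0 1" using f(1) by (simp add: linear_0)
  then have "b > 0" unfolding b_eq using op by (intro emeasure_lborel_open_pos) auto
  obtain B where B: "B > 0" "\<And>x. norm (g x) \<le> B * norm x"
    using linear_bounded_pos[OF g] by blast
  \<comment> \<open>The preimage of the unit ball is bounded because the inverse g is; so b is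
    finite and a / b is a genuine positive real.\<close>
  have "f -` ball 0 1 \<subseteq> ball 0 B"
  proof
    fix x assume "x \<in> f -` ball 0 1"
    then have "norm (f x) < 1" by (simp add: dist_norm)
    moreover have "norm x \<le> B * norm (f x)" using B(2)[of "f x"] by (simp add: gf)
    ultimately show "x \<in> ball 0 B" using B(1)
      by (simp add: dist_norm) (metis less_le_trans mult.right_neutral mult_less_cancel_left_pos not_less)
  qed
  then have "b \<le> emeasure lborel (ball (0::'a) B)" unfolding b_eq by (intro emeasure_mono) auto
  then have "b < \<infinity>" using emeasure_lborel_ball_finite[of "0::'a" B] by (metis infinity_ennreal_def le_less_trans)
  define c where "c = enn2real a / enn2real b"
  have "c > 0" using a \<open>b > 0\<close> \<open>b < \<infinity>\<close> by (simp add: c_def enn2real_positive_iff)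
  moreover have "(\<integral>\<^sup>+x. h x \<partial>lborel) = ennreal c * (\<integral>\<^sup>+x. h (f x) \<partial>lborel)" if h: "h \<in> borel_measurable borel" for h
  proof -
    have "ennreal c = a / b"
      using a \<open>b > 0\<close> \<open>b < \<infinity>\<close> by (simp add: c_def divide_ennreal[symmetric] enn2real_positive_iff)
    then have "ennreal c * (\<integral>\<^sup>+x. h (f x) \<partial>lborel) = (a * (\<integral>\<^sup>+x. h (f x) \<partial>lborel)) / b"
      by (simp add: divide_ennreal_def mult_ac)
    also have "\<dots> = (\<integral>\<^sup>+x. h x \<partial>lborel)"
      using ennreal_mult_divide_eq[of b "\<integral>\<^sup>+x. h x \<partial>lborel"] \<open>b > 0\<close> \<open>b < \<infinity>\<close>
      by (simp add: eq[OF h] mult.commute less_le)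
    finally show ?thesis ..
  qed
  ultimately show ?thesis by blast
qed

text \<open>The absolute determinant of f, defined by its effect on Lebesgue integrals so that it is
  available on every Euclidean space without a matrix. The factor stands beside
  \<open>h (f x)\<close>, which yields |det f| and not its inverse.\<close>

definition lin_scale :: "('a::euclidean_space \<Rightarrow> 'a) \<Rightarrow> real" where
  "lin_scale f = (SOME c. c > 0 \<and> (\<forall>h\<in>borel_measurable borel. (\<integral>\<^sup>+x. h x \<partial>lborel) = ennreal c * (\<integral>\<^sup>+x. h (f x) \<partial>lborel)))"

lemma
  fixes f :: "'a::euclidean_space \<Rightarrow> 'a"
  assumes f: "linear f" "bij f"
  shows lin_scale_pos: "lin_scale f > 0"
    and nn_integral_lin_scale: "h \<in> borel_measurable borel \<Longrightarrow>
       (\<integral>\<^sup>+x. h x \<partial>lborel) = ennreal (lin_scale f) * (\<integral>\<^sup>+x. h (f x) \<partial>lborel)"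
  using someI_ex[OF linear_scale_exists[OF f, unfolded Bex_def]] unfolding lin_scale_def by blast+

lemma lin_scale_unique:
  fixes f :: "'a::euclidean_space \<Rightarrow> 'a"
  assumes f: "linear f" "bij f" and c: "c \<ge> 0"
    and eq: "\<And>h. h \<in> borel_measurable borel \<Longrightarrow> (\<integral>\<^sup>+x. h x \<partial>lborel) = ennreal c * (\<integral>\<^sup>+x. h (f x) \<partial>lborel)"
  shows "lin_scale f = c"
proof -
  define h :: "'a \<Rightarrow> ennreal" where "h = indicator (ball 0 1)"
  have [measurable]: "h \<in> borel_measurable borel" unfolding h_def by (intro borel_measurable_indicator) simp
  have h: "(\<integral>\<^sup>+x. h x \<partial>lborel) > 0" "(\<integral>\<^sup>+x. h x \<partial>lborel) < \<infinity>"
    using emeasure_lborel_open_pos[of "ball (0::'a) 1"] emeasure_lborel_ball_finite[of "0::'a" 1]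
    by (simp_all add: h_def less_top)
  define I where "I = (\<integral>\<^sup>+x. h (f x) \<partial>lborel)"
  have 1: "(\<integral>\<^sup>+x. h x \<partial>lborel) = ennreal c * I"
    unfolding I_def by (rule eq) simp
  have 2: "(\<integral>\<^sup>+x. h x \<partial>lborel) = ennreal (lin_scale f) * I"
    unfolding I_def by (rule nn_integral_lin_scale[OF f]) simp
  have "I \<noteq> 0" "I \<noteq> \<top>"
    using h 2 lin_scale_pos[OF f] by (auto simp: ennreal_mult_top)
  then have "ennreal (lin_scale f) = ennreal c"
    using 1 2 by (metis ennreal_mult_cancel_left mult.commute)
  then show ?thesis using c lin_scale_pos[OF f] by simp
qed

lemma lin_scale_comp:
  fixes f g :: "'a::euclidean_space \<Rightarrow> 'a"
  assumes f: "linear f" "bij f" and g: "linear g" "bij g"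
  shows "lin_scale (f \<circ> g) = lin_scale f * lin_scale g"
proof (rule lin_scale_unique)
  have [measurable]: "f \<in> borel_measurable borel"
    using f by (intro borel_measurable_continuous_onI linear_continuous_on linear_conv_bounded_linear[THEN iffD1])
  show "(\<integral>\<^sup>+x. h x \<partial>lborel) = ennreal (lin_scale f * lin_scale g) * (\<integral>\<^sup>+x. h ((f \<circ> g) x) \<partial>lborel)"
    if [measurable]: "h \<in> borel_measurable borel" for h
    using nn_integral_lin_scale[OF f, of h] nn_integral_lin_scale[OF g, of "\<lambda>x. h (f x)"]
      lin_scale_pos[OF f] lin_scale_pos[OF g]
    by (simp add: ennreal_mult mult.assoc)
qed (use f g lin_scale_pos[OF f] lin_scale_pos[OF g] in \<open>auto simp: linear_compose bij_comp\<close>)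

lemma lin_scale_scaling:
  fixes d :: "'n::finite \<Rightarrow> real"
  assumes d: "\<And>i. d i \<noteq> 0"
  shows "lin_scale (\<lambda>x::real^'n. \<chi> i. d i * x $ i) = (\<Prod>i\<in>UNIV. \<bar>d i\<bar>)"
proof (rule lin_scale_unique)
  let ?f = "\<lambda>x::real^'n. \<chi> i. d i * x $ i"
  show lin: "linear ?f"
    by (simp add: linear_iff vec_eq_iff algebra_simps)
  show "bij ?f"
    by (rule o_bij[where g="\<lambda>x::real^'n. \<chi> i. x $ i / d i"]) (use d in \<open>auto simp: vec_eq_iff\<close>)
  \<comment> \<open>\<open>lborel_affine_euclidean\<close> indexes its factors by basis vectors;
    \<open>THE i. j = axis i 1\<close> translates them back to coordinates.\<close>
  define T where "T = (\<lambda>x::real^'n. 0 + (\<Sum>j\<in>Basis. (d (THE i. j = axis i 1) * (x \<bullet> j)) *\<^sub>R j))"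
  have the: "(THE k. axis i (1::real) = axis k 1) = i" for i :: 'n
    by (auto simp: axis_eq_axis)
  have Basis: "(Basis :: (real^'n) set) = (\<lambda>i. axis i 1) ` UNIV"
    by (auto simp: Basis_vec_def)
  have inj: "inj (\<lambda>i::'n. axis i (1::real))"
    by (auto simp: inj_on_def axis_eq_axis)
  have T: "T x = ?f x" for x
  proof -
    have "T x = (\<Sum>i\<in>UNIV. (d i * x $ i) *\<^sub>R axis i 1)"
      unfolding T_def Basis sum.reindex[OF inj] o_def the by (simp add: inner_axis)
    then show ?thesis
      by (simp add: vec_eq_iff axis_def mult_delta_right)
  qed
  have leb: "lborel = density (distr lborel borel T) (\<lambda>_. (\<Prod>j\<in>(Basis :: (real^'n) set). \<bar>d (THE i. j = axis i 1)\<bar>))"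
    unfolding T_def by (rule lborel_affine_euclidean[where c="\<lambda>j::real^'n. d (THE i. j = axis i 1)" and t=0]) (auto simp: Basis the d)
  have [measurable]: "?f \<in> borel_measurable borel"
    by (intro borel_measurable_continuous_onI linear_continuous_on linear_conv_bounded_linear[THEN iffD1] lin)
  have "(\<Prod>j\<in>(Basis :: (real^'n) set). \<bar>d (THE i. j = axis i 1)\<bar>) = (\<Prod>i\<in>UNIV. \<bar>d i\<bar>)"
    unfolding Basis prod.reindex[OF inj] o_def the ..
  then show "(\<integral>\<^sup>+x. h x \<partial>lborel) = ennreal (\<Prod>i\<in>UNIV. \<bar>d i\<bar>) * (\<integral>\<^sup>+x. h (?f x) \<partial>lborel)"
    if [measurable]: "h \<in> borel_measurable borel" for h
    by (subst leb) (simp add: T[abs_def] nn_integral_density nn_integral_distr nn_integral_cmult)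
qed (simp add: prod_nonneg)

text \<open>If D conjugates f into its square, the scale c of f satisfies c = c^2 and is therefore
  1. This takes the place of a determinant computation for shears.\<close>

lemma lin_scale_commute_square:
  fixes f D :: "'a::euclidean_space \<Rightarrow> 'a"
  assumes f: "linear f" "bij f" and D: "linear D" "bij D" and eq: "D \<circ> f = f \<circ> f \<circ> D"
  shows "lin_scale f = 1"
proof -
  have "lin_scale D * lin_scale f = lin_scale f * lin_scale f * lin_scale D"
    using arg_cong[OF eq, of lin_scale] f D
    by (simp add: lin_scale_comp linear_compose bij_comp)
  then show ?thesis using lin_scale_pos[OF f] lin_scale_pos[OF D] by simp
qed

text \<open>A multiplicative character of \<open>GL\<close> is determined by its values on diagonal matrices:
  an elementary shear \<open>E\<close> is conjugate to its square by a diagonal matrix, and a transposition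
  squares to the identity.\<close>

lemma gl_character:
  fixes \<psi> :: "real^'p^'p \<Rightarrow> real"
  assumes mult: "\<And>A B. invertible A \<Longrightarrow> invertible B \<Longrightarrow> \<psi> (A ** B) = \<psi> A * \<psi> B"
    and pos: "\<And>A. invertible A \<Longrightarrow> \<psi> A > 0"
    and diag: "\<And>d. (\<And>a. d a \<noteq> 0) \<Longrightarrow> \<psi> (diag_mat d) = (\<Prod>a\<in>UNIV. \<bar>d a\<bar>) ^ q"
    and A: "invertible A"
  shows "\<psi> A = \<bar>det A\<bar> ^ q"
proof -
  have "invertible A \<longrightarrow> \<psi> A = \<bar>det A\<bar> ^ q"
  proof (induction A rule: induct_matrix_elementary[case_names mult zero_row diagonal swap1 idplus])
    case (mult A B)
    then show ?case
      using assms(1)[of A B] by (auto simp: invertible_det_nz det_mul abs_mult power_mult_distrib)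
  next
    case (zero_row A i)
    then have "det A = 0"
      using det_zero_row(1)[of i A] by simp
    then show ?case by (simp add: invertible_det_nz)
  next
    case (diagonal A)
    then have A: "A = diag_mat (\<lambda>i. A $ i $ i)"
      by (auto simp: vec_eq_iff diag_mat_def)
    have "invertible A \<Longrightarrow> A $ i $ i \<noteq> 0" for i
      by (subst (asm) A) (auto simp: invertible_det_nz det_diag_mat)
    then show ?case
      by (subst (2) A, subst (2) A) (auto simp: det_diag_mat diag abs_prod)
  next
    case (swap1 m n)
    define P :: "real^'p^'p" where "P = (\<chi> i j. mat 1 $ i $ Transposition.transpose m n j)"
    have Pe: "P $ i $ k = (if k = Transposition.transpose m n i then 1 else 0)" for i k
      by (auto simp: P_def mat_def)
    have PP: "P ** P = mat 1"
    proof -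
      have "(P ** P) $ i $ j = mat 1 $ i $ j" for i j
      proof -
        have "(P ** P) $ i $ j = P $ Transposition.transpose m n i $ j"
          by (simp add: matrix_matrix_mult_def Pe[of i] mult_delta_left)
        also have "\<dots> = mat 1 $ i $ j" by (auto simp: Pe mat_def)
        finally show ?thesis .
      qed
      then show ?thesis by (simp add: vec_eq_iff)
    qed
    then have inv: "invertible P" unfolding invertible_def by blast
    have "\<psi> (mat 1) = 1"
      using diag[of "\<lambda>_. 1"] by (simp add: diag_mat_def mat_def)
    then have "\<psi> P * \<psi> P = 1" using mult[OF inv inv] PP by simp
    then have "\<psi> P = 1" using pos[OF inv]
      by (metis abs_of_pos one_power2 power2_eq_iff_nonneg power2_eq_square less_imp_le zero_le_one)
    moreover have "det P * det P = 1" using PP by (metis det_I det_mul)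
    then have "\<bar>det P\<bar> = 1" by (metis abs_square_eq_1 power2_eq_square)
    ultimately show ?case by (simp add: P_def)
  next
    case (idplus m n c)
    define E :: "real \<Rightarrow> real^'p^'p" where "E = (\<lambda>c. \<chi> i j. if i = m \<and> j = n then c else of_bool (i = j))"
    define D :: "real^'p^'p" where "D = diag_mat (\<lambda>i. if i = m then 2 else 1)"
    have EE: "E a ** E b = E (a + b)" for a b
    proof -
      have "(E a ** E b) $ i $ j = E (a + b) $ i $ j" for i j
      proof (cases "i = m")
        case True
        have "(E a ** E b) $ i $ j = (\<Sum>k\<in>UNIV. (if k = m then E b $ m $ j else 0) + (if k = n then a * E b $ n $ j else 0))"
          using True idplus by (auto simp: matrix_matrix_mult_def E_def intro!: sum.cong)
        then show ?thesis using True idplus by (simp add: sum.distrib E_def)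
      next
        case False
        have "(E a ** E b) $ i $ j = (\<Sum>k\<in>UNIV. (if k = i then E b $ i $ j else 0))"
          using False by (auto simp: matrix_matrix_mult_def E_def intro!: sum.cong)
        then show ?thesis using False by (simp add: E_def)
      qed
      then show ?thesis by (simp add: vec_eq_iff)
    qed
    have E0: "E 0 = mat 1" using idplus by (auto simp: E_def mat_def vec_eq_iff)
    have inv: "invertible (E a)" for a
      using EE[of a "-a"] EE[of "-a" a] E0 unfolding invertible_def by auto
    have DE: "D ** E c = (E c ** E c) ** D"
    proof -
      have "(D ** E c) $ i $ j = (E (c + c) ** D) $ i $ j" for i j
      proof -
        have "(D ** E c) $ i $ j = (if i = m then 2 else 1) * E c $ i $ j"
          unfolding D_def by (simp add: matrix_matrix_mult_def diag_mat_def mult_delta_left)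
        also have "\<dots> = E (c + c) $ i $ j * (if j = m then 2 else 1)"
          using idplus by (auto simp: E_def)
        also have "\<dots> = (E (c + c) ** D) $ i $ j"
          unfolding D_def by (simp add: matrix_matrix_mult_def diag_mat_def mult_delta_right)
        finally show ?thesis .
      qed
      then show ?thesis by (simp add: vec_eq_iff EE)
    qed
    have D: "invertible D" by (simp add: D_def invertible_det_nz det_diag_mat)
    have "\<psi> D * \<psi> (E c) = (\<psi> (E c) * \<psi> (E c)) * \<psi> D"
      using mult[OF D inv] mult[OF inv inv] mult[OF inv D] DE by (metis EE)
    then have "\<psi> (E c) = 1" using pos[OF D] pos[OF inv[of c]] by simp
    moreover have "det D * det (E c) = (det (E c) * det (E c)) * det D"
      using DE by (metis det_mul)
    then have "det (E c) = 1"
      using D inv[of c] by (simp add: invertible_det_nz)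
    ultimately show ?case by (simp add: E_def)
  qed
  with A show ?thesis by blast
qed

text \<open>A tuple is the product of tuples that are the identity off one coordinate, and on each
  of these the case of a single matrix applies.\<close>

lemma gl_tuple_character:
  fixes \<psi> :: "('k::finite \<Rightarrow> real^'p^'p) \<Rightarrow> real"
  assumes mult: "\<And>A B. (\<And>i. invertible (A i)) \<Longrightarrow> (\<And>i. invertible (B i)) \<Longrightarrow> \<psi> (\<lambda>i. A i ** B i) = \<psi> A * \<psi> B"
    and pos: "\<And>A. (\<And>i. invertible (A i)) \<Longrightarrow> \<psi> A > 0"
    and diag: "\<And>d. (\<And>i a. d i a \<noteq> 0) \<Longrightarrow> \<psi> (\<lambda>i. diag_mat (d i)) = (\<Prod>i\<in>UNIV. \<Prod>a\<in>UNIV. \<bar>d i a\<bar>) ^ q"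
    and A: "\<And>i. invertible (A i)"
  shows "\<psi> A = (\<Prod>i\<in>UNIV. \<bar>det (A i)\<bar> ^ q)"
proof -
  have inv1: "invertible (mat 1 :: real^'p^'p)" by (simp add: invertible_det_nz)
  have single: "\<psi> (\<lambda>j. if j = i then B else mat 1) = \<bar>det B\<bar> ^ q" if "invertible B" for i and B :: "real^'p^'p"
  proof (rule gl_character[where \<psi>="\<lambda>B. \<psi> (\<lambda>j. if j = i then B else mat 1)"])
    fix A B :: "real^'p^'p" assume "invertible A" "invertible B"
    then show "\<psi> (\<lambda>j. if j = i then A ** B else mat 1) = \<psi> (\<lambda>j. if j = i then A else mat 1) * \<psi> (\<lambda>j. if j = i then B else mat 1)"
      by (subst mult[symmetric]) (auto simp: inv1 if_distrib intro!: arg_cong[of _ _ \<psi>])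
  next
    fix d :: "'p \<Rightarrow> real" assume d: "\<And>a. d a \<noteq> 0"
    have "(\<lambda>j. if j = i then diag_mat d else mat 1) = (\<lambda>j. diag_mat (if j = i then d else (\<lambda>_. 1)))"
      by (auto simp: fun_eq_iff diag_mat_def mat_def vec_eq_iff)
    then have "\<psi> (\<lambda>j. if j = i then diag_mat d else mat 1) = (\<Prod>j\<in>UNIV. \<Prod>a\<in>UNIV. \<bar>(if j = i then d else (\<lambda>_. 1)) a\<bar>) ^ q"
      using d by (simp add: diag)
    also have "(\<Prod>j\<in>UNIV. \<Prod>a\<in>UNIV. \<bar>(if j = i then d else (\<lambda>_. 1)) a\<bar>) = (\<Prod>j\<in>UNIV. if j = i then \<Prod>a\<in>UNIV. \<bar>d a\<bar> else 1)"
      by (intro prod.cong) auto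
    finally show "\<psi> (\<lambda>j. if j = i then diag_mat d else mat 1) = (\<Prod>a\<in>UNIV. \<bar>d a\<bar>) ^ q"
      by simp
  qed (use that pos inv1 in auto)
  have "\<psi> (\<lambda>j. if j \<in> S then A j else mat 1) = (\<Prod>i\<in>S. \<bar>det (A i)\<bar> ^ q)" if "finite S" for S
    using that
  proof (induction S rule: finite_induct)
    case empty
    show ?case using single[OF inv1, of undefined] by simp
  next
    case (insert i S)
    have "(\<lambda>j. if j \<in> insert i S then A j else mat 1) =
        (\<lambda>j. (if j = i then A i else mat 1) ** (if j \<in> S then A j else mat 1))"
      using insert.hyps by (auto simp: fun_eq_iff)
    then have "\<psi> (\<lambda>j. if j \<in> insert i S then A j else mat 1) =
        \<psi> (\<lambda>j. if j = i then A i else mat 1) * \<psi> (\<lambda>j. if j \<in> S then A j else mat 1)"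
      using A inv1 by (simp add: mult)
    then show ?case using insert A by (simp add: single)
  qed
  from this[of UNIV] show ?thesis by simp
qed

section \<open>Scale factors as absolute determinants\<close>

lemma linear_bij_matrix: "invertible A \<Longrightarrow> bij ((*v) (A :: real^'n^'n))"
  by (simp add: invertible_eq_bij)

lemma lin_scale_matrix:
  fixes A :: "real^'n^'n"
  assumes "invertible A"
  shows "lin_scale ((*v) A) = \<bar>det A\<bar>"
proof -
  have "lin_scale ((*v) A) = \<bar>det A\<bar> ^ 1"
  proof (rule gl_character[where \<psi>="\<lambda>A. lin_scale ((*v) A)"])
    fix A B :: "real^'n^'n" assume "invertible A" "invertible B"
    then show "lin_scale ((*v) (A ** B)) = lin_scale ((*v) A) * lin_scale ((*v) B)"
      by (subst lin_scale_comp[symmetric])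
         (auto simp: linear_bij_matrix o_def matrix_vector_mul_assoc)
  next
    fix d :: "'n \<Rightarrow> real" assume d: "\<And>a. d a \<noteq> 0"
    have "diag_mat d *v x = (\<chi> i. d i * x $ i)" for x
      by (simp add: vec_eq_iff matrix_vector_mult_def diag_mat_def mult_delta_left)
    then have "(*v) (diag_mat d) = (\<lambda>x. \<chi> i. d i * x $ i)" by (simp add: fun_eq_iff)
    then show "lin_scale ((*v) (diag_mat d)) = (\<Prod>a\<in>UNIV. \<bar>d a\<bar>) ^ 1"
      using lin_scale_scaling[of d] d by simp
  qed (use assms in \<open>auto simp: linear_bij_matrix intro: lin_scale_pos\<close>)
  then show ?thesis by simp
qed

lemma lin_scale_eq_abs_det:
  fixes f :: "real^'n \<Rightarrow> real^'n"
  assumes "linear f" "bij f"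
  shows "lin_scale f = \<bar>det (matrix f)\<bar>"
proof -
  have f: "f = (*v) (matrix f)" using assms(1) by (simp add: fun_eq_iff matrix_works)
  then have "invertible (matrix f)" using assms(2) by (simp add: invertible_eq_bij)
  then show ?thesis using lin_scale_matrix f by metis
qed

section \<open>The affine group acting on sufficient statistics\<close>

text \<open>The type \<open>param\<close> carries two kinds of objects: canonical parameters, where
  \<open>xi\<close> and \<open>conc\<close> are Lambda mu and Lambda, and statistics, where they are
  the sum of the observations and the sum of their outer squares. The \<open>SOME\<close> picks an
  order for an unordered pair, which is harmless for symmetric V, as \<open>conc_mk_param\<close>
  requires.\<close>

definition mk_param :: "('k::finite \<Rightarrow> real^'p::finite) \<Rightarrow> ('k \<Rightarrow> real^'p^'p) \<Rightarrow> ('k, 'p) param" where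
  "mk_param m V = (\<chi> z. case snd z of Inl a \<Rightarrow> m (fst z) $ a
     | Inr u \<Rightarrow> (let (a, b) = (SOME (a, b). u = Upair a b) in V (fst z) $ a $ b))"

lemma xi_mk_param [simp]: "xi (mk_param m V) i = m i"
  by (simp add: xi_def mk_param_def vec_eq_iff)

lemma conc_mk_param [simp]:
  assumes "transpose (V i) = V i"
  shows "conc (mk_param m V) i = V i"
proof -
  have "(let (a', b') = (SOME (a', b'). Upair a b = Upair a' b') in V i $ a' $ b') = V i $ a $ b" for a b
  proof -
    obtain a' b' where s: "(SOME (a', b'). Upair a b = Upair a' b') = (a', b')" by fastforce
    have "case (SOME (a', b'). Upair a b = Upair a' b') of (a', b') \<Rightarrow> Upair a b = Upair a' b'"
      by (rule someI[of _ "(a, b)"]) simp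
    then have "Upair a b = Upair a' b'" by (simp only: s prod.case)
    moreover have "V i $ b $ a = V i $ a $ b"
      using arg_cong[OF assms, of "\<lambda>M. M $ a $ b"] by (simp add: transpose_def)
    ultimately have "V i $ a' $ b' = V i $ a $ b" by auto
    then show ?thesis by (simp only: s Let_def prod.case)
  qed
  then show ?thesis
    by (simp add: conc_def mk_param_def vec_eq_iff)
qed

lemma transpose_conc [simp]: "transpose (conc \<phi> i) = conc \<phi> i"
  by (auto simp: transpose_def conc_def vec_eq_iff intro!: arg_cong[of _ _ "\<lambda>u. \<phi> $ (i, Inr u)"])

lemma param_eqI:
  fixes \<phi> \<psi> :: "('k::finite, 'p::finite) param"
  assumes "\<And>i. xi \<phi> i = xi \<psi> i" "\<And>i. conc \<phi> i = conc \<psi> i"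
  shows "\<phi> = \<psi>"
proof -
  have "\<phi> $ (i, x) = \<psi> $ (i, x)" for i x
  proof (cases x)
    case (Inl a)
    then show ?thesis using assms(1)[of i] by (simp add: xi_def vec_eq_iff)
  next
    case (Inr u)
    then show ?thesis using assms(2)[of i] by (cases u) (simp add: conc_def vec_eq_iff)
  qed
  then show ?thesis by (simp add: vec_eq_iff split_paired_all)
qed

lemma xi_add [simp]: "xi (\<phi> + \<psi>) i = xi \<phi> i + xi \<psi> i"
  and xi_scaleR [simp]: "xi (c *\<^sub>R \<phi>) i = c *\<^sub>R xi \<phi> i"
  and xi_diff [simp]: "xi (\<phi> - \<psi>) i = xi \<phi> i - xi \<psi> i"
  and xi_zero [simp]: "xi 0 i = 0"
  by (simp_all add: xi_def vec_eq_iff)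

lemma conc_add [simp]: "conc (\<phi> + \<psi>) i = conc \<phi> i + conc \<psi> i"
  and conc_scaleR [simp]: "conc (c *\<^sub>R \<phi>) i = c *\<^sub>R conc \<phi> i"
  and conc_diff [simp]: "conc (\<phi> - \<psi>) i = conc \<phi> i - conc \<psi> i"
  and conc_zero [simp]: "conc 0 i = 0"
  by (simp_all add: conc_def vec_eq_iff)

lemma transpose_add: "transpose (A + B) = transpose A + transpose (B :: real^'n^'m)"
  and transpose_scaleR: "transpose (c *\<^sub>R A) = c *\<^sub>R transpose (A :: real^'n^'m)"
  and transpose_minus: "transpose (A - B) = transpose A - transpose (B :: real^'n^'m)"
  by (simp_all add: transpose_def vec_eq_iff)

lemma linear_paramI:
  fixes f :: "('k::finite, 'p::finite) param \<Rightarrow> ('k, 'p) param"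
  assumes "\<And>x y i. xi (f (x + y)) i = xi (f x) i + xi (f y) i"
    and "\<And>x y i. conc (f (x + y)) i = conc (f x) i + conc (f y) i"
    and "\<And>c x i. xi (f (c *\<^sub>R x)) i = c *\<^sub>R xi (f x) i"
    and "\<And>c x i. conc (f (c *\<^sub>R x)) i = c *\<^sub>R conc (f x) i"
  shows "linear f"
  using assms by (auto simp: linear_iff intro!: param_eqI)

text \<open>Effect on the moments of the linear substitution y -> A y. With the covariances as A it
  is also the middle factor of \<open>info_op\<close>.\<close>

definition gl_act :: "('k \<Rightarrow> real^'p^'p) \<Rightarrow> ('k::finite, 'p::finite) param \<Rightarrow> ('k, 'p) param" where
  "gl_act A \<phi> = mk_param (\<lambda>i. A i *v xi \<phi> i) (\<lambda>i. A i ** conc \<phi> i ** transpose (A i))"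

lemma xi_gl_act [simp]: "xi (gl_act A \<phi>) i = A i *v xi \<phi> i"
  by (simp add: gl_act_def)

lemma conc_gl_act [simp]: "conc (gl_act A \<phi>) i = A i ** conc \<phi> i ** transpose (A i)"
  by (simp add: gl_act_def matrix_transpose_mul matrix_mul_assoc)

lemma linear_gl_act: "linear (gl_act A)"
  by (rule linear_paramI)
     (simp_all add: matrix_vector_right_distrib matrix_mult_add_left matrix_mult_add_right
        matrix_vector_mult_scaleR matrix_mult_scaleR_left matrix_mult_scaleR_right)

lemma gl_act_comp: "gl_act A \<circ> gl_act B = gl_act (\<lambda>i. A i ** B i)"
  by (auto intro!: param_eqI simp: fun_eq_iff matrix_vector_mul_assoc matrix_transpose_mul matrix_mul_assoc)

lemma gl_act_id: "gl_act (\<lambda>_. mat 1) = id"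
  by (auto intro!: param_eqI simp: fun_eq_iff)

lemma bij_gl_act:
  fixes A :: "'k::finite \<Rightarrow> real^'p::finite^'p"
  assumes "\<And>i. invertible (A i)"
  shows "bij (gl_act A)"
  by (rule o_bij[of "gl_act (\<lambda>i. matrix_inv (A i))"])
     (simp_all add: gl_act_comp gl_act_id matrix_inv_left matrix_inv_right assms)

text \<open>Each index a contributes p + 1 factors: one for every pair with a different index and
  two for the pair with itself.\<close>

lemma prod_uprod:
  fixes f :: "'p::finite \<Rightarrow> real"
  assumes "\<And>a b. F (Upair a b) = f a * f b"
  shows "(\<Prod>u\<in>UNIV. F u) = (\<Prod>a\<in>UNIV. f a) ^ (CARD('p) + 1)"
proof -
  have "(\<Prod>u\<in>{u. set_uprod u \<subseteq> S}. F u) = (\<Prod>a\<in>S. f a) ^ (card S + 1)" if "finite S" for S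
    using that
  proof (induction S)
    case empty
    have "{u::'p uprod. set_uprod u \<subseteq> {}} = {}"
    proof -
      have "set_uprod u \<noteq> {}" for u :: "'p uprod" by (cases u) simp
      then show ?thesis by simp
    qed
    then show ?case by simp
  next
    case (insert x S)
    have eq: "{u. set_uprod u \<subseteq> insert x S} = {u. set_uprod u \<subseteq> S} \<union> Upair x ` insert x S"
    proof (intro set_eqI)
      fix u :: "'p uprod"
      show "u \<in> {u. set_uprod u \<subseteq> insert x S} \<longleftrightarrow> u \<in> {u. set_uprod u \<subseteq> S} \<union> Upair x ` insert x S"
        by (cases u) auto
    qed
    have disj: "{u. set_uprod u \<subseteq> S} \<inter> Upair x ` insert x S = {}"
      using insert.hyps by auto
    have inj: "inj_on (Upair x) (insert x S)" by (auto simp: inj_on_def)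
    have "(\<Prod>u\<in>{u. set_uprod u \<subseteq> insert x S}. F u) = (\<Prod>a\<in>S. f a) ^ (card S + 1) * (\<Prod>a\<in>insert x S. f x * f a)"
    proof -
      have "prod F (Upair x ` insert x S) = (\<Prod>a\<in>insert x S. f x * f a)"
        by (simp only: prod.reindex[OF inj] o_def assms)
      then show ?thesis
        unfolding eq using disj by (subst prod.union_disjoint) (simp_all only: insert.IH finite)
    qed
    also have "\<dots> = (\<Prod>a\<in>insert x S. f a) ^ (card (insert x S) + 1)"
      using insert.hyps by (simp add: prod.distrib power_mult_distrib mult_ac)
    finally show ?case .
  qed
  from this[of UNIV] show ?thesis by simp
qed

text \<open>By the character argument only diagonal tuples need computing, and there the action is
  coordinatewise. The exponent p + 2 is 1 for the vector part plus p + 1 for the symmetric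
  part.\<close>

lemma lin_scale_gl_act:
  fixes A :: "'k::finite \<Rightarrow> real^'p::finite^'p"
  assumes A: "\<And>i. invertible (A i)"
  shows "lin_scale (gl_act A) = (\<Prod>i\<in>UNIV. \<bar>det (A i)\<bar> ^ (CARD('p) + 2))"
proof (rule gl_tuple_character[where \<psi>="\<lambda>A. lin_scale (gl_act A)"])
  fix A B :: "'k \<Rightarrow> real^'p^'p" assume "\<And>i. invertible (A i)" "\<And>i. invertible (B i)"
  then show "lin_scale (gl_act (\<lambda>i. A i ** B i)) = lin_scale (gl_act A) * lin_scale (gl_act B)"
    by (simp add: gl_act_comp[symmetric] lin_scale_comp linear_gl_act bij_gl_act)
next
  fix d :: "'k \<Rightarrow> 'p \<Rightarrow> real" assume d: "\<And>i a. d i a \<noteq> 0"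
  \<comment> \<open>The eigenvalues of the diagonal action; \<open>Abs_commute\<close> packs the
    symmetric product so that \<open>case_uprod\<close> can evaluate it at an unordered
    pair.\<close>
  define e where "e z = (case z of (i, Inl a) \<Rightarrow> d i a
     | (i, Inr u) \<Rightarrow> (case_uprod (Abs_commute (\<lambda>a b. d i a * d i b)) u))" for z :: "'k \<times> ('p + 'p uprod)"
  have e_Inl: "e (i, Inl a) = d i a" for i a by (simp add: e_def)
  have e_Inr: "e (i, Inr (Upair a b)) = d i a * d i b" for i a b
    by (simp add: e_def Abs_commute_inverse mult.commute)
  have "gl_act (\<lambda>i. diag_mat (d i)) \<phi> = (\<chi> z. e z * \<phi> $ z)" for \<phi> :: "('k, 'p) param"
  proof (rule param_eqI)
    fix i
    show "xi (gl_act (\<lambda>i. diag_mat (d i)) \<phi>) i = xi (\<chi> z. e z * \<phi> $ z) i"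
      by (simp add: vec_eq_iff xi_def[of "vec_lambda _"] e_Inl matrix_vector_mult_def diag_mat_def mult_delta_left)
         (simp add: xi_def)
    show "conc (gl_act (\<lambda>i. diag_mat (d i)) \<phi>) i = conc (\<chi> z. e z * \<phi> $ z) i"
      by (simp add: vec_eq_iff conc_def[of "vec_lambda _"] e_Inr transpose_def matrix_matrix_mult_def diag_mat_def mult_delta_left mult_delta_right)
         (simp add: conc_def)
  qed
  then have eq: "gl_act (\<lambda>i. diag_mat (d i)) = (\<lambda>\<phi>. \<chi> z. e z * \<phi> $ z)" by (simp add: fun_eq_iff)
  have e0: "e z \<noteq> 0" for z
  proof (cases z)
    case (Pair i x)
    show ?thesis
    proof (cases x)
      case (Inr u)
      then show ?thesis using Pair d by (cases u) (simp add: e_Inr)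
    qed (use Pair d in \<open>simp add: e_Inl\<close>)
  qed
  have "lin_scale (gl_act (\<lambda>i. diag_mat (d i)) :: ('k, 'p) param \<Rightarrow> _) = (\<Prod>z\<in>UNIV. \<bar>e z\<bar>)"
    unfolding eq by (rule lin_scale_scaling[OF e0])
  also have "\<dots> = (\<Prod>i\<in>UNIV. \<Prod>x\<in>UNIV. \<bar>e (i, x)\<bar>)"
    by (simp add: prod.cartesian_product)
  also have "\<dots> = (\<Prod>i\<in>UNIV. (\<Prod>a\<in>UNIV. \<bar>d i a\<bar>) ^ (CARD('p) + 2))"
  proof (intro prod.cong refl)
    fix i
    have "(\<Prod>x\<in>UNIV. \<bar>e (i, x)\<bar>) = (\<Prod>a\<in>UNIV. \<bar>e (i, Inl a)\<bar>) * (\<Prod>u\<in>UNIV. \<bar>e (i, Inr u)\<bar>)"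
      using prod.Plus[of UNIV UNIV "\<lambda>x. \<bar>e (i, x)\<bar>"] by (simp add: o_def)
    also have "(\<Prod>u\<in>UNIV. \<bar>e (i, Inr u)\<bar>) = (\<Prod>a\<in>UNIV. \<bar>d i a\<bar>) ^ (CARD('p) + 1)"
      by (rule prod_uprod) (simp add: e_Inr abs_mult)
    finally show "(\<Prod>x\<in>UNIV. \<bar>e (i, x)\<bar>) = (\<Prod>a\<in>UNIV. \<bar>d i a\<bar>) ^ (CARD('p) + 2)"
      by (simp add: e_Inl)
  qed
  also have "\<dots> = (\<Prod>i\<in>UNIV. \<Prod>a\<in>UNIV. \<bar>d i a\<bar>) ^ (CARD('p) + 2)"
    by (simp only: prod_power_distrib)
  finally show "lin_scale (gl_act (\<lambda>i. diag_mat (d i)) :: ('k, 'p) param \<Rightarrow> _) = (\<Prod>i\<in>UNIV. \<Prod>a\<in>UNIV. \<bar>d i a\<bar>) ^ (CARD('p) + 2)" .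
qed (use A in \<open>auto intro: lin_scale_pos linear_gl_act bij_gl_act\<close>)

section \<open>Group averages, group covariances and affine substitutions\<close>

lemma outer_scaleR_left: "outer (c *\<^sub>R x) y = c *\<^sub>R outer x y"
  and outer_scaleR_right: "outer x (c *\<^sub>R y) = c *\<^sub>R outer x y"
  by (simp_all add: outer_def vec_eq_iff)

definition group_avg :: "('k \<Rightarrow> real) \<Rightarrow> ('k::finite, 'p::finite) param \<Rightarrow> 'k \<Rightarrow> real^'p" where
  "group_avg N v i = (1 / N i) *\<^sub>R xi v i"

definition group_cov :: "('k \<Rightarrow> real) \<Rightarrow> ('k::finite, 'p::finite) param \<Rightarrow> 'k \<Rightarrow> real^'p^'p" where
  "group_cov N v i = (1 / N i) *\<^sub>R conc v i - outer (group_avg N v i) (group_avg N v i)"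

lemma transpose_group_cov [simp]: "transpose (group_cov N v i) = group_cov N v i"
  by (simp add: group_cov_def transpose_minus transpose_scaleR transpose_outer)

lemma xi_eq_avg: "N i \<noteq> 0 \<Longrightarrow> xi v i = N i *\<^sub>R group_avg N v i"
  by (simp add: group_avg_def)

lemma conc_eq_cov: "N i \<noteq> 0 \<Longrightarrow> conc v i = N i *\<^sub>R (group_cov N v i + outer (group_avg N v i) (group_avg N v i))"
  by (simp add: group_cov_def)

text \<open>Identities between statistics are checked through average and covariance, on which an
  affine substitution acts separately by m -> A m + b and C -> A C A^T; in the raw moments the two
  are mixed.\<close>

lemma param_eqI_avg_cov:
  fixes v w :: "('k::finite, 'p::finite) param"
  assumes "\<And>i. N i \<noteq> 0" "\<And>i. group_avg N v i = group_avg N w i" "\<And>i. group_cov N v i = group_cov N w i"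
  shows "v = w"
  using assms by (intro param_eqI) (simp_all add: xi_eq_avg[of N] conc_eq_cov[of N])

definition of_avg_cov :: "('k \<Rightarrow> real) \<Rightarrow> ('k \<Rightarrow> real^'p) \<Rightarrow> ('k \<Rightarrow> real^'p^'p) \<Rightarrow> ('k::finite, 'p::finite) param" where
  "of_avg_cov N m C = mk_param (\<lambda>i. N i *\<^sub>R m i) (\<lambda>i. N i *\<^sub>R (C i + outer (m i) (m i)))"

lemma group_avg_of_avg_cov: "N i \<noteq> 0 \<Longrightarrow> group_avg N (of_avg_cov N m C) i = m i"
  by (simp add: of_avg_cov_def group_avg_def)

lemma group_cov_of_avg_cov:
  "N i \<noteq> 0 \<Longrightarrow> transpose (C i) = C i \<Longrightarrow> group_cov N (of_avg_cov N m C) i = C i"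
  by (simp add: of_avg_cov_def group_cov_def group_avg_def transpose_add transpose_scaleR transpose_outer)

text \<open>The effect on the sufficient statistic of the substitution \<open>y \<mapsto> A y + b\<close> of the data.\<close>

definition affine_act :: "('k \<Rightarrow> real) \<Rightarrow> ('k \<Rightarrow> real^'p^'p) \<Rightarrow> ('k \<Rightarrow> real^'p) \<Rightarrow>
    ('k::finite, 'p::finite) param \<Rightarrow> ('k, 'p) param" where
  "affine_act N A b v = mk_param (\<lambda>i. A i *v xi v i + N i *\<^sub>R b i)
     (\<lambda>i. A i ** conc v i ** transpose (A i) + outer (A i *v xi v i) (b i) + outer (b i) (A i *v xi v i)
        + N i *\<^sub>R outer (b i) (b i))"

lemma xi_affine_act [simp]: "xi (affine_act N A b v) i = A i *v xi v i + N i *\<^sub>R b i"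
  by (simp add: affine_act_def)

lemma conc_affine_act [simp]:
  "conc (affine_act N A b v) i = A i ** conc v i ** transpose (A i) + outer (A i *v xi v i) (b i)
     + outer (b i) (A i *v xi v i) + N i *\<^sub>R outer (b i) (b i)"
  unfolding affine_act_def
  by (subst conc_mk_param) (simp_all add: transpose_add transpose_scaleR transpose_outer matrix_transpose_mul
      matrix_mul_assoc)

lemma group_avg_affine_act:
  "N i \<noteq> 0 \<Longrightarrow> group_avg N (affine_act N A b v) i = A i *v group_avg N v i + b i"
  by (simp add: group_avg_def matrix_vector_mult_scaleR scaleR_add_right)

lemma group_cov_affine_act:
  assumes "N i \<noteq> 0"
  shows "group_cov N (affine_act N A b v) i = A i ** group_cov N v i ** transpose (A i)"
proof -
  define m where "m = group_avg N v i"
  have m: "xi v i = N i *\<^sub>R m" using assms by (simp add: m_def xi_eq_avg[of N])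
  have "group_cov N (affine_act N A b v) i = (1 / N i) *\<^sub>R (A i ** conc v i ** transpose (A i))
     - outer (A i *v m) (A i *v m)"
    unfolding group_cov_def group_avg_affine_act[of N, OF assms] m_def[symmetric] conc_affine_act m
    using assms by (simp add: outer_add_left outer_add_right scaleR_add_right
        matrix_vector_mult_scaleR outer_scaleR_left outer_scaleR_right)
  then show ?thesis
    by (simp add: group_cov_def m_def bounded_bilinear.diff_left[OF bounded_bilinear_matrix_mult]
        bounded_bilinear.diff_right[OF bounded_bilinear_matrix_mult] outer_mult
        matrix_mult_scaleR_left matrix_mult_scaleR_right)
qed

lemma affine_act_affine_act:
  assumes "\<And>i. N i \<noteq> 0"
  shows "affine_act N A b (affine_act N A' b' v) = affine_act N (\<lambda>i. A i ** A' i) (\<lambda>i. A i *v b' i + b i) v"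
  by (rule param_eqI_avg_cov[where N=N])
     (simp_all add: assms group_avg_affine_act group_cov_affine_act matrix_vector_right_distrib
        matrix_vector_mul_assoc matrix_transpose_mul matrix_mul_assoc)

lemma affine_act_id: "(\<And>i. N i \<noteq> 0) \<Longrightarrow> affine_act N (\<lambda>_. mat 1) (\<lambda>_. 0) v = v"
  by (rule param_eqI_avg_cov[where N=N]) (simp_all add: group_avg_affine_act group_cov_affine_act)

text \<open>The linear part of the translation y -> y + b acting on the moments; what remains is a
  constant.\<close>

definition mean_shear :: "('k \<Rightarrow> real^'p) \<Rightarrow> ('k::finite, 'p::finite) param \<Rightarrow> ('k, 'p) param" where
  "mean_shear b v = mk_param (xi v) (\<lambda>i. conc v i + outer (xi v i) (b i) + outer (b i) (xi v i))"

lemma xi_mean_shear [simp]: "xi (mean_shear b v) i = xi v i"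
  by (simp add: mean_shear_def)

lemma conc_mean_shear [simp]: "conc (mean_shear b v) i = conc v i + outer (xi v i) (b i) + outer (b i) (xi v i)"
  unfolding mean_shear_def by (subst conc_mk_param) (simp_all add: transpose_add transpose_outer)

text \<open>The adjoint of \<open>mean_shear b\<close> for the form that pairs \<open>xi\<close> by
  the inner product and \<open>conc\<close> by half the trace. The two flank the middle factor of
  \<open>info_op\<close>, which thus has the shape U G U^T up to the weights.\<close>

definition conc_shear :: "('k \<Rightarrow> real^'p) \<Rightarrow> ('k::finite, 'p::finite) param \<Rightarrow> ('k, 'p) param" where
  "conc_shear b v = mk_param (\<lambda>i. xi v i + conc v i *v b i) (conc v)"

lemma xi_conc_shear [simp]: "xi (conc_shear b v) i = xi v i + conc v i *v b i"
  and conc_conc_shear [simp]: "conc (conc_shear b v) i = conc v i"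
  by (simp_all add: conc_shear_def)

lemma outer_minus_right: "outer x (- y) = - outer x y"
  and outer_minus_left: "outer (- x) y = - outer x y"
  by (simp_all add: outer_def vec_eq_iff)

lemma linear_mean_shear: "linear (mean_shear b)"
  by (rule linear_paramI) (simp_all add: outer_add_left outer_add_right outer_scaleR_left outer_scaleR_right scaleR_add_right)

lemma linear_conc_shear: "linear (conc_shear b)"
  by (rule linear_paramI) (simp_all add: matrix_vector_mult_add_rdistrib scaleR_matrix_vector_assoc[symmetric] scaleR_add_right)

lemma bij_mean_shear: "bij (mean_shear b)"
  by (rule o_bij[of "mean_shear (\<lambda>i. - b i)"])
     (auto simp: fun_eq_iff outer_minus_right outer_minus_left intro!: param_eqI)

lemma matrix_vector_mult_minus_right: "A *v (- x) = - (A *v x)" for A :: "real^'n^'m"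
  by (simp add: matrix_vector_mult_def vec_eq_iff sum_negf)

lemma bij_conc_shear: "bij (conc_shear b)"
  by (rule o_bij[of "conc_shear (\<lambda>i. - b i)"])
     (auto simp: fun_eq_iff matrix_vector_mult_minus_right intro!: param_eqI)

text \<open>Rescaling \<open>xi\<close> alone conjugates a shear into its square, with factor 1/2
  for \<open>mean_shear\<close> and 2 for \<open>conc_shear\<close>; this feeds
  \<open>lin_scale_commute_square\<close>.\<close>

definition scale_xi :: "real \<Rightarrow> ('k::finite, 'p::finite) param \<Rightarrow> ('k, 'p) param" where
  "scale_xi c v = mk_param (\<lambda>i. c *\<^sub>R xi v i) (conc v)"

lemma xi_scale_xi [simp]: "xi (scale_xi c v) i = c *\<^sub>R xi v i"
  and conc_scale_xi [simp]: "conc (scale_xi c v) i = conc v i"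
  by (simp_all add: scale_xi_def)

lemma linear_scale_xi: "linear (scale_xi c)"
  by (rule linear_paramI) (simp_all add: scaleR_add_right)

lemma bij_scale_xi: "c \<noteq> 0 \<Longrightarrow> bij (scale_xi c)"
  by (rule o_bij[of "scale_xi (1 / c)"]) (auto simp: fun_eq_iff intro!: param_eqI)

lemma lin_scale_mean_shear: "lin_scale (mean_shear b) = 1"
  by (rule lin_scale_commute_square[OF linear_mean_shear bij_mean_shear linear_scale_xi bij_scale_xi[of "1/2"]])
     (auto simp: fun_eq_iff outer_scaleR_left outer_scaleR_right intro!: param_eqI
       simp flip: scaleR_add_left)

lemma lin_scale_conc_shear: "lin_scale (conc_shear b) = 1"
  by (rule lin_scale_commute_square[OF linear_conc_shear bij_conc_shear linear_scale_xi bij_scale_xi[of "2"]])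
     (auto simp: fun_eq_iff scaleR_2 algebra_simps intro!: param_eqI)

lemma borel_measurable_linear:
  fixes f :: "'a::euclidean_space \<Rightarrow> 'b::euclidean_space"
  shows "linear f \<Longrightarrow> f \<in> borel_measurable borel"
  by (intro borel_measurable_continuous_onI linear_continuous_on linear_conv_bounded_linear[THEN iffD1])

text \<open>The action is affine in v. Its constant part disappears by translation invariance and
  its linear part is \<open>gl_act\<close> followed by a volume-preserving shear. On the data the
  same substitution has exponent n i in place of p + 2.\<close>

lemma nn_integral_affine_act:
  fixes A :: "'k::finite \<Rightarrow> real^'p::finite^'p"
  assumes A: "\<And>i. invertible (A i)" and [measurable]: "h \<in> borel_measurable borel"
  shows "(\<integral>\<^sup>+v. h v \<partial>lborel) =
    ennreal (\<Prod>i\<in>UNIV. \<bar>det (A i)\<bar> ^ (CARD('p) + 2)) * (\<integral>\<^sup>+v. h (affine_act N A b v) \<partial>lborel)"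
proof -
  define c where "c = affine_act N A b 0"
  have eq: "affine_act N A b v = (mean_shear b \<circ> gl_act A) v + c" for v
    unfolding c_def by (rule param_eqI) (simp_all add: outer_def vec_eq_iff matrix_vector_mult_def)
  have [measurable]: "(mean_shear b \<circ> gl_act A) \<in> borel_measurable borel"
    by (intro borel_measurable_linear linear_compose linear_gl_act linear_mean_shear)
  have "(\<integral>\<^sup>+v. h v \<partial>lborel) = (\<integral>\<^sup>+v. h (v + c) \<partial>lborel)"
    by (simp add: nn_integral_lborel_translate')
  also have "\<dots> = ennreal (lin_scale (mean_shear b \<circ> gl_act A)) * (\<integral>\<^sup>+v. h ((mean_shear b \<circ> gl_act A) v + c) \<partial>lborel)"
    using A by (intro nn_integral_lin_scale) (auto intro: linear_compose linear_gl_act linear_mean_shear bij_comp bij_gl_act bij_mean_shear)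
  also have "lin_scale (mean_shear b \<circ> gl_act A) = (\<Prod>i\<in>UNIV. \<bar>det (A i)\<bar> ^ (CARD('p) + 2))"
    using A by (simp add: lin_scale_comp linear_gl_act linear_mean_shear bij_gl_act bij_mean_shear lin_scale_mean_shear lin_scale_gl_act)
  finally show ?thesis by (simp only: eq)
qed

section \<open>The log-likelihood and its maximizers\<close>

lemma sum_uprod:
  fixes G :: "'p::finite uprod \<Rightarrow> real"
  shows "(\<Sum>a\<in>UNIV. \<Sum>b\<in>UNIV. G (Upair a b)) = (\<Sum>u\<in>UNIV. (if proper_uprod u then 2 else 1) * G u)"
proof -
  have "(\<Sum>a\<in>S. \<Sum>b\<in>S. G (Upair a b)) = (\<Sum>u\<in>{u. set_uprod u \<subseteq> S}. (if proper_uprod u then 2 else 1) * G u)"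
    if "finite S" for S
    using that
  proof (induction S)
    case empty
    have "set_uprod u \<noteq> {}" for u :: "'p uprod" by (cases u) simp
    then show ?case by simp
  next
    case (insert x S)
    let ?w = "\<lambda>u. (if proper_uprod u then 2 else 1) * G u"
    have eq: "{u. set_uprod u \<subseteq> insert x S} = {u. set_uprod u \<subseteq> S} \<union> Upair x ` insert x S"
    proof (intro set_eqI)
      fix u :: "'p uprod"
      show "u \<in> {u. set_uprod u \<subseteq> insert x S} \<longleftrightarrow> u \<in> {u. set_uprod u \<subseteq> S} \<union> Upair x ` insert x S"
        by (cases u) auto
    qed
    have disj: "{u. set_uprod u \<subseteq> S} \<inter> Upair x ` insert x S = {}"
      using insert.hyps by auto
    have inj: "inj_on (Upair x) (insert x S)" by (auto simp: inj_on_def)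
    have "(\<Sum>u\<in>{u. set_uprod u \<subseteq> insert x S}. ?w u) = (\<Sum>a\<in>S. \<Sum>b\<in>S. G (Upair a b)) + (\<Sum>u\<in>Upair x ` insert x S. ?w u)"
      unfolding eq using disj by (subst sum.union_disjoint) (simp_all only: insert.IH finite)
    also have "(\<Sum>u\<in>Upair x ` insert x S. ?w u) = (\<Sum>a\<in>insert x S. ?w (Upair x a))"
      by (simp only: sum.reindex[OF inj] o_def)
    also have "\<dots> = G (Upair x x) + (\<Sum>a\<in>S. 2 * G (Upair x a))"
      using insert.hyps by (simp, intro sum.cong) auto
    also have "(\<Sum>a\<in>S. \<Sum>b\<in>S. G (Upair a b)) + (G (Upair x x) + (\<Sum>a\<in>S. 2 * G (Upair x a)))
       = (\<Sum>a\<in>insert x S. \<Sum>b\<in>insert x S. G (Upair a b))"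
    proof -
      have "(\<Sum>a\<in>S. G (Upair a x)) = (\<Sum>a\<in>S. G (Upair x a))"
        by (intro sum.cong refl arg_cong[of _ _ G]) simp
      then show ?thesis using insert.hyps by (simp add: sum.distrib sum_distrib_left[symmetric])
    qed
    finally show ?case by simp
  qed
  from this[of UNIV] show ?thesis by simp
qed

text \<open>Turns the moments \<open>(\<Sum> y, \<Sum> y y\<^sup>T)\<close> into the canonical sufficient statistic: the
  coefficient of an entry of \<open>\<Lambda>\<close> in \<open>- tr (\<Lambda> \<Sum> y y\<^sup>T) / 2\<close> depends on whether the entry is
  on the diagonal.\<close>

definition to_canonical :: "('k::finite, 'p::finite) param \<Rightarrow> ('k, 'p) param" where
  "to_canonical v = (\<chi> z. (case snd z of Inl _ \<Rightarrow> 1 | Inr u \<Rightarrow> if proper_uprod u then - 1 else - 1 / 2) * v $ z)"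

lemma linear_to_canonical: "linear to_canonical"
  by (simp add: linear_iff to_canonical_def vec_eq_iff algebra_simps)

lemma inner_to_canonical:
  fixes \<phi> v :: "('k::finite, 'p::finite) param"
  shows "\<phi> \<bullet> to_canonical v = (\<Sum>i\<in>UNIV. xi \<phi> i \<bullet> xi v i - trace (conc \<phi> i ** conc v i) / 2)"
proof -
  define c :: "'p + 'p uprod \<Rightarrow> real" where "c x = (case x of Inl _ \<Rightarrow> 1 | Inr u \<Rightarrow> if proper_uprod u then - 1 else - 1 / 2)" for x
  have "\<phi> \<bullet> to_canonical v = (\<Sum>z\<in>UNIV. \<phi> $ z * (c (snd z) * v $ z))"
    by (simp add: inner_vec_def to_canonical_def c_def)
  also have "\<dots> = (\<Sum>i\<in>UNIV. \<Sum>x\<in>UNIV. \<phi> $ (i, x) * (c x * v $ (i, x)))"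
    by (simp add: sum.cartesian_product case_prod_beta')
  also have "\<dots> = (\<Sum>i\<in>UNIV. xi \<phi> i \<bullet> xi v i - trace (conc \<phi> i ** conc v i) / 2)"
  proof (intro sum.cong refl)
    fix i
    define G where "G u = \<phi> $ (i, Inr u) * v $ (i, Inr u)" for u
    have "trace (conc \<phi> i ** conc v i) = (\<Sum>a\<in>UNIV. \<Sum>b\<in>UNIV. conc \<phi> i $ a $ b * conc v i $ b $ a)"
      by (simp add: trace_def matrix_matrix_mult_def)
    also have "\<dots> = (\<Sum>a\<in>UNIV. \<Sum>b\<in>UNIV. G (Upair a b))"
    proof (intro sum.cong refl)
      fix a b :: 'p
      have "Upair b a = Upair a b" by simp
      then show "conc \<phi> i $ a $ b * conc v i $ b $ a = G (Upair a b)"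
        by (simp only: G_def conc_def vec_lambda_beta)
    qed
    also have "\<dots> = (\<Sum>u\<in>UNIV. (if proper_uprod u then 2 else 1) * G u)" by (rule sum_uprod)
    finally have tr: "trace (conc \<phi> i ** conc v i) / 2 = - (\<Sum>u\<in>UNIV. \<phi> $ (i, Inr u) * (c (Inr u) * v $ (i, Inr u)))"
      by (simp add: sum_divide_distrib sum_negf[symmetric] c_def G_def, intro sum.cong) auto
    have "(\<Sum>x\<in>UNIV. \<phi> $ (i, x) * (c x * v $ (i, x))) = (\<Sum>a\<in>UNIV. \<phi> $ (i, Inl a) * (c (Inl a) * v $ (i, Inl a)))
      + (\<Sum>u\<in>UNIV. \<phi> $ (i, Inr u) * (c (Inr u) * v $ (i, Inr u)))"
      using sum.Plus[of UNIV UNIV "\<lambda>x. \<phi> $ (i, x) * (c x * v $ (i, x))"] by (simp add: o_def)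
    also have "(\<Sum>a\<in>UNIV. \<phi> $ (i, Inl a) * (c (Inl a) * v $ (i, Inl a))) = xi \<phi> i \<bullet> xi v i"
      by (simp add: c_def xi_def inner_vec_def)
    finally show "(\<Sum>x\<in>UNIV. \<phi> $ (i, x) * (c x * v $ (i, x))) = xi \<phi> i \<bullet> xi v i - trace (conc \<phi> i ** conc v i) / 2"
      using tr by simp
  qed
  finally show ?thesis .
qed

text \<open>The constant with ln (2 pi) is kept so that \<open>exp\<close> of the log-likelihood is
  the joint density itself, as \<open>prod_mvn_density\<close> asserts.\<close>

definition cumulant :: "('k \<Rightarrow> real) \<Rightarrow> ('k::finite, 'p::finite) param \<Rightarrow> real" where
  "cumulant N \<phi> = (\<Sum>i\<in>UNIV. N i / 2 * (xi \<phi> i \<bullet> (matrix_inv (conc \<phi> i) *v xi \<phi> i)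
     - ln (det (conc \<phi> i)) + CARD('p) * ln (2 * pi)))"

text \<open>The statistic v is a free argument and not a function of the data, so that the
  likelihood at a point of the line s(t) is this same function at another v.\<close>

definition stat_loglik :: "('k \<Rightarrow> real) \<Rightarrow> ('k::finite, 'p::finite) param \<Rightarrow> ('k, 'p) param \<Rightarrow> real" where
  "stat_loglik N v \<phi> = \<phi> \<bullet> to_canonical v - cumulant N \<phi>"

definition suff_stat :: "('k \<Rightarrow> nat) \<Rightarrow> ('k \<Rightarrow> nat \<Rightarrow> real^'p) \<Rightarrow> ('k::finite, 'p::finite) param" where
  "suff_stat n y = mk_param (\<lambda>i. \<Sum>j<n i. y i j) (\<lambda>i. \<Sum>j<n i. outer (y i j) (y i j))"

lemma transpose_sum: "transpose (\<Sum>j\<in>S. f j) = (\<Sum>j\<in>S. transpose (f j :: real^'n^'m))"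
  by (simp add: transpose_def vec_eq_iff)

lemma xi_suff_stat [simp]: "xi (suff_stat n y) i = (\<Sum>j<n i. y i j)"
  by (simp add: suff_stat_def)

lemma conc_suff_stat [simp]: "conc (suff_stat n y) i = (\<Sum>j<n i. outer (y i j) (y i j))"
  by (simp add: suff_stat_def transpose_sum transpose_outer)

lemma matrix_mult_sum_right: "A ** (\<Sum>j\<in>S. f j) = (\<Sum>j\<in>S. A ** f j)" for A :: "real^'n^'m"
  by (rule bounded_bilinear.sum_right[OF bounded_bilinear_matrix_mult])

lemma trace_sum: "trace (\<Sum>j\<in>S. f j :: real^'n^'n) = (\<Sum>j\<in>S. trace (f j))"
  unfolding trace_def sum_component by (rule sum.swap)

lemma inner_sym_mult:
  fixes L :: "real^'n^'n"
  assumes "transpose L = L"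
  shows "x \<bullet> (L *v y) = y \<bullet> (L *v x)"
  using inner_matrix_mult_transpose[of x L y] by (simp add: assms inner_commute)

lemma ln_det_matrix_inv: "pos_def S \<Longrightarrow> ln (det (matrix_inv S)) = - ln (det S)"
  using pos_def_det_pos by (simp add: det_matrix_inv pos_def_invertible ln_div)

lemma mvn_loglik_eq_stat_loglik:
  fixes y :: "'k::finite \<Rightarrow> nat \<Rightarrow> real^'p::finite"
  assumes "\<phi> \<in> param_space"
  shows "mvn_loglik n y \<phi> = stat_loglik (\<lambda>i. real (n i)) (suff_stat n y) \<phi>"
proof -
  have "(\<Sum>j<n i. ln (mvn_density (mean \<phi> i) (matrix_inv (conc \<phi> i)) (y i j))) =
     xi \<phi> i \<bullet> xi (suff_stat n y) i - trace (conc \<phi> i ** conc (suff_stat n y) i) / 2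
      - real (n i) / 2 * (xi \<phi> i \<bullet> (matrix_inv (conc \<phi> i) *v xi \<phi> i) - ln (det (conc \<phi> i)) + CARD('p) * ln (2 * pi))" for i
  proof -
    define L where "L = conc \<phi> i"
    have L: "pos_def L" using assms by (simp add: param_space_def L_def)
    have tL: "transpose L = L" by (simp add: L_def)
    define S where "S = matrix_inv L"
    have LS: "L ** S = mat 1" unfolding S_def by (rule matrix_inv_right[OF pos_def_invertible[OF L]])
    have detS: "det S = 1 / det L" unfolding S_def by (rule det_matrix_inv[OF pos_def_invertible[OF L]])
    define x where "x = xi \<phi> i"
    have "ln (mvn_density (S *v x) S w) = x \<bullet> w - (w \<bullet> (L *v w)) / 2
       - (x \<bullet> (S *v x) - ln (det L) + CARD('p) * ln (2 * pi)) / 2" for w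
    proof -
      have pos: "(2 * pi) ^ CARD('p) * det S > 0"
        using pos_def_det_pos[OF L] by (simp add: detS)
      have invS: "matrix_inv S = L" unfolding S_def by (rule matrix_inv_matrix_inv[OF pos_def_invertible[OF L]])
      have LSx: "L *v (S *v x) = x" by (simp add: matrix_vector_mul_assoc LS)
      have "ln (mvn_density (S *v x) S w) = - ((w - S *v x) \<bullet> (L *v (w - S *v x))) / 2 - ln (sqrt ((2 * pi) ^ CARD('p) * det S))"
        unfolding mvn_density_def invS using pos by (subst ln_div) auto
      also have "(w - S *v x) \<bullet> (L *v (w - S *v x)) = w \<bullet> (L *v w) - 2 * (x \<bullet> w) + x \<bullet> (S *v x)"
        using inner_sym_mult[OF tL, of "S *v x" w]
        by (simp add: matrix_vector_mult_diff_distrib inner_diff_left inner_diff_right LSx inner_commute)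
      also have "ln (sqrt ((2 * pi) ^ CARD('p) * det S)) = (CARD('p) * ln (2 * pi) - ln (det L)) / 2"
      proof -
        have "ln ((2 * pi) ^ CARD('p) * det S) = CARD('p) * ln (2 * pi) - ln (det L)"
        proof -
          have "ln ((2 * pi) ^ CARD('p)) = CARD('p) * ln (2 * pi)" by (rule ln_realpow)
          moreover have "ln (det S) = - ln (det L)" by (simp add: S_def ln_det_matrix_inv L)
          moreover have "det S > 0" using pos_def_det_pos[OF L] by (simp add: detS)
          ultimately show ?thesis
            by (simp add: ln_mult_pos del: power_mult_distrib)
        qed
        then show ?thesis using pos by (simp add: ln_sqrt del: power_mult_distrib)
      qed
      finally show ?thesis by (simp add: field_simps)
    qed
    then have "(\<Sum>j<n i. ln (mvn_density (S *v x) S (y i j))) =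
      (\<Sum>j<n i. x \<bullet> y i j) - (\<Sum>j<n i. y i j \<bullet> (L *v y i j)) / 2
       - real (n i) / 2 * (x \<bullet> (S *v x) - ln (det L) + CARD('p) * ln (2 * pi))"
      by (simp add: sum_subtractf sum_divide_distrib)
    then show ?thesis
      by (simp add: mean_def L_def[symmetric] S_def[symmetric] x_def[symmetric] inner_sum_right
          matrix_mult_sum_right trace_sum trace_mult_outer)
  qed
  then show ?thesis
    unfolding mvn_loglik_def stat_loglik_def inner_to_canonical cumulant_def sum_subtractf[symmetric] by simp
qed

text \<open>Completing the square separates the two parameters: the mean enters only through a
  quadratic form with matrix \<open>conc\<close>, and the rest is the expression bounded in
  \<open>log_det_le\<close>.\<close>

lemma stat_loglik_eq:
  fixes \<phi> v :: "('k::finite, 'p::finite) param"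
  assumes \<phi>: "\<phi> \<in> param_space" and N: "\<And>i. N i > 0"
  shows "stat_loglik N v \<phi> = (\<Sum>i\<in>UNIV. N i / 2 * (ln (det (conc \<phi> i)) - trace (conc \<phi> i ** group_cov N v i)
    - (mean \<phi> i - group_avg N v i) \<bullet> (conc \<phi> i *v (mean \<phi> i - group_avg N v i)) - CARD('p) * ln (2 * pi)))"
proof -
  have "xi \<phi> i \<bullet> xi v i - trace (conc \<phi> i ** conc v i) / 2 - N i / 2 * (xi \<phi> i \<bullet> (matrix_inv (conc \<phi> i) *v xi \<phi> i)
     - ln (det (conc \<phi> i)) + CARD('p) * ln (2 * pi)) =
    N i / 2 * (ln (det (conc \<phi> i)) - trace (conc \<phi> i ** group_cov N v i)
    - (mean \<phi> i - group_avg N v i) \<bullet> (conc \<phi> i *v (mean \<phi> i - group_avg N v i)) - CARD('p) * ln (2 * pi))" for i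
  proof -
    define L where "L = conc \<phi> i"
    have L: "pos_def L" using \<phi> by (simp add: param_space_def L_def)
    have tL: "transpose L = L" by (simp add: L_def)
    define m where "m = group_avg N v i"
    define u where "u = mean \<phi> i"
    have Lu: "xi \<phi> i = L *v u"
      by (simp add: u_def mean_def matrix_vector_mul_assoc L_def[symmetric] matrix_inv_right[OF pos_def_invertible[OF L]])
    have inv: "matrix_inv L *v (L *v u) = u"
      by (simp add: matrix_vector_mul_assoc matrix_inv_left[OF pos_def_invertible[OF L]])
    have tr: "trace (L ** conc v i) = N i * (trace (L ** group_cov N v i) + m \<bullet> (L *v m))"
      using N[of i] by (simp add: conc_eq_cov[of N] m_def[symmetric] matrix_mult_scaleR_right matrix_mult_add_right
          trace_add trace_mult_outer[symmetric]) (simp add: trace_def sum_distrib_left sum.distrib algebra_simps)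
    have xv: "xi v i = N i *\<^sub>R m" using N[of i] by (simp add: xi_eq_avg[of N] m_def)
    show ?thesis
      unfolding L_def[symmetric] m_def[symmetric] u_def[symmetric] tr Lu inv xv
      using inner_sym_mult[OF tL, of m u]
      by (simp add: matrix_vector_mult_diff_distrib inner_diff_left inner_diff_right inner_commute field_simps)
  qed
  then show ?thesis
    unfolding stat_loglik_def inner_to_canonical cumulant_def sum_subtractf[symmetric] by (simp only:)
qed

section \<open>Unconstrained maximization\<close>

definition stat_mle :: "('k \<Rightarrow> real) \<Rightarrow> ('k::finite, 'p::finite) param \<Rightarrow> ('k, 'p) param" where
  "stat_mle N v = mk_param (\<lambda>i. matrix_inv (group_cov N v i) *v group_avg N v i) (\<lambda>i. matrix_inv (group_cov N v i))"

lemma transpose_matrix_inv_sym: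
  fixes S :: "real^'n^'n"
  shows "pos_def S \<Longrightarrow> transpose (matrix_inv S) = matrix_inv S"
  using pos_def_matrix_inv pos_def_def by blast

lemma
  fixes v :: "('k::finite, 'p::finite) param"
  assumes C: "\<And>i. pos_def (group_cov N v i)"
  shows conc_stat_mle: "conc (stat_mle N v) i = matrix_inv (group_cov N v i)"
    and mean_stat_mle: "mean (stat_mle N v) i = group_avg N v i"
    and stat_mle_in_param_space: "stat_mle N v \<in> param_space"
proof -
  show c: "conc (stat_mle N v) i = matrix_inv (group_cov N v i)" for i
    by (simp add: stat_mle_def transpose_matrix_inv_sym[OF C])
  show "mean (stat_mle N v) i = group_avg N v i"
    unfolding mean_def c by (simp add: stat_mle_def matrix_vector_mul_assoc matrix_inv_left invertible_matrix_inv pos_def_invertible[OF C])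
  show "stat_mle N v \<in> param_space" by (simp add: param_space_def c pos_def_matrix_inv[OF C])
qed

definition max_stat_loglik :: "('k \<Rightarrow> real) \<Rightarrow> ('k::finite, 'p::finite) param \<Rightarrow> real" where
  "max_stat_loglik N v = (\<Sum>i\<in>UNIV. N i / 2 * (- ln (det (group_cov N v i)) - CARD('p) - CARD('p) * ln (2 * pi)))"

lemma stat_loglik_stat_mle:
  fixes v :: "('k::finite, 'p::finite) param"
  assumes N: "\<And>i. N i > 0" and C: "\<And>i. pos_def (group_cov N v i)"
  shows "stat_loglik N v (stat_mle N v) = max_stat_loglik N v"
  unfolding stat_loglik_eq[OF stat_mle_in_param_space[OF C] N] max_stat_loglik_def
  by (simp add: conc_stat_mle[OF C] mean_stat_mle[OF C] matrix_inv_left pos_def_invertible[OF C] ln_det_matrix_inv[OF C] trace_I)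

text \<open>Both bounds hold group by group: the quadratic form is nonnegative and the rest is
  \<open>log_det_le\<close>. Equality of the sums forces equality in every group, which determines
  the concentration and the mean.\<close>

lemma
  fixes v :: "('k::finite, 'p::finite) param"
  assumes N: "\<And>i. N i > 0" and C: "\<And>i. pos_def (group_cov N v i)" and \<phi>: "\<phi> \<in> param_space"
  shows stat_loglik_le: "stat_loglik N v \<phi> \<le> max_stat_loglik N v"
    and stat_loglik_max_unique: "stat_loglik N v \<phi> = max_stat_loglik N v \<Longrightarrow> \<phi> = stat_mle N v"
proof -
  have L: "pos_def (conc \<phi> i)" for i using \<phi> by (simp add: param_space_def)
  let ?q = "\<lambda>i. (mean \<phi> i - group_avg N v i) \<bullet> (conc \<phi> i *v (mean \<phi> i - group_avg N v i))"
  have q: "0 \<le> ?q i" for i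
    using L[of i] unfolding pos_def_def by (cases "mean \<phi> i - group_avg N v i = 0") (auto intro: less_imp_le)
  define f where "f i = N i / 2 * (ln (det (conc \<phi> i)) - trace (conc \<phi> i ** group_cov N v i) - ?q i - CARD('p) * ln (2 * pi))" for i
  define g where "g i = N i / 2 * (- ln (det (group_cov N v i)) - CARD('p) - CARD('p) * ln (2 * pi))" for i
  have fg: "f i \<le> g i" for i
    unfolding f_def g_def using N[of i] q[of i] log_det_le(1)[OF L C, of i i] by (intro mult_left_mono) auto
  have eq: "stat_loglik N v \<phi> = sum f UNIV" "max_stat_loglik N v = sum g UNIV"
    unfolding stat_loglik_eq[OF \<phi> N] max_stat_loglik_def f_def g_def by auto
  show "stat_loglik N v \<phi> \<le> max_stat_loglik N v"
    unfolding eq by (intro sum_mono fg)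
  assume "stat_loglik N v \<phi> = max_stat_loglik N v"
  then have "(\<Sum>i\<in>UNIV. g i - f i) = 0" unfolding eq by (simp add: sum_subtractf)
  then have "g i - f i = 0" for i
    using fg by (subst (asm) sum_nonneg_eq_0_iff) auto
  then have 0: "ln (det (conc \<phi> i)) - trace (conc \<phi> i ** group_cov N v i) - ?q i = - ln (det (group_cov N v i)) - CARD('p)" for i
  proof -
    have 1: "N i / 2 \<noteq> 0" and 2: "g i = f i" using N[of i] \<open>g i - f i = 0\<close> by auto
    show ?thesis
      using iffD1[OF mult_left_cancel[OF 1] 2[unfolded f_def g_def]] by simp
  qed
  have q0: "?q i = 0" for i using 0[of i] q[of i] log_det_le(1)[OF L C, of i i] by simp
  have c: "conc \<phi> i = matrix_inv (group_cov N v i)" for i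
    using 0[of i] q0[of i] log_det_le(2)[OF L C, of i i] by simp
  have m: "mean \<phi> i = group_avg N v i" for i
    using q0[of i] L[of i] unfolding pos_def_def by (metis less_irrefl right_minus_eq)
  show "\<phi> = stat_mle N v"
  proof (rule param_eqI)
    fix i
    show "conc \<phi> i = conc (stat_mle N v) i" by (simp add: c conc_stat_mle[OF C])
    have "xi \<phi> i = conc \<phi> i *v mean \<phi> i"
      by (simp add: mean_def matrix_vector_mul_assoc matrix_inv_right[OF pos_def_invertible[OF L]])
    then show "xi \<phi> i = xi (stat_mle N v) i" by (simp add: c m stat_mle_def)
  qed
qed

text \<open>Shows that no maximizer exists when a covariance C is not positive definite. For x with
  x . C x <= 0, adding x x^T to the concentration does not increase the trace term but strictly
  increases the log determinant.\<close>

lemma stat_loglik_unbounded_step: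
  fixes v \<phi> :: "('k::finite, 'p::finite) param"
  assumes N: "\<And>i. N i > 0" and C: "\<not> pos_def (group_cov N v i)" and \<phi>: "\<phi> \<in> param_space"
  shows "\<exists>\<phi>'\<in>param_space. stat_loglik N v \<phi> < stat_loglik N v \<phi>'"
proof -
  have L: "pos_def (conc \<phi> j)" for j using \<phi> by (simp add: param_space_def)
  obtain x where x: "x \<noteq> 0" "x \<bullet> (group_cov N v i *v x) \<le> 0"
    using C unfolding pos_def_def by (auto simp: not_less)
  define L' where "L' = (\<lambda>j. if j = i then conc \<phi> i + outer x x else conc \<phi> j)"
  \<comment> \<open>Placing the mean at the group average removes the quadratic term, which the
    enlarged concentration could otherwise make worse.\<close>
  define m where "m = (\<lambda>j. if j = i then group_avg N v i else mean \<phi> j)"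
  define \<phi>' where "\<phi>' = mk_param (\<lambda>j. L' j *v m j) L'"
  have L': "pos_def (L' j)" for j
    using L log_det_less_rank_one_update(1)[OF L x(1)] by (simp add: L'_def)
  then have c: "conc \<phi>' j = L' j" for j by (simp add: \<phi>'_def pos_def_def)
  have mm: "mean \<phi>' j = m j" for j
    unfolding mean_def c by (simp add: \<phi>'_def matrix_vector_mul_assoc matrix_inv_left[OF pos_def_invertible[OF L']])
  have \<phi>': "\<phi>' \<in> param_space" by (simp add: param_space_def c L')
  have "stat_loglik N v \<phi> < stat_loglik N v \<phi>'"
    unfolding stat_loglik_eq[OF \<phi> N] stat_loglik_eq[OF \<phi>' N]
  proof (rule sum_strict_mono_ex1)
    have q: "0 \<le> (mean \<phi> i - group_avg N v i) \<bullet> (conc \<phi> i *v (mean \<phi> i - group_avg N v i))"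
      using L[of i] unfolding pos_def_def by (cases "mean \<phi> i - group_avg N v i = 0") (auto intro: less_imp_le)
    have "trace (outer x x ** group_cov N v i) \<le> 0"
      using x(2) by (subst trace_mul_sym) (simp add: trace_mult_outer)
    then have "ln (det (conc \<phi> i)) - trace (conc \<phi> i ** group_cov N v i) < ln (det (L' i)) - trace (L' i ** group_cov N v i)"
      using log_det_less_rank_one_update(2)[OF L x(1), of i]
      by (simp add: L'_def matrix_mult_add_left trace_add)
    then have less: "N i / 2 * (ln (det (conc \<phi> i)) - trace (conc \<phi> i ** group_cov N v i)
      - (mean \<phi> i - group_avg N v i) \<bullet> (conc \<phi> i *v (mean \<phi> i - group_avg N v i)) - CARD('p) * ln (2 * pi))
     < N i / 2 * (ln (det (conc \<phi>' i)) - trace (conc \<phi>' i ** group_cov N v i)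
      - (mean \<phi>' i - group_avg N v i) \<bullet> (conc \<phi>' i *v (mean \<phi>' i - group_avg N v i)) - CARD('p) * ln (2 * pi))"
      using N[of i] q by (intro mult_strict_left_mono) (simp_all add: c mm m_def)
    then show "\<exists>a\<in>UNIV. N a / 2 * (ln (det (conc \<phi> a)) - trace (conc \<phi> a ** group_cov N v a)
      - (mean \<phi> a - group_avg N v a) \<bullet> (conc \<phi> a *v (mean \<phi> a - group_avg N v a)) - CARD('p) * ln (2 * pi))
     < N a / 2 * (ln (det (conc \<phi>' a)) - trace (conc \<phi>' a ** group_cov N v a)
      - (mean \<phi>' a - group_avg N v a) \<bullet> (conc \<phi>' a *v (mean \<phi>' a - group_avg N v a)) - CARD('p) * ln (2 * pi))"
      by blast
    show "\<forall>a\<in>UNIV. N a / 2 * (ln (det (conc \<phi> a)) - trace (conc \<phi> a ** group_cov N v a)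
      - (mean \<phi> a - group_avg N v a) \<bullet> (conc \<phi> a *v (mean \<phi> a - group_avg N v a)) - CARD('p) * ln (2 * pi))
     \<le> N a / 2 * (ln (det (conc \<phi>' a)) - trace (conc \<phi>' a ** group_cov N v a)
      - (mean \<phi>' a - group_avg N v a) \<bullet> (conc \<phi>' a *v (mean \<phi>' a - group_avg N v a)) - CARD('p) * ln (2 * pi))"
    proof
      fix a show "N a / 2 * (ln (det (conc \<phi> a)) - trace (conc \<phi> a ** group_cov N v a)
        - (mean \<phi> a - group_avg N v a) \<bullet> (conc \<phi> a *v (mean \<phi> a - group_avg N v a)) - CARD('p) * ln (2 * pi))
       \<le> N a / 2 * (ln (det (conc \<phi>' a)) - trace (conc \<phi>' a ** group_cov N v a)
        - (mean \<phi>' a - group_avg N v a) \<bullet> (conc \<phi>' a *v (mean \<phi>' a - group_avg N v a)) - CARD('p) * ln (2 * pi))"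
        using less by (cases "a = i") (auto simp: c mm m_def L'_def intro: less_imp_le)
    qed
  qed simp
  with \<phi>' show ?thesis by blast
qed

section \<open>The saddlepoint approximation along the line\<close>

lemma pos_def_conc_iff: "pos_def (conc \<phi> i) \<longleftrightarrow> (\<forall>x. x \<noteq> 0 \<longrightarrow> 0 < x \<bullet> (conc \<phi> i *v x))"
  by (simp add: pos_def_def)

lemma linear_conc: "linear (\<lambda>\<phi>. conc \<phi> i)" and linear_xi: "linear (\<lambda>\<phi>. xi \<phi> i)"
  by (simp_all add: linear_iff)

lemma bounded_linear_conc: "bounded_linear (\<lambda>\<phi> :: ('k::finite, 'p::finite) param. conc \<phi> i)"
  and bounded_linear_xi: "bounded_linear (\<lambda>\<phi> :: ('k::finite, 'p::finite) param. xi \<phi> i)"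
  using linear_conc linear_xi linear_conv_bounded_linear by blast+

lemma open_param_space: "open (param_space :: ('k::finite, 'p::finite) param set)"
proof -
  have "param_space = (\<Inter>i. (\<lambda>\<phi> :: ('k, 'p) param. conc \<phi> i) -` {S. \<forall>x. x \<noteq> 0 \<longrightarrow> 0 < x \<bullet> (S *v x)})"
    by (auto simp: param_space_def pos_def_conc_iff)
  moreover have "open \<dots>"
    by (intro open_INT open_vimage open_pos_quadratic linear_continuous_on bounded_linear_conc ballI) auto
  ultimately show ?thesis by simp
qed

text \<open>The likelihood l is compared with \<open>stat_loglik\<close> only on
  \<open>param_space\<close>, where \<open>mvn_loglik\<close> has its intended meaning. Existence of
  the estimate along the line thereby becomes a condition on covariances.\<close>

lemma mle_exists_iff:
  assumes N: "\<And>i. N i > 0" and l: "\<And>\<phi>. \<phi> \<in> param_space \<Longrightarrow> l \<phi> = stat_loglik N v \<phi>"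
  shows "mle_exists param_space l \<longleftrightarrow> (\<forall>i. pos_def (group_cov N v i))"
proof
  assume "mle_exists param_space l"
  then obtain \<phi> where \<phi>: "\<phi> \<in> param_space" "\<And>\<phi>'. \<phi>' \<in> param_space \<Longrightarrow> l \<phi>' \<le> l \<phi>"
    by (auto simp: mle_exists_def is_arg_max_linorder)
  show "\<forall>i. pos_def (group_cov N v i)"
    using stat_loglik_unbounded_step[of N v _ \<phi>] N \<phi> l by (metis not_le)
next
  assume C: "\<forall>i. pos_def (group_cov N v i)"
  then have "is_arg_max l (\<lambda>\<phi>. \<phi> \<in> param_space) (stat_mle N v)"
    using stat_mle_in_param_space[of N v] stat_loglik_le[of N v] stat_loglik_stat_mle[of N v] N
    by (auto simp: is_arg_max_linorder l)
  then show "mle_exists param_space l" by (auto simp: mle_exists_def)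
qed

lemma mle_eq_stat_mle:
  assumes N: "\<And>i. N i > 0" and l: "\<And>\<phi>. \<phi> \<in> param_space \<Longrightarrow> l \<phi> = stat_loglik N v \<phi>"
    and C: "\<And>i. pos_def (group_cov N v i)"
  shows "mle param_space l = stat_mle N v"
proof -
  have "mle_exists param_space l" using mle_exists_iff[where N=N, OF N l] C by simp
  then have "is_arg_max l (\<lambda>\<phi>. \<phi> \<in> param_space) (mle param_space l)"
    unfolding mle_exists_def mle_def arg_max_def by (rule someI_ex)
  then have "mle param_space l \<in> param_space" "stat_loglik N v (stat_mle N v) \<le> stat_loglik N v (mle param_space l)"
    using stat_mle_in_param_space[of N v] C by (auto simp: is_arg_max_linorder l)
  then show ?thesis
    using stat_loglik_max_unique[of N v "mle param_space l"] stat_loglik_le[of N v "mle param_space l"]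
      stat_loglik_stat_mle[of N v] N C by (auto intro: antisym)
qed

text \<open>The expected moments under the parameter, inverse to \<open>stat_mle\<close>. After
  \<open>to_canonical\<close> they are the gradient of \<open>cumulant\<close>.\<close>

definition mean_stat :: "('k \<Rightarrow> real) \<Rightarrow> ('k::finite, 'p::finite) param \<Rightarrow> ('k, 'p) param" where
  "mean_stat N \<phi> = of_avg_cov N (mean \<phi>) (\<lambda>i. matrix_inv (conc \<phi> i))"

lemma
  fixes \<phi> :: "('k::finite, 'p::finite) param"
  assumes N: "\<And>i. N i > 0" and \<phi>: "\<phi> \<in> param_space"
  shows group_avg_mean_stat: "group_avg N (mean_stat N \<phi>) i = mean \<phi> i"
    and group_cov_mean_stat: "group_cov N (mean_stat N \<phi>) i = matrix_inv (conc \<phi> i)"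
    and stat_mle_mean_stat: "stat_mle N (mean_stat N \<phi>) = \<phi>"
proof -
  have L: "pos_def (conc \<phi> i)" for i using \<phi> by (simp add: param_space_def)
  have N0: "N i \<noteq> 0" for i using N[of i] by simp
  show a: "group_avg N (mean_stat N \<phi>) i = mean \<phi> i" for i
    by (simp add: mean_stat_def group_avg_of_avg_cov N0)
  show c: "group_cov N (mean_stat N \<phi>) i = matrix_inv (conc \<phi> i)" for i
    by (simp add: mean_stat_def group_cov_of_avg_cov N0 transpose_matrix_inv_sym L)
  have C: "pos_def (group_cov N (mean_stat N \<phi>) i)" for i
    by (simp add: c pos_def_matrix_inv L)
  show "stat_mle N (mean_stat N \<phi>) = \<phi>"
  proof (rule param_eqI)
    fix i
    show "conc (stat_mle N (mean_stat N \<phi>)) i = conc \<phi> i"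
      by (simp add: conc_stat_mle[OF C] c matrix_inv_matrix_inv pos_def_invertible L)
    show "xi (stat_mle N (mean_stat N \<phi>)) i = xi \<phi> i"
      by (simp add: stat_mle_def c a matrix_inv_matrix_inv pos_def_invertible L mean_def
          matrix_vector_mul_assoc matrix_inv_right)
  qed
qed

lemma mean_stat_stat_mle:
  fixes v :: "('k::finite, 'p::finite) param"
  assumes N: "\<And>i. N i > 0" and C: "\<And>i. pos_def (group_cov N v i)"
  shows "mean_stat N (stat_mle N v) = v"
proof (rule param_eqI_avg_cov)
  show "N i \<noteq> 0" for i using N[of i] by simp
  show "group_avg N (mean_stat N (stat_mle N v)) i = group_avg N v i" for i
    by (simp add: group_avg_mean_stat N stat_mle_in_param_space C mean_stat_mle)
  show "group_cov N (mean_stat N (stat_mle N v)) i = group_cov N v i" for i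
    by (simp add: group_cov_mean_stat N stat_mle_in_param_space C conc_stat_mle matrix_inv_matrix_inv pos_def_invertible)
qed

definition coord_scale :: "('n \<Rightarrow> real) \<Rightarrow> real^'n::finite \<Rightarrow> real^'n" where
  "coord_scale e v = (\<chi> z. e z * v $ z)"

text \<open>N times the absolute values of the coefficients in \<open>to_canonical\<close>; their
  sign is cancelled by the minus in the derivative of the inverse matrix.\<close>

definition info_weight :: "('k \<Rightarrow> real) \<Rightarrow> 'k \<times> ('p + 'p uprod) \<Rightarrow> real" where
  "info_weight N z = N (fst z) * (case snd z of Inl _ \<Rightarrow> 1 | Inr u \<Rightarrow> if proper_uprod u then 1 else 1 / 2)"

text \<open>The Fisher information operator, factored into maps of known determinant.\<close>

definition info_op :: "('k \<Rightarrow> real) \<Rightarrow> ('k::finite, 'p::finite) param \<Rightarrow> ('k, 'p) param \<Rightarrow> ('k, 'p) param" where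
  "info_op N \<phi> = coord_scale (info_weight N) \<circ> mean_shear (\<lambda>i. - mean \<phi> i)
     \<circ> gl_act (\<lambda>i. matrix_inv (conc \<phi> i)) \<circ> conc_shear (\<lambda>i. - mean \<phi> i)"

lemma linear_coord_scale: "linear (coord_scale e)"
  by (simp add: linear_iff coord_scale_def vec_eq_iff algebra_simps)

lemma bounded_bilinear_matrix_vector_mult: "bounded_bilinear (\<lambda>(A::real^'n^'m) (x::real^'n). A *v x)"
  by (intro bilinear_conv_bounded_bilinear[THEN iffD1])
     (auto simp: bilinear_def linear_iff vec_eq_iff matrix_vector_mult_def sum.distrib algebra_simps sum_distrib_left)

lemma bounded_bilinear_outer: "bounded_bilinear (outer :: real^'n \<Rightarrow> real^'n \<Rightarrow> real^'n^'n)"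
  by (intro bilinear_conv_bounded_bilinear[THEN iffD1])
     (auto simp: bilinear_def linear_iff outer_add_left outer_add_right outer_scaleR_left outer_scaleR_right)

text \<open>This is the Hessian of \<open>cumulant\<close>. With S the inverse concentration, dS =
  -S dLambda S and dmu = S (dxi - dLambda mu). The bracket is \<open>conc_shear\<close>, the
  multiplications by S are \<open>gl_act\<close>, and the derivative of mu mu^T supplies the
  \<open>mean_shear\<close>.\<close>

lemma has_derivative_mean_stat:
  fixes \<phi> :: "('k::finite, 'p::finite) param"
  assumes \<phi>: "\<phi> \<in> param_space"
  shows "((\<lambda>\<phi>. to_canonical (mean_stat N \<phi>)) has_derivative info_op N \<phi>) (at \<phi>)"
proof -
  define S where "S i = matrix_inv (conc \<phi> i)" for i
  define \<mu> where "\<mu> = mean \<phi>"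
  have L: "pos_def (conc \<phi> i)" for i using \<phi> by (simp add: param_space_def)
  have tS: "transpose (S i) = S i" for i unfolding S_def by (rule transpose_matrix_inv_sym[OF L])
  have dinv: "((\<lambda>\<phi>. matrix_inv (conc \<phi> i)) has_derivative (\<lambda>h. - (S i ** conc h i ** S i))) (at \<phi>)" for i
    unfolding S_def
    by (rule has_derivative_compose[OF bounded_linear_imp_has_derivative[OF bounded_linear_conc]
          has_derivative_matrix_inv[OF pos_def_invertible[OF L]]])
  define d\<mu> where "d\<mu> h i = S i *v (xi h i - conc h i *v \<mu> i)" for h :: "('k, 'p) param" and i
  have dmean: "((\<lambda>\<phi>. mean \<phi> i) has_derivative (\<lambda>h. d\<mu> h i)) (at \<phi>)" for i
  proof -
    have "((\<lambda>\<phi>. mean \<phi> i) has_derivative (\<lambda>h. matrix_inv (conc \<phi> i) *v xi h i + - (S i ** conc h i ** S i) *v xi \<phi> i)) (at \<phi>)"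
      unfolding mean_def
      by (rule bounded_bilinear.FDERIV[OF bounded_bilinear_matrix_vector_mult dinv
            bounded_linear_imp_has_derivative[OF bounded_linear_xi]])
    moreover have "matrix_inv (conc \<phi> i) *v xi h i + - (S i ** conc h i ** S i) *v xi \<phi> i = d\<mu> h i" for h
    proof -
      have "- (S i ** conc h i ** S i) *v xi \<phi> i = - (S i *v (conc h i *v \<mu> i))"
        by (simp add: \<mu>_def mean_def S_def matrix_vector_mul_assoc matrix_mul_assoc
            bounded_bilinear.minus_left[OF bounded_bilinear_matrix_vector_mult])
      then show ?thesis
        by (simp add: d\<mu>_def S_def matrix_vector_mult_diff_distrib)
    qed
    ultimately show ?thesis by simp
  qed
  define M where "M h i = - (S i ** conc h i ** S i) + (outer (\<mu> i) (d\<mu> h i) + outer (d\<mu> h i) (\<mu> i))" for h :: "('k, 'p) param" and i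
  have dcov: "((\<lambda>\<phi>. matrix_inv (conc \<phi> i) + outer (mean \<phi> i) (mean \<phi> i)) has_derivative
      (\<lambda>h. M h i)) (at \<phi>)" for i
    unfolding M_def \<mu>_def
    by (intro has_derivative_add dinv bounded_bilinear.FDERIV[OF bounded_bilinear_outer] dmean)
  \<comment> \<open>The three inner factors of \<open>info_op\<close> produce dmu in the
    \<open>xi\<close> part and -M in the \<open>conc\<close> part; the outer weights then match
    \<open>to_canonical\<close>.\<close>
  have xi_op: "xi ((mean_shear (\<lambda>i. - mean \<phi> i) \<circ> gl_act (\<lambda>i. matrix_inv (conc \<phi> i)) \<circ> conc_shear (\<lambda>i. - mean \<phi> i)) h) i = d\<mu> h i"
    for h i
    by (simp add: d\<mu>_def S_def \<mu>_def matrix_vector_mult_minus_right)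
  have conc_op: "conc ((mean_shear (\<lambda>i. - mean \<phi> i) \<circ> gl_act (\<lambda>i. matrix_inv (conc \<phi> i)) \<circ> conc_shear (\<lambda>i. - mean \<phi> i)) h) i
     = - M h i" for h i
    using tS[of i]
    by (simp add: M_def d\<mu>_def S_def \<mu>_def matrix_vector_mult_minus_right outer_minus_left outer_minus_right)
  have comp: "((\<lambda>\<phi>. to_canonical (mean_stat N \<phi>) $ z) has_derivative (\<lambda>h. info_op N \<phi> h $ z)) (at \<phi>)" for z
  proof -
    obtain i x where z: "z = (i, x)" by (cases z)
    show ?thesis
    proof (cases x)
      case (Inl a)
      have 1: "to_canonical (mean_stat N \<psi>) $ z = N i * mean \<psi> i $ a" for \<psi> :: "('k, 'p) param"
        using arg_cong[OF xi_mk_param[of "\<lambda>i. N i *\<^sub>R mean \<psi> i" _ i], of "\<lambda>x. x $ a"]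
        by (simp add: to_canonical_def z Inl mean_stat_def of_avg_cov_def xi_def)
      have 2: "info_op N \<phi> h $ z = N i * d\<mu> h i $ a" for h
        using arg_cong[OF xi_op[of h i], of "\<lambda>x. x $ a"]
        by (simp add: info_op_def coord_scale_def z Inl xi_def info_weight_def)
      show ?thesis unfolding 1 2
        by (intro has_derivative_mult_right bounded_linear.has_derivative[OF bounded_linear_vec_nth dmean])
    next
      case (Inr u)
      obtain a b where u: "u = Upair a b" by (cases u)
      define c :: real where "c = (if a \<noteq> b then - 1 else - 1 / 2)"
      \<comment> \<open>Entries of \<open>mk_param\<close> can be read off only for symmetric
        matrices, and the inverse concentration is known to be symmetric on
        \<open>param_space\<close>; hence the detour through an open set.\<close>
      have 1: "to_canonical (mean_stat N \<psi>) $ z = c * N i * (matrix_inv (conc \<psi> i) + outer (mean \<psi> i) (mean \<psi> i)) $ a $ b"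
        if "\<psi> \<in> param_space" for \<psi> :: "('k, 'p) param"
      proof -
        have "pos_def (conc \<psi> i)" for i using that by (simp add: param_space_def)
        then have "conc (mean_stat N \<psi>) i = N i *\<^sub>R (matrix_inv (conc \<psi> i) + outer (mean \<psi> i) (mean \<psi> i))"
          unfolding mean_stat_def of_avg_cov_def
          by (subst conc_mk_param) (simp_all add: transpose_add transpose_scaleR transpose_outer transpose_matrix_inv_sym)
        from arg_cong[OF this, of "\<lambda>M. M $ a $ b"]
        have "mean_stat N \<psi> $ (i, Inr (Upair a b)) = N i * (matrix_inv (conc \<psi> i) + outer (mean \<psi> i) (mean \<psi> i)) $ a $ b"
          by (simp add: conc_def)
        then show ?thesis by (simp add: to_canonical_def z Inr u c_def)
      qed
      have 2: "info_op N \<phi> h $ z = c * N i * M h i $ a $ b" for h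
      proof -
        have "info_op N \<phi> h $ z = info_weight N z * (- M h i) $ a $ b"
          unfolding conc_op[symmetric] by (simp add: info_op_def coord_scale_def z Inr u conc_def[of "_ _"])
        then show ?thesis by (simp add: info_weight_def z Inr u c_def)
      qed
      have "((\<lambda>\<psi>. c * N i * (matrix_inv (conc \<psi> i) + outer (mean \<psi> i) (mean \<psi> i)) $ a $ b) has_derivative (\<lambda>h. info_op N \<phi> h $ z)) (at \<phi>)"
        unfolding 2
        by (intro has_derivative_mult_right bounded_linear.has_derivative[OF bounded_linear_vec_nth]
              bounded_linear.has_derivative[OF bounded_linear_vec_nth dcov])
      then show ?thesis
        by (rule has_derivative_transform_within_open[OF _ open_param_space \<phi>]) (simp add: 1)
    qed
  qed
  show ?thesis
    unfolding has_derivative_componentwise_within[of _ "info_op N \<phi>"]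
    using comp by (auto simp: Basis_vec_def inner_axis)
qed

text \<open>First-order convexity of the cumulant function. It expresses that a parameter maximizes
  the likelihood of its own mean statistic, so it follows from
  \<open>stat_loglik_le\<close>.\<close>

lemma cumulant_squeeze:
  fixes \<phi> \<psi> :: "('k::finite, 'p::finite) param"
  assumes N: "\<And>i. N i > 0" and \<phi>: "\<phi> \<in> param_space" and \<psi>: "\<psi> \<in> param_space"
  shows "0 \<le> cumulant N \<psi> - cumulant N \<phi> - (\<psi> - \<phi>) \<bullet> to_canonical (mean_stat N \<phi>)"
proof -
  have "pos_def (conc \<phi> i)" for i using \<phi> by (simp add: param_space_def)
  then have C: "pos_def (group_cov N (mean_stat N \<phi>) i)" for i
    by (simp add: group_cov_mean_stat N \<phi> pos_def_matrix_inv)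
  have "stat_loglik N (mean_stat N \<phi>) \<psi> \<le> stat_loglik N (mean_stat N \<phi>) \<phi>"
    using stat_loglik_le[where N=N, OF N C \<psi>] stat_loglik_stat_mle[where N=N, OF N C] by (simp add: stat_mle_mean_stat[where N=N, OF N \<phi>])
  then show ?thesis by (simp add: stat_loglik_def inner_diff_left)
qed

text \<open>The gradient is obtained without differentiating determinants: maximality of the likelihood at
  \<open>\<phi>\<close> and at \<open>\<psi>\<close> squeezes the first-order remainder of the cumulant function between \<open>0\<close> and
  \<open>(\<psi> - \<phi>) \<bullet> (u \<psi> - u \<phi>)\<close>.\<close>

lemma GDERIV_cumulant:
  fixes \<phi> :: "('k::finite, 'p::finite) param"
  assumes N: "\<And>i. N i > 0" and \<phi>: "\<phi> \<in> param_space"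
  shows "GDERIV (cumulant N) \<phi> :> to_canonical (mean_stat N \<phi>)"
proof -
  define u where "u \<psi> = to_canonical (mean_stat N \<psi>)" for \<psi> :: "('k, 'p) param"
  have "isCont u \<phi>"
    using has_derivative_continuous[OF has_derivative_mean_stat[OF \<phi>, of N]] unfolding u_def .
  then have "((\<lambda>\<psi>. norm (u \<psi> - u \<phi>)) \<longlongrightarrow> norm (u \<phi> - u \<phi>)) (at \<phi>)"
    unfolding isCont_def by (intro tendsto_intros)
  then have lim: "((\<lambda>\<psi>. norm (u \<psi> - u \<phi>)) \<longlongrightarrow> 0) (at \<phi>)" by simp
  have ev: "\<forall>\<^sub>F \<psi> in at \<phi>. \<psi> \<in> param_space"
    using open_param_space \<phi> by (auto simp: eventually_at_topological)
  show ?thesis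
    unfolding gderiv_def has_derivative_iff_norm u_def[symmetric]
  proof
    show "bounded_linear (\<lambda>h. h \<bullet> u \<phi>)" by (rule bounded_linear_inner_left)
    show "((\<lambda>y. norm (cumulant N y - cumulant N \<phi> - (y - \<phi>) \<bullet> u \<phi>) / norm (y - \<phi>)) \<longlongrightarrow> 0) (at \<phi>)"
    proof (rule Lim_null_comparison[OF _ lim])
      show "\<forall>\<^sub>F \<psi> in at \<phi>. norm (norm (cumulant N \<psi> - cumulant N \<phi> - (\<psi> - \<phi>) \<bullet> u \<phi>) / norm (\<psi> - \<phi>)) \<le> norm (u \<psi> - u \<phi>)"
        using ev eventually_neq_at_within[of \<phi> \<phi> UNIV]
      proof eventually_elim
        case (elim \<psi>)
        have "0 \<le> cumulant N \<psi> - cumulant N \<phi> - (\<psi> - \<phi>) \<bullet> u \<phi>"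
          unfolding u_def by (rule cumulant_squeeze[where N=N, OF N \<phi> elim(1)])
        moreover have "cumulant N \<psi> - cumulant N \<phi> - (\<psi> - \<phi>) \<bullet> u \<phi> \<le> (\<psi> - \<phi>) \<bullet> (u \<psi> - u \<phi>)"
          using cumulant_squeeze[where N=N, OF N elim(1) \<phi>] unfolding u_def by (simp add: inner_diff_left inner_diff_right)
        moreover have "(\<psi> - \<phi>) \<bullet> (u \<psi> - u \<phi>) \<le> norm (\<psi> - \<phi>) * norm (u \<psi> - u \<phi>)"
          by (rule norm_cauchy_schwarz)
        ultimately show ?case using elim(2) by (simp add: divide_le_eq mult.commute)
      qed
    qed
  qed
qed

section \<open>Gradient, observed information and its determinant\<close>

lemma gradient_eqI:
  assumes "GDERIV f x :> D"
  shows "gradient f x = D"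
  unfolding gradient_def
proof (rule the_equality[of "\<lambda>D. GDERIV f x :> D", OF assms])
  fix D' assume "GDERIV f x :> D'"
  with assms have "(\<lambda>h. h \<bullet> D') = (\<lambda>h. h \<bullet> D)"
    unfolding gderiv_def by (rule has_derivative_unique[rotated])
  then have "(D' - D) \<bullet> D' = (D' - D) \<bullet> D" by (simp add: fun_eq_iff)
  then have "(D' - D) \<bullet> (D' - D) = 0" by (simp add: inner_diff_right)
  then show "D' = D" by simp
qed

lemma gradient_stat_loglik:
  fixes \<phi> :: "('k::finite, 'p::finite) param"
  assumes N: "\<And>i. N i > 0" and l: "\<And>\<phi>. \<phi> \<in> param_space \<Longrightarrow> l \<phi> = stat_loglik N v \<phi>" and \<phi>: "\<phi> \<in> param_space"
  shows "gradient l \<phi> = to_canonical v - to_canonical (mean_stat N \<phi>)"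
proof (rule gradient_eqI)
  have "(stat_loglik N v has_derivative (\<lambda>h. h \<bullet> to_canonical v - h \<bullet> to_canonical (mean_stat N \<phi>))) (at \<phi>)"
    unfolding stat_loglik_def using GDERIV_cumulant[where N=N, OF N \<phi>]
    by (intro has_derivative_diff bounded_linear_imp_has_derivative[OF bounded_linear_inner_left]) (simp_all add: gderiv_def)
  then have "(l has_derivative (\<lambda>h. h \<bullet> to_canonical v - h \<bullet> to_canonical (mean_stat N \<phi>))) (at \<phi>)"
    by (rule has_derivative_transform_within_open[OF _ open_param_space \<phi>]) (simp add: l)
  then show "GDERIV l \<phi> :> to_canonical v - to_canonical (mean_stat N \<phi>)"
    by (simp add: gderiv_def inner_diff_right)
qed

text \<open>The statistic enters linearly, so the second derivative does not see v. Differentiating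
  the gradient requires its formula on a whole neighbourhood, which \<open>open_param_space\<close>
  provides.\<close>

lemma obs_information_stat_loglik:
  fixes \<phi> :: "('k::finite, 'p::finite) param"
  assumes N: "\<And>i. N i > 0" and l: "\<And>\<phi>. \<phi> \<in> param_space \<Longrightarrow> l \<phi> = stat_loglik N v \<phi>" and \<phi>: "\<phi> \<in> param_space"
  shows "obs_information l \<phi> = matrix (info_op N \<phi>)"
proof -
  have "((\<lambda>\<phi>. to_canonical v - to_canonical (mean_stat N \<phi>)) has_derivative (\<lambda>h. 0 - info_op N \<phi> h)) (at \<phi>)"
    by (intro has_derivative_diff has_derivative_const has_derivative_mean_stat \<phi>)
  then have "(gradient l has_derivative (\<lambda>h. 0 - info_op N \<phi> h)) (at \<phi>)"
    by (rule has_derivative_transform_within_open[OF _ open_param_space \<phi>]) (simp add: gradient_stat_loglik[where N=N and l=l and v=v, OF N l])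
  then have "frechet_derivative (gradient l) (at \<phi>) = (\<lambda>h. 0 - info_op N \<phi> h)"
    by (rule frechet_derivative_at[symmetric])
  then show ?thesis
    by (simp add: obs_information_def jacobian_def matrix_def vec_eq_iff)
qed

text \<open>A scale factor is only the absolute value of a determinant; exhibiting f as a square
  settles the sign. The shears and the congruence in the information operator are such
  squares.\<close>

lemma det_matrix_square:
  fixes f g :: "real^'n \<Rightarrow> real^'n"
  assumes g: "linear g" and f: "f = g \<circ> g" "bij f"
  shows "det (matrix f) = lin_scale f"
proof -
  have lf: "linear f" unfolding f by (rule linear_compose[OF g g])
  have "det (matrix f) = (det (matrix g))^2"
    unfolding f using g by (simp add: matrix_compose det_mul power2_eq_square)
  then show ?thesis using lin_scale_eq_abs_det[OF lf f(2)] by simp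
qed

text \<open>Unlike \<open>pos_def_root\<close> this has M = S S, which makes \<open>gl_act\<close>
  of such matrices the square of a linear map.\<close>

lemma pos_def_sqrt:
  fixes M :: "real^'p^'p"
  assumes "pos_def M"
  obtains S :: "real^'p^'p" where "M = S ** S"
proof -
  obtain Q :: "real^'p^'p" and d where Q: "orthogonal_matrix Q" and M: "M = Q ** diag_mat d ** transpose Q" and d: "\<And>i. d i > 0"
    by (rule pos_def_diagonalizable[OF assms]) (rule that)
  define S where "S = Q ** diag_mat (\<lambda>i. sqrt (d i)) ** transpose Q"
  have "S ** S = Q ** diag_mat (\<lambda>i. sqrt (d i)) ** (transpose Q ** Q) ** diag_mat (\<lambda>i. sqrt (d i)) ** transpose Q"
    by (simp add: S_def matrix_mul_assoc)
  also have "\<dots> = Q ** (diag_mat (\<lambda>i. sqrt (d i)) ** diag_mat (\<lambda>i. sqrt (d i))) ** transpose Q"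
    using Q by (simp add: orthogonal_matrix_def matrix_mul_assoc)
  also have "\<dots> = M" using d by (simp add: M diag_mat_mult less_imp_le)
  finally show ?thesis using that by metis
qed

lemma bij_coord_scale: "(\<And>z. e z \<noteq> 0) \<Longrightarrow> bij (coord_scale e)"
  by (rule o_bij[of "coord_scale (\<lambda>z. 1 / e z)"]) (auto simp: fun_eq_iff coord_scale_def vec_eq_iff)

lemma info_weight_pos: "(\<And>i. N i > 0) \<Longrightarrow> info_weight N z > 0"
  by (auto simp: info_weight_def split: sum.split)

text \<open>The weights contribute a constant, the shears contribute 1, and the covariances act
  through \<open>gl_act\<close> with exponent p + 2.\<close>

lemma det_info_op:
  fixes \<phi> :: "('k::finite, 'p::finite) param"
  assumes N: "\<And>i. N i > 0" and \<phi>: "\<phi> \<in> param_space"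
  shows "det (matrix (info_op N \<phi>)) =
    (\<Prod>z\<in>(UNIV :: ('k \<times> ('p + 'p uprod)) set). info_weight N z) * (\<Prod>i\<in>UNIV. det (matrix_inv (conc \<phi> i)) ^ (CARD('p) + 2))"
proof -
  define S where "S i = matrix_inv (conc \<phi> i)" for i
  have S: "pos_def (S i)" for i using \<phi> by (simp add: param_space_def S_def pos_def_matrix_inv)
  have Sinv: "invertible (S i)" for i by (rule pos_def_invertible[OF S])
  define b where "b i = - mean \<phi> i" for i
  have e: "info_weight N z > 0" for z :: "'k \<times> ('p + 'p uprod)" using info_weight_pos N by blast
  have e0: "info_weight N z \<noteq> 0" for z :: "'k \<times> ('p + 'p uprod)" using e[of z] by simp
  have 1: "det (matrix (coord_scale (info_weight N) :: ('k, 'p) param \<Rightarrow> _)) = (\<Prod>z\<in>(UNIV :: ('k \<times> ('p + 'p uprod)) set). info_weight N z)"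
  proof -
    have "matrix (coord_scale (info_weight N) :: ('k, 'p) param \<Rightarrow> _) = diag_mat (info_weight N)"
      by (auto simp: matrix_def coord_scale_def diag_mat_def vec_eq_iff axis_def)
    then show ?thesis by (simp add: det_diag_mat)
  qed
  have 2: "det (matrix (mean_shear b)) = 1"
  proof -
    have eq: "mean_shear b = mean_shear (\<lambda>i. (1/2) *\<^sub>R b i) \<circ> mean_shear (\<lambda>i. (1/2) *\<^sub>R b i)"
      by (rule ext, rule param_eqI) (simp_all add: vec_eq_iff outer_def)
    show ?thesis using det_matrix_square[OF linear_mean_shear eq bij_mean_shear] by (simp add: lin_scale_mean_shear)
  qed
  have 3: "det (matrix (conc_shear b)) = 1"
  proof -
    have eq: "conc_shear b = conc_shear (\<lambda>i. (1/2) *\<^sub>R b i) \<circ> conc_shear (\<lambda>i. (1/2) *\<^sub>R b i)"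
      by (rule ext, rule param_eqI) (simp_all add: matrix_vector_mult_scaleR add.assoc flip: scaleR_add_left)
    show ?thesis using det_matrix_square[OF linear_conc_shear eq bij_conc_shear] by (simp add: lin_scale_conc_shear)
  qed
  have 4: "det (matrix (gl_act S)) = (\<Prod>i\<in>UNIV. det (S i) ^ (CARD('p) + 2))"
  proof -
    have "\<exists>R. S i = R ** R" for i by (rule pos_def_sqrt[OF S[of i]]) blast
    then obtain R where R: "S i = R i ** R i" for i
      using choice[of "\<lambda>i R. S i = R ** R"] by auto
    have eq: "gl_act S = gl_act R \<circ> gl_act R"
      unfolding gl_act_comp R[symmetric] by simp
    show ?thesis
      using det_matrix_square[OF linear_gl_act eq bij_gl_act[OF Sinv]]
      by (simp add: lin_scale_gl_act[OF Sinv] abs_of_pos[OF pos_def_det_pos[OF S]])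
  qed
  have "info_op N \<phi> = coord_scale (info_weight N) \<circ> (mean_shear b \<circ> (gl_act S \<circ> conc_shear b))"
    by (simp add: info_op_def b_def[abs_def] S_def[abs_def] o_assoc)
  then have "det (matrix (info_op N \<phi>)) = det (matrix (coord_scale (info_weight N) :: ('k, 'p) param \<Rightarrow> _))
      * (det (matrix (mean_shear b)) * (det (matrix (gl_act S)) * det (matrix (conc_shear b))))"
    by (simp add: matrix_compose det_mul linear_compose linear_coord_scale linear_mean_shear linear_gl_act linear_conc_shear)
  then show ?thesis by (simp add: 1 2 3 4 S_def)
qed

section \<open>Pooled statistics and rays\<close>

definition pooled :: "('k \<Rightarrow> real) \<Rightarrow> ('k::finite, 'p::finite) param \<Rightarrow> ('k, 'p) param" where
  "pooled N v = (\<chi> z. N (fst z) / sum N UNIV * (\<Sum>j\<in>UNIV. v $ (j, snd z)))"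

text \<open>\<open>pooled\<close> is the linear projection that keeps the totals and gives each
  group its share N i / n of them, so that every group has average ybar and covariance (A + B)/n.
  \<open>radial\<close> is the dilation about it: t = 1 is the data and t = 0 the constrained
  fit.\<close>

definition radial :: "('k \<Rightarrow> real) \<Rightarrow> real \<Rightarrow> ('k::finite, 'p::finite) param \<Rightarrow> ('k, 'p) param" where
  "radial N t v = pooled N v + t *\<^sub>R (v - pooled N v)"

lemma linear_pooled: "linear (pooled N)"
  by (simp add: linear_iff pooled_def vec_eq_iff sum.distrib algebra_simps sum_distrib_left)

lemma xi_pooled: "xi (pooled N v) i = (N i / sum N UNIV) *\<^sub>R (\<Sum>j\<in>UNIV. xi v j)"
  by (simp add: xi_def pooled_def vec_eq_iff)

lemma conc_pooled: "conc (pooled N v) i = (N i / sum N UNIV) *\<^sub>R (\<Sum>j\<in>UNIV. conc v j)"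
  by (simp add: conc_def pooled_def vec_eq_iff)

lemma sum_weights_pos: "(\<And>i. N i > 0) \<Longrightarrow> sum N (UNIV :: 'k::finite set) > (0 :: real)"
  by (intro sum_pos) auto

lemma pooled_pooled:
  assumes N: "\<And>i. N i > 0"
  shows "pooled N (pooled N v) = pooled N v"
proof -
  have "(\<Sum>j\<in>UNIV. N j / sum N UNIV * c) = c" for c :: real
    using sum_weights_pos[where N=N, OF N] by (simp add: sum_divide_distrib[symmetric] sum_distrib_right[symmetric])
  then show ?thesis by (simp add: pooled_def vec_eq_iff)
qed

lemma pooled_radial: "(\<And>i. N i > 0) \<Longrightarrow> pooled N (radial N t v) = pooled N v"
  by (simp add: radial_def linear_add[OF linear_pooled] linear_scale[OF linear_pooled]
      linear_diff[OF linear_pooled] pooled_pooled)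

lemma radial_radial: "(\<And>i. N i > 0) \<Longrightarrow> radial N s (radial N t v) = radial N (s * t) v"
  by (simp add: radial_def[of _ s] pooled_radial) (simp add: radial_def)

lemma radial_1 [simp]: "radial N 1 v = v"
  by (simp_all add: radial_def)

text \<open>A null parameter has the same components in all groups, so the pairing sees only the
  totals, and \<open>pooled\<close> keeps these. This is why the null likelihood is constant on
  rays.\<close>

lemma inner_to_canonical_pooled:
  fixes \<phi> v :: "('k::finite, 'p::finite) param"
  assumes N: "\<And>i. N i > 0" and \<phi>: "\<phi> \<in> null_params"
  shows "\<phi> \<bullet> to_canonical (pooled N v) = \<phi> \<bullet> to_canonical v"
proof -
  have L: "pos_def (conc \<phi> i)" for i using \<phi> by (simp add: param_space_def null_params_def)
  have x: "xi \<phi> i = conc \<phi> i *v mean \<phi> i" for i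
    by (simp add: mean_def matrix_vector_mul_assoc matrix_inv_right[OF pos_def_invertible[OF L]])
  define k0 :: 'k where "k0 = undefined"
  define x0 where "x0 = xi \<phi> k0"
  define L0 where "L0 = conc \<phi> k0"
  have eq: "xi \<phi> i = x0" "conc \<phi> i = L0" for i
    using \<phi> x unfolding null_params_def H_psi_def x0_def L0_def by auto metis+
  have "\<phi> \<bullet> to_canonical (pooled N v) =
     (\<Sum>i\<in>UNIV. N i / sum N UNIV * (x0 \<bullet> (\<Sum>j\<in>UNIV. xi v j) - trace (L0 ** (\<Sum>j\<in>UNIV. conc v j)) / 2))"
    unfolding inner_to_canonical eq xi_pooled conc_pooled
    by (simp add: matrix_mult_scaleR_right trace_def sum_distrib_left right_diff_distrib sum_divide_distrib)
  also have "\<dots> = x0 \<bullet> (\<Sum>j\<in>UNIV. xi v j) - trace (L0 ** (\<Sum>j\<in>UNIV. conc v j)) / 2"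
    using sum_weights_pos[where N=N, OF N] by (simp add: sum_divide_distrib[symmetric] sum_distrib_right[symmetric])
  also have "\<dots> = \<phi> \<bullet> to_canonical v"
    unfolding inner_to_canonical eq
    by (simp add: inner_sum_right matrix_mult_sum_right trace_sum sum_subtractf sum_divide_distrib)
  finally show ?thesis .
qed

lemma group_cov_convex:
  fixes v w :: "('k::finite, 'p::finite) param"
  shows "group_cov N ((1 - t) *\<^sub>R v + t *\<^sub>R w) i = (1 - t) *\<^sub>R group_cov N v i + t *\<^sub>R group_cov N w i
    + (t * (1 - t)) *\<^sub>R outer (group_avg N v i - group_avg N w i) (group_avg N v i - group_avg N w i)"
  by (simp add: group_cov_def group_avg_def vec_eq_iff outer_def algebra_simps diff_divide_distrib add_divide_distrib)

text \<open>The mixed term in \<open>group_cov_convex\<close> has coefficient t (1 - t), which is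
  nonnegative on [0, 1], so positive definiteness at the ends of a segment spreads over it.\<close>

lemma pos_def_group_cov_convex:
  fixes v w :: "('k::finite, 'p::finite) param"
  assumes v: "pos_def (group_cov N v i)" and w: "pos_def (group_cov N w i)" and t: "0 \<le> t" "t \<le> 1"
  shows "pos_def (group_cov N ((1 - t) *\<^sub>R v + t *\<^sub>R w) i)"
proof -
  have "0 < x \<bullet> (group_cov N ((1 - t) *\<^sub>R v + t *\<^sub>R w) i *v x)" if x: "x \<noteq> 0" for x
  proof -
    let ?d = "group_avg N v i - group_avg N w i"
    have "x \<bullet> (group_cov N ((1 - t) *\<^sub>R v + t *\<^sub>R w) i *v x) =
      (1 - t) * (x \<bullet> (group_cov N v i *v x)) + t * (x \<bullet> (group_cov N w i *v x)) + (t * (1 - t)) * (?d \<bullet> x)^2"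
      unfolding group_cov_convex
      by (simp add: matrix_vector_mult_add_rdistrib scaleR_matrix_vector_assoc[symmetric] inner_add_right
          outer_mult_vec power2_eq_square inner_commute)
    moreover have "0 < (1 - t) * (x \<bullet> (group_cov N v i *v x)) + t * (x \<bullet> (group_cov N w i *v x))"
    proof (cases "t = 0")
      case True
      then show ?thesis using v x by (simp add: pos_def_def)
    next
      case False
      have "0 < t * (x \<bullet> (group_cov N w i *v x))" "0 \<le> (1 - t) * (x \<bullet> (group_cov N v i *v x))"
        using False v w x t by (simp_all add: pos_def_def less_imp_le)
      then show ?thesis by simp
    qed
    moreover have "0 \<le> (t * (1 - t)) * (?d \<bullet> x)^2" using t by simp
    ultimately show ?thesis by linarith
  qed
  then show ?thesis by (simp add: pos_def_def)
qed

lemma group_avg_pooled: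
  assumes N: "\<And>i. N i > 0"
  shows "group_avg N (pooled N v) i = (1 / sum N UNIV) *\<^sub>R (\<Sum>j\<in>UNIV. xi v j)"
  using N[of i] by (simp add: group_avg_def xi_pooled)

lemma group_cov_pooled:
  assumes N: "\<And>i. N i > 0"
  shows "group_cov N (pooled N v) i = (1 / sum N UNIV) *\<^sub>R (\<Sum>j\<in>UNIV. conc v j)
    - outer ((1 / sum N UNIV) *\<^sub>R (\<Sum>j\<in>UNIV. xi v j)) ((1 / sum N UNIV) *\<^sub>R (\<Sum>j\<in>UNIV. xi v j))"
  unfolding group_cov_def group_avg_pooled[of N, OF N] using N[of i] by (simp add: conc_pooled)

text \<open>Decomposition of variance: the pooled form is the within-group part, which is positive,
  plus the between-group part of the averages, which is nonnegative.\<close>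

lemma pos_def_group_cov_pooled:
  fixes v :: "('k::finite, 'p::finite) param"
  assumes N: "\<And>i. N i > 0" and C: "\<And>i. pos_def (group_cov N v i)"
  shows "pos_def (group_cov N (pooled N v) i)"
proof -
  define s where "s = sum N UNIV"
  have s: "s > 0" unfolding s_def by (rule sum_weights_pos[where N=N, OF N])
  have "0 < x \<bullet> (group_cov N (pooled N v) i *v x)" if x: "x \<noteq> 0" for x
  proof -
    define a where "a j = group_avg N v j \<bullet> x" for j
    define b where "b = (\<Sum>j\<in>UNIV. N j / s * a j)"
    have N0: "N j \<noteq> 0" for j using N[of j] by simp
    have 1: "x \<bullet> (conc v j *v x) = N j * (x \<bullet> (group_cov N v j *v x) + (a j)^2)" for j
      by (simp add: conc_eq_cov[of N, OF N0] scaleR_matrix_vector_assoc[symmetric] matrix_vector_mult_add_rdistrib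
          inner_add_right outer_mult_vec a_def power2_eq_square inner_commute)
    have 2: "xi v j \<bullet> x = N j * a j" for j
      by (simp add: a_def xi_eq_avg[of N, OF N0])
    define g where "g = (1 / s) *\<^sub>R (\<Sum>j\<in>UNIV. xi v j)"
    have bs: "g \<bullet> x = b"
      by (simp add: g_def inner_sum_left 2 b_def sum_distrib_left)
    have mv: "(\<Sum>j\<in>UNIV. conc v j) *v x = (\<Sum>j\<in>UNIV. conc v j *v x)"
      by (rule bounded_bilinear.sum_left[OF bounded_bilinear_matrix_vector_mult])
    have "x \<bullet> (group_cov N (pooled N v) i *v x) = (1 / s) * (\<Sum>j\<in>UNIV. x \<bullet> (conc v j *v x)) - b^2"
      unfolding group_cov_pooled[where N=N, OF N] s_def[symmetric] g_def[symmetric]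
      using bs by (simp add: matrix_vector_mult_diff_rdistrib scaleR_matrix_vector_assoc[symmetric] inner_diff_right
          outer_mult_vec mv inner_sum_right power2_eq_square inner_commute)
    also have "\<dots> = (\<Sum>j\<in>UNIV. N j / s * (x \<bullet> (group_cov N v j *v x))) + ((\<Sum>j\<in>UNIV. N j / s * (a j)^2) - b^2)"
      by (simp add: 1 sum_distrib_left distrib_left sum.distrib)
    also have "(\<Sum>j\<in>UNIV. N j / s * (a j)^2) - b^2 = (\<Sum>j\<in>UNIV. N j / s * (a j - b)^2)"
    proof -
      have w1: "(\<Sum>j\<in>UNIV. N j / s) = 1" using s by (simp add: sum_divide_distrib[symmetric] s_def)
      have "(\<Sum>j\<in>UNIV. N j / s * (a j - b)^2) = (\<Sum>j\<in>UNIV. N j / s * (a j)^2 - 2 * b * (N j / s * a j) + b^2 * (N j / s))"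
      proof (intro sum.cong refl)
        fix j
        have "w * (a' - b)^2 = w * a'^2 - 2 * b * (w * a') + b^2 * w" for w a' :: real
          by (simp add: power2_eq_square algebra_simps)
        then show "N j / s * (a j - b)^2 = N j / s * (a j)^2 - 2 * b * (N j / s * a j) + b^2 * (N j / s)" .
      qed
      also have "\<dots> = (\<Sum>j\<in>UNIV. N j / s * (a j)^2) - 2 * b * b + b^2"
        by (simp only: sum.distrib sum_subtractf sum_distrib_left[symmetric] w1 b_def[symmetric] mult_1_right)
      finally show ?thesis by (simp add: power2_eq_square)
    qed
    also have "0 < (\<Sum>j\<in>UNIV. N j / s * (x \<bullet> (group_cov N v j *v x))) + (\<Sum>j\<in>UNIV. N j / s * (a j - b)^2)"
    proof (rule add_pos_nonneg)
      show "0 < (\<Sum>j\<in>UNIV. N j / s * (x \<bullet> (group_cov N v j *v x)))"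
        using N s C x by (intro sum_pos mult_pos_pos) (auto simp: pos_def_def)
      show "0 \<le> (\<Sum>j\<in>UNIV. N j / s * (a j - b)^2)"
        using N s by (intro sum_nonneg mult_nonneg_nonneg) (auto intro: less_imp_le)
    qed
    finally show ?thesis .
  qed
  then show ?thesis by (simp add: pos_def_def)
qed

section \<open>Constrained estimate and saddlepoint approximation along the ray\<close>

lemma stat_mle_pooled_in_null:
  assumes N: "\<And>i. N i > 0" and C: "\<And>i. pos_def (group_cov N v i)"
  shows "stat_mle N (pooled N v) \<in> null_params"
  using stat_mle_in_param_space[OF pos_def_group_cov_pooled[where N=N, OF N C]]
  by (auto simp: null_params_def H_psi_def mean_stat_mle[OF pos_def_group_cov_pooled[where N=N, OF N C]]
      conc_stat_mle[OF pos_def_group_cov_pooled[where N=N, OF N C]] group_avg_pooled[where N=N, OF N] group_cov_pooled[where N=N, OF N])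

text \<open>On null parameters the likelihoods of v and of \<open>pooled N v\<close> agree. The
  unconstrained maximizer for the pooled statistic is itself a null parameter, so it is the
  constrained maximizer for v, and uniqueness carries over.\<close>

lemma
  assumes N: "\<And>i. N i > 0" and C: "\<And>i. pos_def (group_cov N v i)"
    and l: "\<And>\<phi>. \<phi> \<in> param_space \<Longrightarrow> l \<phi> = stat_loglik N v \<phi>"
  shows mle_null_exists: "mle_exists null_params l"
    and mle_null_eq: "mle null_params l = stat_mle N (pooled N v)"
proof -
  let ?w = "pooled N v"
  have C': "pos_def (group_cov N ?w i)" for i by (rule pos_def_group_cov_pooled[where N=N, OF N C])
  have l': "l \<phi> = stat_loglik N ?w \<phi>" if "\<phi> \<in> null_params" for \<phi>
    using that by (simp add: l null_params_def stat_loglik_def)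
      (simp add: inner_to_canonical_pooled[where N=N, OF N] null_params_def)
  have sub: "null_params \<subseteq> param_space" by (auto simp: null_params_def)
  have m: "stat_mle N ?w \<in> null_params" by (rule stat_mle_pooled_in_null[where N=N, OF N C])
  have ex: "is_arg_max l (\<lambda>\<phi>. \<phi> \<in> null_params) (stat_mle N ?w)"
    using m sub stat_loglik_le[where N=N, OF N C'] by (auto simp: is_arg_max_linorder l' stat_loglik_stat_mle[where N=N, OF N C'])
  then show "mle_exists null_params l" by (auto simp: mle_exists_def)
  have "is_arg_max l (\<lambda>\<phi>. \<phi> \<in> null_params) (mle null_params l)"
    unfolding mle_def arg_max_def using ex by (rule someI)
  then have n: "mle null_params l \<in> null_params" and "stat_loglik N ?w (stat_mle N ?w) \<le> stat_loglik N ?w (mle null_params l)"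
    using m by (auto simp: is_arg_max_linorder l')
  then have "stat_loglik N ?w (mle null_params l) = max_stat_loglik N ?w"
    using sub stat_loglik_le[where N=N, OF N C', of "mle null_params l"] by (auto simp: stat_loglik_stat_mle[where N=N, OF N C'] intro: antisym)
  then show "mle null_params l = stat_mle N ?w"
    using n sub by (intro stat_loglik_max_unique[where N=N, OF N C']) auto
qed

text \<open>The gradient at the constrained estimate is the difference between v and its fitted
  moments, which are \<open>pooled N v\<close>. Tilting by s(t) therefore only replaces v by a point
  of its ray.\<close>

lemma loglik_at_s_line:
  assumes N: "\<And>i. N i > 0" and C: "\<And>i. pos_def (group_cov N v i)"
    and l: "\<And>\<phi>. \<phi> \<in> param_space \<Longrightarrow> l \<phi> = stat_loglik N v \<phi>"
    and \<phi>: "\<phi> \<in> param_space"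
  shows "loglik_at l (s_line null_params l t) \<phi> = stat_loglik N (radial N t v) \<phi>"
proof -
  have C': "pos_def (group_cov N (pooled N v) i)" for i by (rule pos_def_group_cov_pooled[where N=N, OF N C])
  have sp: "s_psi null_params l = to_canonical (pooled N v) - to_canonical v"
  proof -
    have "mle null_params l = stat_mle N (pooled N v)" by (rule mle_null_eq[where N=N and l=l and v=v, OF N C l])
    moreover have "gradient l (stat_mle N (pooled N v)) = to_canonical v - to_canonical (mean_stat N (stat_mle N (pooled N v)))"
      by (rule gradient_stat_loglik[where N=N and l=l and v=v, OF N l stat_mle_in_param_space[OF C']])
    ultimately show ?thesis by (simp add: s_psi_def mean_stat_stat_mle[where N=N, OF N C'])
  qed
  have rd: "radial N t v = v + (1 - t) *\<^sub>R (pooled N v - v)"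
    by (simp add: radial_def algebra_simps)
  show ?thesis
    unfolding loglik_at_def s_line_def l[OF \<phi>] stat_loglik_def sp rd
    by (simp add: inner_add_right inner_diff_right
        linear_add[OF linear_to_canonical] linear_scale[OF linear_to_canonical] linear_diff[OF linear_to_canonical] algebra_simps)
qed

text \<open>The maximized log-likelihood is a constant minus the sum of N i / 2 times the log
  determinants, and the information determinant contributes the exponent p + 2. All other factors
  are the same for every t and form c'.\<close>

lemma saddlepoint_s_line:
  fixes v :: "('k::finite, 'p::finite) param"
  assumes N: "\<And>i. N i > 0" and C: "\<And>i. pos_def (group_cov N v i)"
    and l: "\<And>\<phi>. \<phi> \<in> param_space \<Longrightarrow> l \<phi> = stat_loglik N v \<phi>" and c: "c > 0"
  shows "\<exists>c'>0. \<forall>t. (\<forall>i. pos_def (group_cov N (radial N t v) i)) \<longrightarrow>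
    saddlepoint c param_space null_params l (s_line null_params l t) =
      c' * (\<Prod>i\<in>UNIV. det (group_cov N (radial N t v) i) powr ((N i - CARD('p) - 2) / 2))"
proof -
  define E where "E = (\<Prod>z\<in>(UNIV :: ('k \<times> ('p + 'p uprod)) set). info_weight N z)"
  have E: "E > 0" unfolding E_def using info_weight_pos[of N] N by (intro prod_pos) auto
  define K where "K = stat_loglik N (pooled N v) (stat_mle N (pooled N v))"
  define D where "D = (\<Sum>i\<in>UNIV. N i / 2 * (CARD('p) + CARD('p) * ln (2 * pi)))"
  define c' where "c' = c * exp (K + D) * E powr (- 1 / 2)"
  have "c' > 0" using c E by (simp add: c'_def)
  moreover have "saddlepoint c param_space null_params l (s_line null_params l t) =
      c' * (\<Prod>i\<in>UNIV. det (group_cov N (radial N t v) i) powr ((N i - CARD('p) - 2) / 2))"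
    if T: "\<forall>i. pos_def (group_cov N (radial N t v) i)" for t
  proof -
    let ?w = "radial N t v"
    let ?d = "\<lambda>i. det (group_cov N ?w i)"
    let ?l = "loglik_at l (s_line null_params l t)"
    have T: "pos_def (group_cov N ?w i)" for i using T by blast
    have lt: "?l \<phi> = stat_loglik N ?w \<phi>" if "\<phi> \<in> param_space" for \<phi>
      by (rule loglik_at_s_line[where N=N and l=l and v=v, OF N C l that])
    have m: "mle param_space ?l = stat_mle N ?w" by (rule mle_eq_stat_mle[where N=N, OF N lt T])
    have n: "mle null_params l = stat_mle N (pooled N v)" by (rule mle_null_eq[where N=N and l=l and v=v, OF N C l])
    have d: "?d i > 0" for i by (rule pos_def_det_pos[OF T])
    \<comment> \<open>The constrained estimate is a null parameter, so only the pooled statistic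
      matters, and that is the same for all t.\<close>
    have 1: "?l (stat_mle N (pooled N v)) = K"
      unfolding K_def lt[OF stat_mle_in_param_space[OF pos_def_group_cov_pooled[where N=N, OF N C]]] stat_loglik_def
      using inner_to_canonical_pooled[where N=N, OF N stat_mle_pooled_in_null[where N=N, OF N C], of ?w]
      by (simp add: pooled_radial[where N=N, OF N])
    have 2: "?l (stat_mle N ?w) = - D - (\<Sum>i\<in>UNIV. N i / 2 * ln (?d i))"
      unfolding lt[OF stat_mle_in_param_space[OF T]] stat_loglik_stat_mle[where N=N, OF N T] max_stat_loglik_def D_def
      unfolding sum_negf[symmetric] sum_subtractf[symmetric]
      by (intro sum.cong refl) (simp add: algebra_simps)
    have 3: "det (obs_information ?l (stat_mle N ?w)) = E * (\<Prod>i\<in>UNIV. ?d i ^ (CARD('p) + 2))"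
    proof -
      have "obs_information ?l (stat_mle N ?w) = matrix (info_op N (stat_mle N ?w))"
        by (rule obs_information_stat_loglik[where N=N, OF N lt stat_mle_in_param_space[OF T]])
      then show ?thesis
        by (simp only: det_info_op[where N=N, OF N stat_mle_in_param_space[OF T]] E_def conc_stat_mle[OF T]
          matrix_inv_matrix_inv pos_def_invertible[OF T])
    qed
    have 4: "(\<Prod>i\<in>UNIV. ?d i ^ (CARD('p) + 2)) powr (- 1 / 2) = (\<Prod>i\<in>UNIV. ?d i powr (- (CARD('p) + 2) / 2))"
    proof -
      have "(\<Prod>i\<in>UNIV. ?d i ^ (CARD('p) + 2)) powr (- 1 / 2) = (\<Prod>i\<in>UNIV. (?d i ^ (CARD('p) + 2)) powr (- 1 / 2))"
        using d by (intro prod_powr_distrib)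
      also have "\<dots> = (\<Prod>i\<in>UNIV. ?d i powr (- (CARD('p) + 2) / 2))"
      proof (intro prod.cong refl)
        fix i
        show "(?d i ^ (CARD('p) + 2)) powr (- 1 / 2) = ?d i powr (- (CARD('p) + 2) / 2)"
          unfolding powr_realpow[OF d, symmetric] powr_powr
          by (rule arg_cong2[where f="(powr)", OF refl]) (simp add: field_simps)
      qed
      finally show ?thesis .
    qed
    have 5: "exp (\<Sum>i\<in>UNIV. N i / 2 * ln (?d i)) = (\<Prod>i\<in>UNIV. ?d i powr (N i / 2))"
      using d by (simp add: exp_sum powr_def less_imp_neq[symmetric])
    have "saddlepoint c param_space null_params l (s_line null_params l t) =
       c * exp (K + D + (\<Sum>i\<in>UNIV. N i / 2 * ln (?d i))) * (E * (\<Prod>i\<in>UNIV. ?d i ^ (CARD('p) + 2))) powr (- 1 / 2)"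
      unfolding saddlepoint_def Let_def m n 1 2 3 by (simp add: algebra_simps)
    also have "\<dots> = c' * ((\<Prod>i\<in>UNIV. ?d i powr (N i / 2)) * (\<Prod>i\<in>UNIV. ?d i powr (- (CARD('p) + 2) / 2)))"
    proof -
      have "(E * (\<Prod>i\<in>UNIV. ?d i ^ (CARD('p) + 2))) powr (- 1 / 2) = E powr (- 1 / 2) * (\<Prod>i\<in>UNIV. ?d i powr (- (CARD('p) + 2) / 2))"
        unfolding 4[symmetric] using E d by (intro powr_mult; auto intro!: prod_nonneg simp: less_imp_le)
      then show ?thesis unfolding c'_def exp_add[of "K + D"] 5 by (simp only: mult_ac)
    qed
    also have "(\<Prod>i\<in>UNIV. ?d i powr (N i / 2)) * (\<Prod>i\<in>UNIV. ?d i powr (- (CARD('p) + 2) / 2)) =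
        (\<Prod>i\<in>UNIV. ?d i powr ((N i - CARD('p) - 2) / 2))"
      unfolding prod.distrib[symmetric] powr_add[symmetric]
      by (intro prod.cong refl arg_cong2[where f="(powr)"]) (simp add: field_simps)
    finally show ?thesis .
  qed
  ultimately show ?thesis by blast
qed

section \<open>The p-value as a ratio of tail masses\<close>

text \<open>Extension by 0 absorbs \<open>t_sup\<close>: integrals up to it become integrals over
  half-lines. The same function will appear as the density of the statistic, up to the likelihood
  and a constant.\<close>

definition stat_weight :: "('k \<Rightarrow> real) \<Rightarrow> ('k::finite, 'p::finite) param \<Rightarrow> real" where
  "stat_weight N v = (if \<forall>i. pos_def (group_cov N v i)
     then \<Prod>i\<in>UNIV. det (group_cov N v i) powr ((N i - CARD('p) - 2) / 2) else 0)"

lemma continuous_on_group_avg: "continuous_on S (\<lambda>v :: ('k::finite, 'p::finite) param. group_avg N v i)"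
  unfolding group_avg_def
  by (intro continuous_intros linear_continuous_on bounded_linear_xi)

lemma continuous_on_group_cov: "continuous_on S (\<lambda>v :: ('k::finite, 'p::finite) param. group_cov N v i)"
  unfolding group_cov_def
  by (intro continuous_on_diff continuous_on_scaleR continuous_on_const linear_continuous_on bounded_linear_conc
      bounded_bilinear.continuous_on[OF bounded_bilinear_outer] continuous_on_group_avg)

lemma open_pos_def_group_cov: "open {v :: ('k::finite, 'p::finite) param. \<forall>i. pos_def (group_cov N v i)}"
proof -
  have "{v :: ('k, 'p) param. \<forall>i. pos_def (group_cov N v i)} =
     (\<Inter>i. (\<lambda>v. group_cov N v i) -` {S. \<forall>x. x \<noteq> 0 \<longrightarrow> 0 < x \<bullet> (S *v x)})"
    by (auto simp: pos_def_def)
  moreover have "open \<dots>"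
    by (intro open_INT open_vimage open_pos_quadratic continuous_on_group_cov ballI) auto
  ultimately show ?thesis by simp
qed

lemma borel_measurable_group_cov [measurable]:
  "(\<lambda>v :: ('k::finite, 'p::finite) param. group_cov N v i) \<in> borel_measurable borel"
  by (rule borel_measurable_continuous_onI[OF continuous_on_group_cov])

lemma measurable_pos_def_group_cov [measurable]:
  "Measurable.pred borel (\<lambda>v :: ('k::finite, 'p::finite) param. \<forall>i. pos_def (group_cov N v i))"
  unfolding pred_def using borel_open[OF open_pos_def_group_cov[of N]] by simp

lemma borel_measurable_stat_weight [measurable]:
  "(stat_weight N :: ('k::finite, 'p::finite) param \<Rightarrow> real) \<in> borel_measurable borel"
  unfolding stat_weight_def[abs_def] by measurable

lemma stat_weight_nonneg: "stat_weight N v \<ge> 0"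
  by (auto simp: stat_weight_def intro!: prod_nonneg)

lemma continuous_on_radial: "continuous_on S (\<lambda>t. radial N t v)"
  unfolding radial_def by (intro continuous_intros)

lemma borel_measurable_radial [measurable]:
  "(\<lambda>(t, v :: ('k::finite, 'p::finite) param). radial N t v) \<in> borel_measurable (borel \<Otimes>\<^sub>M borel)"
proof -
  have [measurable]: "(pooled N :: ('k, 'p) param \<Rightarrow> _) \<in> borel_measurable borel"
    by (rule borel_measurable_linear[OF linear_pooled])
  show ?thesis unfolding radial_def[abs_def] by measurable
qed

text \<open>Values in \<open>ennreal\<close> let Tonelli and scaling be applied without
  integrability conditions; \<open>enn2real\<close> returns to the integrals in the p-value.\<close>

definition tail_mass :: "nat \<Rightarrow> ('k \<Rightarrow> real) \<Rightarrow> real \<Rightarrow> ('k::finite, 'p::finite) param \<Rightarrow> ennreal" where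
  "tail_mass d N a v = (\<integral>\<^sup>+t. ennreal (t ^ (d - 1) * stat_weight N (radial N t v)) * indicator {a<..} t \<partial>lborel)"

lemma radial_convex:
  assumes "s \<noteq> 0"
  shows "radial N t v = (1 - t / s) *\<^sub>R pooled N v + (t / s) *\<^sub>R radial N s v"
  using assms by (simp add: radial_def algebra_simps)

lemma mvn_pvalue_pos_def:
  fixes y :: "'k::finite \<Rightarrow> nat \<Rightarrow> real^'p::finite" and n :: "'k \<Rightarrow> nat"
  defines "N \<equiv> \<lambda>i. real (n i)" and "d \<equiv> CARD('p) * (CARD('p) + 3) * (CARD('k) - 1) div 2"
  assumes n: "\<And>i. n i > 0" and c: "c > 0" and C: "\<And>i. pos_def (group_cov N (suff_stat n y) i)"
  shows "mvn_pvalue c n y = enn2real (tail_mass d N 1 (suff_stat n y)) / enn2real (tail_mass d N 0 (suff_stat n y))"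
proof -
  define v :: "('k, 'p) param" where "v = suff_stat n y"
  define l where "l = mvn_loglik n y"
  have N: "N i > 0" for i using n[of i] by (simp add: N_def)
  have l: "l \<phi> = stat_loglik N v \<phi>" if "\<phi> \<in> param_space" for \<phi>
    unfolding l_def N_def v_def by (rule mvn_loglik_eq_stat_loglik[OF that])
  have C: "pos_def (group_cov N v i)" for i using C by (simp add: v_def)
  define T where "T = {t. \<forall>i. pos_def (group_cov N (radial N t v) i)}"
  have ex: "mle_exists param_space (loglik_at l (s_line null_params l t)) \<longleftrightarrow> t \<in> T" for t
    unfolding T_def mem_Collect_eq
    by (rule mle_exists_iff[where N=N, OF N]) (rule loglik_at_s_line[where N=N and l=l and v=v, OF N C l])
  define b where "b = t_sup param_space null_params l"
  have b: "b = (SUP t\<in>T. ereal t)" by (simp add: b_def t_sup_def ex)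
  have T1: "1 \<in> T" using C by (simp add: T_def)
  have T0: "pos_def (group_cov N (pooled N v) i)" for i by (rule pos_def_group_cov_pooled[where N=N, OF N C])
  have "open T"
    using open_vimage[OF open_pos_def_group_cov[of N] continuous_on_radial[of UNIV N v]] by (simp add: T_def vimage_def)
  \<comment> \<open>T is open, so its supremum b is not attained and integrating strictly below b
    loses no point of T.\<close>
  have T_less: "ereal t < b" if "t \<in> T" for t
  proof -
    obtain e where e: "e > 0" "ball t e \<subseteq> T" using \<open>open T\<close> \<open>t \<in> T\<close> openE by blast
    then have "t + e / 2 \<in> T" by (auto simp: dist_real_def)
    then have "ereal (t + e / 2) \<le> b" unfolding b by (rule SUP_upper[where f=ereal])
    moreover have "ereal t < ereal (t + e / 2)" using e(1) by simp
    ultimately show ?thesis by (rule less_le_trans[rotated])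
  qed
  \<comment> \<open>Such a t lies between 0, where the pooled covariance is positive definite, and a
    point of T beyond t. Negative t are not covered; the integrals start at 0 or 1.\<close>
  have less_T: "t \<in> T" if "0 \<le> t" "ereal t < b" for t
  proof -
    obtain s where s: "s \<in> T" "t < s" using \<open>ereal t < b\<close> unfolding b less_SUP_iff by auto
    then have "0 \<le> t / s" "t / s \<le> 1" "s \<noteq> 0" using \<open>0 \<le> t\<close> by auto
    then show ?thesis
      unfolding T_def mem_Collect_eq radial_convex[OF \<open>s \<noteq> 0\<close>, of N t v]
      using s(1) T0 by (auto intro!: pos_def_group_cov_convex simp: T_def)
  qed
  obtain c' where c': "c' > 0" and sp: "\<And>t. t \<in> T \<Longrightarrow> saddlepoint c param_space null_params l (s_line null_params l t) =
      c' * (\<Prod>i\<in>UNIV. det (group_cov N (radial N t v) i) powr ((N i - CARD('p) - 2) / 2))"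
    using saddlepoint_s_line[where N=N and l=l and v=v and c=c, OF N C l c] by (auto simp: T_def)
  have sp: "saddlepoint c param_space null_params l (s_line null_params l t) = c' * stat_weight N (radial N t v)"
    if "t \<in> T" for t
    using sp[OF that] that by (simp add: stat_weight_def T_def)
  have w0: "stat_weight N (radial N t v) = 0" if "t \<notin> T" for t
    using that by (auto simp: stat_weight_def T_def)
  have LB: "(LBINT t=ereal a..b. t ^ (d - 1) * saddlepoint c param_space null_params l (s_line null_params l t))
      = c' * enn2real (tail_mass d N a v)" if a: "0 \<le> a" "a \<le> 1" for a
  proof -
    define g where "g t = t ^ (d - 1) * stat_weight N (radial N t v) * indicator {a<..} t" for t
    have [measurable]: "(\<lambda>t. radial N t v) \<in> borel_measurable borel"
      by (rule borel_measurable_continuous_onI[OF continuous_on_radial])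
    have [measurable]: "g \<in> borel_measurable borel"
      unfolding g_def[abs_def] by measurable
    have "ereal a \<le> b" using T_less[OF T1] a(2) by (metis ereal_less_eq(3) less_imp_le order_trans one_ereal_def)
    then have "(LBINT t=ereal a..b. t ^ (d - 1) * saddlepoint c param_space null_params l (s_line null_params l t)) =
      (\<integral>t. indicator (einterval a b) t *\<^sub>R (t ^ (d - 1) * saddlepoint c param_space null_params l (s_line null_params l t)) \<partial>lborel)"
      by (simp add: interval_lebesgue_integral_def set_lebesgue_integral_def)
    also have "\<dots> = (\<integral>t. c' * g t \<partial>lborel)"
    proof (intro Bochner_Integration.integral_cong refl)
      fix t
      show "indicator (einterval a b) t *\<^sub>R (t ^ (d - 1) * saddlepoint c param_space null_params l (s_line null_params l t)) = c' * g t"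
      proof (cases "t \<in> T")
        case True
        then show ?thesis using T_less[OF True] by (simp add: sp g_def einterval_def indicator_def)
      next
        case False
        then have "t \<notin> einterval a b" using less_T[of t] a(1) by (auto simp: einterval_def)
        then show ?thesis using False by (simp add: g_def w0)
      qed
    qed
    also have "\<dots> = c' * (\<integral>t. g t \<partial>lborel)" by simp
    \<comment> \<open>Valid without integrability: a nonnegative function of infinite integral has
      Bochner integral 0, and \<open>enn2real\<close> sends infinity to 0.\<close>
    also have "(\<integral>t. g t \<partial>lborel) = enn2real (\<integral>\<^sup>+t. ennreal (g t) \<partial>lborel)"
      using a(1) by (intro integral_eq_nn_integral AE_I2) (auto simp: g_def stat_weight_nonneg indicator_def)
    also have "(\<integral>\<^sup>+t. ennreal (g t) \<partial>lborel) = tail_mass d N a v"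
      unfolding tail_mass_def by (intro nn_integral_cong) (auto simp: g_def indicator_def)
    finally show ?thesis .
  qed
  have "mle_exists param_space l" using mle_exists_iff[where N=N and l=l and v=v, OF N l] C by simp
  moreover have "mle_exists null_params l" by (rule mle_null_exists[where N=N and l=l and v=v, OF N C l])
  ultimately show ?thesis
    using LB[of 0] LB[of 1] c'
    unfolding mvn_pvalue_def directional_pvalue_def l_def[symmetric] d_def[symmetric] b_def[symmetric] v_def[symmetric]
    by (simp add: zero_ereal_def one_ereal_def)
qed

text \<open>On exceptional data the p-value is one fixed unspecified constant, which is enough for
  measurability.\<close>

lemma mvn_pvalue_undefined:
  fixes y :: "'k::finite \<Rightarrow> nat \<Rightarrow> real^'p::finite" and n :: "'k \<Rightarrow> nat"
  assumes n: "\<And>i. n i > 0" and C: "\<not> (\<forall>i. pos_def (group_cov (\<lambda>i. real (n i)) (suff_stat n y) i))"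
  shows "mvn_pvalue c n y = undefined"
proof -
  have "\<not> mle_exists param_space (mvn_loglik n y)"
    using mle_exists_iff[where N="\<lambda>i. real (n i)" and l="mvn_loglik n y" and v="suff_stat n y", OF _ mvn_loglik_eq_stat_loglik] n C
    by simp
  then show ?thesis by (simp add: mvn_pvalue_def directional_pvalue_def)
qed

section \<open>Relatively invariant measures on the space of statistics\<close>

text \<open>Tuples of matrices, and below of vectors, are stored as points of a Euclidean space, so
  that the affine group carries \<open>lborel\<close> and can take part in Tonelli's
  theorem.\<close>

definition mat_tuple :: "real^('k \<times> 'p \<times> 'p) \<Rightarrow> 'k::finite \<Rightarrow> real^'p::finite^'p" where
  "mat_tuple A i = (\<chi> a b. A $ (i, a, b))"

definition of_mat_tuple :: "('k \<Rightarrow> real^'p^'p) \<Rightarrow> real^('k::finite \<times> 'p::finite \<times> 'p)" where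
  "of_mat_tuple M = (\<chi> z. case z of (i, a, b) \<Rightarrow> M i $ a $ b)"

definition vec_tuple :: "real^('k \<times> 'p) \<Rightarrow> 'k::finite \<Rightarrow> real^'p::finite" where
  "vec_tuple x i = (\<chi> a. x $ (i, a))"

definition of_vec_tuple :: "('k \<Rightarrow> real^'p) \<Rightarrow> real^('k::finite \<times> 'p::finite)" where
  "of_vec_tuple m = (\<chi> z. case z of (i, a) \<Rightarrow> m i $ a)"

lemma mat_tuple_of_mat_tuple [simp]: "mat_tuple (of_mat_tuple M) = M"
  and of_mat_tuple_mat_tuple [simp]: "of_mat_tuple (mat_tuple A) = A"
  and vec_tuple_of_vec_tuple [simp]: "vec_tuple (of_vec_tuple m) = m"
  and of_vec_tuple_vec_tuple [simp]: "of_vec_tuple (vec_tuple x) = x"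
  by (auto simp: mat_tuple_def of_mat_tuple_def vec_tuple_def of_vec_tuple_def fun_eq_iff vec_eq_iff)

lemma mat_tuple_eq_iff: "A = B \<longleftrightarrow> mat_tuple A = mat_tuple B"
  and vec_tuple_eq_iff: "x = y \<longleftrightarrow> vec_tuple x = vec_tuple y"
  by (metis of_mat_tuple_mat_tuple, metis of_vec_tuple_vec_tuple)

lemma mat_tuple_add [simp]: "mat_tuple (A + B) i = mat_tuple A i + mat_tuple B i"
  and mat_tuple_scaleR [simp]: "mat_tuple (c *\<^sub>R A) i = c *\<^sub>R mat_tuple A i"
  and vec_tuple_add [simp]: "vec_tuple (x + y) i = vec_tuple x i + vec_tuple y i"
  and vec_tuple_diff [simp]: "vec_tuple (x - y) i = vec_tuple x i - vec_tuple y i"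
  and vec_tuple_minus [simp]: "vec_tuple (- x) i = - vec_tuple x i"
  and vec_tuple_scaleR [simp]: "vec_tuple (c *\<^sub>R x) i = c *\<^sub>R vec_tuple x i"
  by (simp_all add: mat_tuple_def vec_tuple_def vec_eq_iff)

section \<open>Multiplication operators and Haar measure\<close>

definition right_mult :: "('k \<Rightarrow> real^'p^'p) \<Rightarrow> real^('k::finite \<times> 'p::finite \<times> 'p) \<Rightarrow> real^('k \<times> 'p \<times> 'p)" where
  "right_mult B A = of_mat_tuple (\<lambda>i. mat_tuple A i ** B i)"

definition left_mult :: "('k \<Rightarrow> real^'p^'p) \<Rightarrow> real^('k::finite \<times> 'p::finite \<times> 'p) \<Rightarrow> real^('k \<times> 'p \<times> 'p)" where
  "left_mult B A = of_mat_tuple (\<lambda>i. B i ** mat_tuple A i)"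

definition vec_mult :: "('k \<Rightarrow> real^'p^'p) \<Rightarrow> real^('k::finite \<times> 'p::finite) \<Rightarrow> real^('k \<times> 'p)" where
  "vec_mult B x = of_vec_tuple (\<lambda>i. B i *v vec_tuple x i)"

lemma mat_tuple_right_mult [simp]: "mat_tuple (right_mult B A) i = mat_tuple A i ** B i"
  and mat_tuple_left_mult [simp]: "mat_tuple (left_mult B A) i = B i ** mat_tuple A i"
  and vec_tuple_vec_mult [simp]: "vec_tuple (vec_mult B x) i = B i *v vec_tuple x i"
  by (simp_all add: right_mult_def left_mult_def vec_mult_def)

lemma linear_right_mult: "linear (right_mult B)"
  and linear_left_mult: "linear (left_mult B)"
  and linear_vec_mult: "linear (vec_mult B)"
  by (auto simp: linear_iff mat_tuple_eq_iff vec_tuple_eq_iff fun_eq_iff matrix_mult_add_left matrix_mult_add_right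
      matrix_mult_scaleR_left matrix_mult_scaleR_right matrix_vector_right_distrib matrix_vector_mult_scaleR)

lemma right_mult_comp: "right_mult A \<circ> right_mult B = right_mult (\<lambda>i. B i ** A i)"
  and left_mult_comp: "left_mult A \<circ> left_mult B = left_mult (\<lambda>i. A i ** B i)"
  and vec_mult_comp: "vec_mult A \<circ> vec_mult B = vec_mult (\<lambda>i. A i ** B i)"
  by (auto simp: fun_eq_iff mat_tuple_eq_iff vec_tuple_eq_iff matrix_mul_assoc matrix_vector_mul_assoc)

lemma right_mult_id: "right_mult (\<lambda>_. mat 1) = id"
  and left_mult_id: "left_mult (\<lambda>_. mat 1) = id"
  and vec_mult_id: "vec_mult (\<lambda>_. mat 1) = id"
  by (auto simp: fun_eq_iff mat_tuple_eq_iff vec_tuple_eq_iff)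

lemma
  fixes B :: "'k::finite \<Rightarrow> real^'p::finite^'p"
  assumes "\<And>i. invertible (B i)"
  shows bij_right_mult: "bij (right_mult B)"
    and bij_left_mult: "bij (left_mult B)"
    and bij_vec_mult: "bij (vec_mult B)"
proof -
  show "bij (right_mult B)"
    by (rule o_bij[of "right_mult (\<lambda>i. matrix_inv (B i))"])
       (simp_all add: right_mult_comp right_mult_id matrix_inv_left matrix_inv_right assms)
  show "bij (left_mult B)"
    by (rule o_bij[of "left_mult (\<lambda>i. matrix_inv (B i))"])
       (simp_all add: left_mult_comp left_mult_id matrix_inv_left matrix_inv_right assms)
  show "bij (vec_mult B)"
    by (rule o_bij[of "vec_mult (\<lambda>i. matrix_inv (B i))"])
       (simp_all add: vec_mult_comp vec_mult_id matrix_inv_left matrix_inv_right assms)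
qed

lemma prod_triple: "(\<Prod>z\<in>UNIV. f z) = (\<Prod>i\<in>UNIV. \<Prod>a\<in>UNIV. \<Prod>b\<in>UNIV. f (i, a, b))"
  for f :: "'a::finite \<times> 'b::finite \<times> 'c::finite \<Rightarrow> real"
  by (simp add: prod.cartesian_product UNIV_Times_UNIV[symmetric] del: UNIV_Times_UNIV)

lemma lin_scale_right_mult:
  fixes B :: "'k::finite \<Rightarrow> real^'p::finite^'p"
  assumes B: "\<And>i. invertible (B i)"
  shows "lin_scale (right_mult B) = (\<Prod>i\<in>UNIV. \<bar>det (B i)\<bar> ^ CARD('p))"
proof (rule gl_tuple_character[where \<psi>="\<lambda>B. lin_scale (right_mult B)"])
  fix A B :: "'k \<Rightarrow> real^'p^'p" assume "\<And>i. invertible (A i)" "\<And>i. invertible (B i)"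
  \<comment> \<open>Right multiplication reverses the order of composition, which commuting real
    factors do not notice.\<close>
  then show "lin_scale (right_mult (\<lambda>i. A i ** B i)) = lin_scale (right_mult A) * lin_scale (right_mult B)"
    by (simp add: right_mult_comp[symmetric] lin_scale_comp linear_right_mult bij_right_mult mult.commute)
next
  fix d :: "'k \<Rightarrow> 'p \<Rightarrow> real" assume d: "\<And>i a. d i a \<noteq> 0"
  have "right_mult (\<lambda>i. diag_mat (d i)) = (\<lambda>A. \<chi> z. d (fst z) (snd (snd z)) * A $ z)"
    by (auto simp: fun_eq_iff mat_tuple_eq_iff, simp add: mat_tuple_def vec_eq_iff matrix_matrix_mult_def
        diag_mat_def mult_delta_right)
  then have "lin_scale (right_mult (\<lambda>i. diag_mat (d i))) = (\<Prod>i\<in>UNIV. \<Prod>a\<in>(UNIV::'p set). \<Prod>b\<in>UNIV. \<bar>d i b\<bar>)"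
    using d by (simp add: lin_scale_scaling prod_triple)
  also have "\<dots> = (\<Prod>i\<in>UNIV. \<Prod>a\<in>UNIV. \<bar>d i a\<bar>) ^ CARD('p)"
    by (simp add: prod_power_distrib)
  finally show "lin_scale (right_mult (\<lambda>i. diag_mat (d i))) = (\<Prod>i\<in>UNIV. \<Prod>a\<in>UNIV. \<bar>d i a\<bar>) ^ CARD('p)" .
qed (use B in \<open>auto intro: lin_scale_pos linear_right_mult bij_right_mult\<close>)

lemma lin_scale_left_mult:
  fixes B :: "'k::finite \<Rightarrow> real^'p::finite^'p"
  assumes B: "\<And>i. invertible (B i)"
  shows "lin_scale (left_mult B) = (\<Prod>i\<in>UNIV. \<bar>det (B i)\<bar> ^ CARD('p))"
proof (rule gl_tuple_character[where \<psi>="\<lambda>B. lin_scale (left_mult B)"])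
  fix A B :: "'k \<Rightarrow> real^'p^'p" assume "\<And>i. invertible (A i)" "\<And>i. invertible (B i)"
  then show "lin_scale (left_mult (\<lambda>i. A i ** B i)) = lin_scale (left_mult A) * lin_scale (left_mult B)"
    by (simp add: left_mult_comp[symmetric] lin_scale_comp linear_left_mult bij_left_mult)
next
  fix d :: "'k \<Rightarrow> 'p \<Rightarrow> real" assume d: "\<And>i a. d i a \<noteq> 0"
  have "left_mult (\<lambda>i. diag_mat (d i)) = (\<lambda>A. \<chi> z. d (fst z) (fst (snd z)) * A $ z)"
    by (auto simp: fun_eq_iff mat_tuple_eq_iff, simp add: mat_tuple_def vec_eq_iff matrix_matrix_mult_def
        diag_mat_def mult_delta_left)
  then have "lin_scale (left_mult (\<lambda>i. diag_mat (d i))) = (\<Prod>i\<in>UNIV. \<Prod>a\<in>UNIV. \<Prod>b\<in>(UNIV::'p set). \<bar>d i a\<bar>)"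
    using d by (simp add: lin_scale_scaling prod_triple)
  also have "\<dots> = (\<Prod>i\<in>UNIV. \<Prod>a\<in>UNIV. \<bar>d i a\<bar>) ^ CARD('p)"
    by (simp add: prod_power_distrib)
  finally show "lin_scale (left_mult (\<lambda>i. diag_mat (d i))) = (\<Prod>i\<in>UNIV. \<Prod>a\<in>UNIV. \<bar>d i a\<bar>) ^ CARD('p)" .
qed (use B in \<open>auto intro: lin_scale_pos linear_left_mult bij_left_mult\<close>)

lemma lin_scale_vec_mult:
  fixes B :: "'k::finite \<Rightarrow> real^'p::finite^'p"
  assumes B: "\<And>i. invertible (B i)"
  shows "lin_scale (vec_mult B) = (\<Prod>i\<in>UNIV. \<bar>det (B i)\<bar>)"
proof -
  have "lin_scale (vec_mult B) = (\<Prod>i\<in>UNIV. \<bar>det (B i)\<bar> ^ 1)"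
  proof (rule gl_tuple_character[where \<psi>="\<lambda>B. lin_scale (vec_mult B)"])
    fix A B :: "'k \<Rightarrow> real^'p^'p" assume "\<And>i. invertible (A i)" "\<And>i. invertible (B i)"
    then show "lin_scale (vec_mult (\<lambda>i. A i ** B i)) = lin_scale (vec_mult A) * lin_scale (vec_mult B)"
      by (simp add: vec_mult_comp[symmetric] lin_scale_comp linear_vec_mult bij_vec_mult)
  next
    fix d :: "'k \<Rightarrow> 'p \<Rightarrow> real" assume d: "\<And>i a. d i a \<noteq> 0"
    have "vec_mult (\<lambda>i. diag_mat (d i)) = (\<lambda>x. \<chi> z. d (fst z) (snd z) * x $ z)"
      by (auto simp: fun_eq_iff vec_tuple_eq_iff, simp add: vec_tuple_def vec_eq_iff matrix_vector_mult_def
          diag_mat_def mult_delta_left)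
    then have "lin_scale (vec_mult (\<lambda>i. diag_mat (d i))) = (\<Prod>z\<in>UNIV. \<bar>d (fst z) (snd z)\<bar>)"
      using d by (simp add: lin_scale_scaling)
    also have "\<dots> = (\<Prod>i\<in>UNIV. \<Prod>a\<in>UNIV. \<bar>d i a\<bar>) ^ 1"
      by (simp add: prod.cartesian_product case_prod_beta')
    finally show "lin_scale (vec_mult (\<lambda>i. diag_mat (d i))) = (\<Prod>i\<in>UNIV. \<Prod>a\<in>UNIV. \<bar>d i a\<bar>) ^ 1" .
  qed (use B in \<open>auto intro: lin_scale_pos linear_vec_mult bij_vec_mult\<close>)
  then show ?thesis by simp
qed

text \<open>Density of Haar measure on \<open>GL\<^sup>k\<close>; it vanishes on singular tuples because \<open>inverse 0 = 0\<close>.\<close>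

definition haar_density :: "real^('k::finite \<times> 'p::finite \<times> 'p) \<Rightarrow> ennreal" where
  "haar_density A = ennreal (\<Prod>i\<in>UNIV. inverse \<bar>det (mat_tuple A i)\<bar> ^ CARD('p))"

lemma haar_density_singular:
  fixes A :: "real^('k::finite \<times> 'p::finite \<times> 'p)"
  assumes "\<not> (\<forall>i. invertible (mat_tuple A i))"
  shows "haar_density A = 0"
proof -
  obtain i where "det (mat_tuple A i) = 0" using assms by (auto simp: invertible_det_nz)
  then have "(\<Prod>i\<in>UNIV. inverse \<bar>det (mat_tuple A i)\<bar> ^ CARD('p)) = 0"
    by (intro prod_zero bexI[of _ i]) auto
  then show ?thesis by (simp only: haar_density_def ennreal_0)
qed

lemma borel_measurable_mat_tuple [measurable (raw)]:
  fixes f :: "'x \<Rightarrow> real^('k::finite \<times> 'p::finite \<times> 'p)"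
  assumes "f \<in> borel_measurable L"
  shows "(\<lambda>x. mat_tuple (f x) i) \<in> borel_measurable L"
  unfolding mat_tuple_def by (intro borel_measurable_vecI) (simp add: borel_measurable_vec_nth[OF assms])

lemma borel_measurable_vec_tuple [measurable (raw)]:
  fixes f :: "'x \<Rightarrow> real^('k::finite \<times> 'p::finite)"
  assumes "f \<in> borel_measurable L"
  shows "(\<lambda>x. vec_tuple (f x) i) \<in> borel_measurable L"
  unfolding vec_tuple_def by (intro borel_measurable_vecI) (simp add: borel_measurable_vec_nth[OF assms])

lemma borel_measurable_haar_density [measurable]: "haar_density \<in> borel_measurable borel"
  unfolding haar_density_def[abs_def] by measurable

lemma borel_measurable_matrix_vector_mult [measurable (raw)]:
  fixes f :: "'x \<Rightarrow> real^'n^'m"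
  assumes [measurable]: "f \<in> borel_measurable L" "g \<in> borel_measurable L"
  shows "(\<lambda>x. f x *v g x) \<in> borel_measurable L"
  unfolding matrix_vector_mult_def by (intro borel_measurable_vecI) simp

lemma borel_measurable_affine_act [measurable (raw)]:
  fixes f :: "'x \<Rightarrow> ('k::finite, 'p::finite) param"
  assumes [measurable]: "\<And>i. (\<lambda>x. A x i) \<in> borel_measurable L" "\<And>i. (\<lambda>x. b x i) \<in> borel_measurable L"
    "f \<in> borel_measurable L"
  shows "(\<lambda>x. affine_act N (A x) (b x) (f x)) \<in> borel_measurable L"
proof (rule borel_measurable_vecI)
  fix z :: "'k \<times> ('p + 'p uprod)"
  obtain i y where z: "z = (i, y)" by (cases z)
  show "(\<lambda>x. affine_act N (A x) (b x) (f x) $ z) \<in> borel_measurable L"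
  proof (cases y)
    case (Inl a)
    have "affine_act N (A x) (b x) (f x) $ z = (A x i *v xi (f x) i + N i *\<^sub>R b x i) $ a" for x
      unfolding xi_affine_act[symmetric] by (simp only: xi_def z Inl vec_lambda_beta)
    then show ?thesis
      by (simp only:) (simp add: matrix_vector_mult_def xi_def)
  next
    case (Inr u)
    obtain a c where u: "u = Upair a c" by (cases u)
    have "affine_act N (A x) (b x) (f x) $ z = (A x i ** conc (f x) i ** transpose (A x i) + outer (A x i *v xi (f x) i) (b x i)
     + outer (b x i) (A x i *v xi (f x) i) + N i *\<^sub>R outer (b x i) (b x i)) $ a $ c" for x
      unfolding conc_affine_act[symmetric] by (simp only: conc_def z Inr u vec_lambda_beta)
    then show ?thesis
      by (simp only:) (simp add: matrix_vector_mult_def matrix_matrix_mult_def outer_def transpose_def xi_def conc_def)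
  qed
qed

text \<open>Lebesgue measure scales by |det B|^p per group, exactly what the density loses. Left
  multiplication has the same scale, so the density is invariant on both sides: GL is
  unimodular.\<close>

lemma nn_integral_haar_right_mult:
  fixes B :: "'k::finite \<Rightarrow> real^'p::finite^'p"
  assumes B: "\<And>i. invertible (B i)" and [measurable]: "f \<in> borel_measurable borel"
  shows "(\<integral>\<^sup>+A. haar_density A * f (right_mult B A) \<partial>lborel) = (\<integral>\<^sup>+A. haar_density A * f A \<partial>lborel)"
proof -
  define c where "c = (\<Prod>i\<in>UNIV. \<bar>det (B i)\<bar> ^ CARD('p))"
  have d: "det (B i) \<noteq> 0" for i using B[of i] by (simp add: invertible_det_nz)
  have h: "ennreal c * haar_density (right_mult B A) = haar_density A" for A
    unfolding haar_density_def c_def using d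
    by (subst ennreal_mult[symmetric])
       (auto intro!: prod_nonneg arg_cong[of _ _ ennreal] prod.cong simp: prod.distrib[symmetric] det_mul abs_mult
         power_mult_distrib power_inverse)
  have [measurable]: "right_mult B \<in> borel_measurable borel" by (rule borel_measurable_linear[OF linear_right_mult])
  have "(\<integral>\<^sup>+A. haar_density A * f A \<partial>lborel) = ennreal c * (\<integral>\<^sup>+A. haar_density (right_mult B A) * f (right_mult B A) \<partial>lborel)"
    unfolding c_def lin_scale_right_mult[OF B, symmetric]
    by (intro nn_integral_lin_scale linear_right_mult bij_right_mult B) measurable
  also have "\<dots> = (\<integral>\<^sup>+A. haar_density A * f (right_mult B A) \<partial>lborel)"
    by (subst nn_integral_cmult[symmetric]) (simp_all add: h mult.assoc[symmetric])
  finally show ?thesis ..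
qed

lemma nn_integral_haar_left_mult:
  fixes B :: "'k::finite \<Rightarrow> real^'p::finite^'p"
  assumes B: "\<And>i. invertible (B i)" and [measurable]: "f \<in> borel_measurable borel"
  shows "(\<integral>\<^sup>+A. haar_density A * f (left_mult B A) \<partial>lborel) = (\<integral>\<^sup>+A. haar_density A * f A \<partial>lborel)"
proof -
  define c where "c = (\<Prod>i\<in>UNIV. \<bar>det (B i)\<bar> ^ CARD('p))"
  have d: "det (B i) \<noteq> 0" for i using B[of i] by (simp add: invertible_det_nz)
  have h: "ennreal c * haar_density (left_mult B A) = haar_density A" for A
    unfolding haar_density_def c_def using d
    by (subst ennreal_mult[symmetric])
       (auto intro!: prod_nonneg arg_cong[of _ _ ennreal] prod.cong simp: prod.distrib[symmetric] det_mul abs_mult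
         power_mult_distrib power_inverse)
  have [measurable]: "left_mult B \<in> borel_measurable borel" by (rule borel_measurable_linear[OF linear_left_mult])
  have "(\<integral>\<^sup>+A. haar_density A * f A \<partial>lborel) = ennreal c * (\<integral>\<^sup>+A. haar_density (left_mult B A) * f (left_mult B A) \<partial>lborel)"
    unfolding c_def lin_scale_left_mult[OF B, symmetric]
    by (intro nn_integral_lin_scale linear_left_mult bij_left_mult B) measurable
  also have "\<dots> = (\<integral>\<^sup>+A. haar_density A * f (left_mult B A) \<partial>lborel)"
    by (subst nn_integral_cmult[symmetric]) (simp_all add: h mult.assoc[symmetric])
  finally show ?thesis ..
qed

lemma nn_integral_vec_mult:
  fixes B :: "'k::finite \<Rightarrow> real^'p::finite^'p"
  assumes B: "\<And>i. invertible (B i)" and [measurable]: "f \<in> borel_measurable borel"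
  shows "(\<integral>\<^sup>+x. f x \<partial>lborel) = ennreal (\<Prod>i\<in>UNIV. \<bar>det (B i)\<bar>) * (\<integral>\<^sup>+x. f (vec_mult B x) \<partial>lborel)"
  unfolding lin_scale_vec_mult[OF B, symmetric]
  by (intro nn_integral_lin_scale linear_vec_mult bij_vec_mult B) measurable

lemma nn_integral_pos_open:
  fixes f :: "'a::euclidean_space \<Rightarrow> ennreal"
  assumes [measurable]: "f \<in> borel_measurable borel" and S: "open S" "S \<noteq> {}" and pos: "\<And>x. x \<in> S \<Longrightarrow> f x > 0"
  shows "(\<integral>\<^sup>+x. f x \<partial>lborel) > 0"
proof (rule ccontr)
  assume "\<not> ?thesis"
  then have "AE x in lborel. f x = 0" by (simp add: nn_integral_0_iff_AE)
  then have "AE x in lborel. x \<notin> S"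
  proof eventually_elim
    case (elim x)
    then show ?case using pos[of x] by auto
  qed
  then have "emeasure lborel S = 0"
    using S(1) by (subst (asm) AE_iff_measurable[of S]) auto
  then show False using emeasure_lborel_open_pos[OF S] by simp
qed

section \<open>Integrals over affine orbits\<close>

definition std_stat :: "('k \<Rightarrow> real) \<Rightarrow> ('k::finite, 'p::finite) param" where
  "std_stat N = of_avg_cov N (\<lambda>_. 0) (\<lambda>_. mat 1)"

text \<open>Integral of f along the orbit of \<open>std_stat\<close> for
  \<open>haar_density A\<close> dA db, a right Haar measure of the affine group: right translation
  by (B, m) sends A to A B and shifts b by A m.\<close>

definition orbit_integral :: "('k \<Rightarrow> real) \<Rightarrow> (('k::finite, 'p::finite) param \<Rightarrow> ennreal) \<Rightarrow> ennreal" where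
  "orbit_integral N f = (\<integral>\<^sup>+A. haar_density A *
     (\<integral>\<^sup>+b. f (affine_act N (mat_tuple A) (vec_tuple b) (std_stat N)) \<partial>lborel) \<partial>lborel)"

text \<open>Transitivity of the affine action on statistics with positive definite covariances;
  roots of the covariances serve as linear parts.\<close>

lemma obtain_affine_act:
  fixes v :: "('k::finite, 'p::finite) param"
  assumes N: "\<And>i. N i > 0" and C: "\<And>i. pos_def (group_cov N v i)"
  obtains B :: "'k \<Rightarrow> real^'p^'p" where "\<And>i. invertible (B i)" "\<And>i. group_cov N v i = B i ** transpose (B i)"
    "v = affine_act N B (group_avg N v) (std_stat N)"
proof -
  have "\<exists>R :: real^'p^'p. invertible R \<and> group_cov N v i = R ** transpose R" for i
    by (rule pos_def_root[OF C[of i]]) blast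
  then obtain B :: "'k \<Rightarrow> real^'p^'p" where B: "\<And>i. invertible (B i)" "\<And>i. group_cov N v i = B i ** transpose (B i)"
    using choice[of "\<lambda>i (R :: real^'p^'p). invertible R \<and> group_cov N v i = R ** transpose R"] by auto
  have N0: "N i \<noteq> 0" for i using N[of i] by simp
  have "v = affine_act N B (group_avg N v) (std_stat N)"
    by (rule param_eqI_avg_cov[where N=N])
       (simp_all add: N0 group_avg_affine_act group_cov_affine_act std_stat_def group_avg_of_avg_cov group_cov_of_avg_cov B)
  with B that show ?thesis by blast
qed

text \<open>Since v is itself the image of the base point under some group element, right invariance
  absorbs that element: first a shift of b, then right multiplication of A.\<close>

lemma orbit_integral_eq:
  fixes v :: "('k::finite, 'p::finite) param"
  assumes N: "\<And>i. N i > 0" and C: "\<And>i. pos_def (group_cov N v i)" and [measurable]: "f \<in> borel_measurable borel"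
  shows "(\<integral>\<^sup>+A. haar_density A * (\<integral>\<^sup>+b. f (affine_act N (mat_tuple A) (vec_tuple b) v) \<partial>lborel) \<partial>lborel) = orbit_integral N f"
proof -
  obtain B :: "'k \<Rightarrow> real^'p^'p" where B: "\<And>i. invertible (B i)" and "\<And>i. group_cov N v i = B i ** transpose (B i)"
    and v: "v = affine_act N B (group_avg N v) (std_stat N)"
    by (rule obtain_affine_act[where N=N and v=v, OF N C]) (rule that)
  define m where "m = group_avg N v"
  have N0: "N i \<noteq> 0" for i using N[of i] by simp
  have "(\<integral>\<^sup>+b. f (affine_act N (mat_tuple A) (vec_tuple b) v) \<partial>lborel) =
     (\<integral>\<^sup>+b. f (affine_act N (mat_tuple (right_mult B A)) (vec_tuple b) (std_stat N)) \<partial>lborel)" for A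
  proof -
    have "affine_act N (mat_tuple A) (vec_tuple b) v =
      affine_act N (mat_tuple (right_mult B A)) (vec_tuple (of_vec_tuple (\<lambda>i. mat_tuple A i *v m i) + b)) (std_stat N)" for b
      by (subst v) (simp add: affine_act_affine_act[where N=N, OF N0] m_def ext[OF vec_tuple_add] ext[OF mat_tuple_right_mult])
    then show ?thesis
      using nn_integral_lborel_translate[of "\<lambda>b. f (affine_act N (mat_tuple (right_mult B A)) (vec_tuple b) (std_stat N))"] by simp
  qed
  then show ?thesis
    unfolding orbit_integral_def
    using nn_integral_haar_right_mult[OF B, of "\<lambda>A. \<integral>\<^sup>+b. f (affine_act N (mat_tuple A) (vec_tuple b) (std_stat N)) \<partial>lborel"]
    by simp
qed

text \<open>The integral of K over inverse group elements applied to \<open>std_stat\<close>, after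
  the translation -A^-1 b has been made the new variable b; this substitution produces the factor
  |det A|.\<close>

definition orbit_inv_integral :: "('k \<Rightarrow> real) \<Rightarrow> (('k::finite, 'p::finite) param \<Rightarrow> ennreal) \<Rightarrow> ennreal" where
  "orbit_inv_integral N K = (\<integral>\<^sup>+A. haar_density A * (ennreal (\<Prod>i\<in>UNIV. \<bar>det (mat_tuple A i)\<bar>) *
     (\<integral>\<^sup>+b. K (affine_act N (\<lambda>i. cramer_inv (mat_tuple A i)) (vec_tuple b) (std_stat N)) \<partial>lborel)) \<partial>lborel)"

text \<open>The product of |det B i| for any roots of the covariances, covariance = B B^T: the
  modular factor of an affine map that takes \<open>std_stat\<close> to v.\<close>

definition sqrt_det_cov :: "('k \<Rightarrow> real) \<Rightarrow> ('k::finite, 'p::finite) param \<Rightarrow> ennreal" where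
  "sqrt_det_cov N v = ennreal (\<Prod>i\<in>UNIV. sqrt (det (group_cov N v i)))"

text \<open>The measure on the affine group is not left invariant, so the average over inverses
  depends on the starting point v, by the modular factor of a map carrying \<open>std_stat\<close>
  to v.\<close>

lemma orbit_inv_integral_eq:
  fixes v :: "('k::finite, 'p::finite) param"
  assumes N: "\<And>i. N i > 0" and C: "\<And>i. pos_def (group_cov N v i)" and [measurable]: "K \<in> borel_measurable borel"
  shows "(\<integral>\<^sup>+A. haar_density A * (\<integral>\<^sup>+b. K (affine_act N (\<lambda>i. cramer_inv (mat_tuple A i))
     (\<lambda>i. - (cramer_inv (mat_tuple A i) *v vec_tuple b i)) v) \<partial>lborel) \<partial>lborel) = sqrt_det_cov N v * orbit_inv_integral N K"
proof -
  obtain B :: "'k \<Rightarrow> real^'p^'p" where B: "\<And>i. invertible (B i)" and BC: "\<And>i. group_cov N v i = B i ** transpose (B i)"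
    and v: "v = affine_act N B (group_avg N v) (std_stat N)"
    by (rule obtain_affine_act[where N=N and v=v, OF N C]) (rule that)
  define m where "m = of_vec_tuple (group_avg N v)"
  have N0: "N i \<noteq> 0" for i using N[of i] by simp
  define \<psi> where "\<psi> A = ennreal (\<Prod>i\<in>UNIV. \<bar>det (mat_tuple A i)\<bar>) *
     (\<integral>\<^sup>+b. K (affine_act N (\<lambda>i. cramer_inv (mat_tuple A i) ** B i) (vec_tuple b) (std_stat N)) \<partial>lborel)" for A
  have mm [measurable]: "(\<lambda>A. cramer_inv (mat_tuple (A :: real^('k \<times> 'p \<times> 'p)) i) ** B i) \<in> borel_measurable borel" for i
  proof -
    have [measurable]: "(\<lambda>X :: real^'p^'p. X ** B i) \<in> borel_measurable borel"
      by (intro borel_measurable_linear) (simp add: linear_iff matrix_mult_add_left matrix_mult_scaleR_left)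
    show ?thesis by measurable
  qed
  have [measurable]: "\<psi> \<in> borel_measurable borel"
  proof -
    have [measurable]: "(\<lambda>x. cramer_inv (mat_tuple (fst x :: real^('k \<times> 'p \<times> 'p)) i) ** B i) \<in> borel_measurable (borel \<Otimes>\<^sub>M borel)" for i
      by (rule measurable_compose[OF measurable_fst mm])
    show ?thesis unfolding \<psi>_def[abs_def] by measurable
  qed
  have inner: "(\<integral>\<^sup>+b. K (affine_act N (\<lambda>i. cramer_inv (mat_tuple A i))
     (\<lambda>i. - (cramer_inv (mat_tuple A i) *v vec_tuple b i)) v) \<partial>lborel) = \<psi> A" if A: "\<forall>i. invertible (mat_tuple A i)" for A
  proof -
    define A' where "A' = (\<lambda>i. cramer_inv (mat_tuple A i))"
    have A': "A' i ** mat_tuple A i = mat 1" "A' i = matrix_inv (mat_tuple A i)" for i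
      using A by (simp_all add: A'_def matrix_inv_eq_cramer_inv[symmetric] matrix_inv_left)
    define \<phi> where "\<phi> c = K (affine_act N (\<lambda>i. A' i ** B i) (vec_tuple c) (std_stat N))" for c
    have [measurable]: "\<phi> \<in> borel_measurable borel" unfolding \<phi>_def[abs_def] by measurable
    have [measurable]: "vec_mult A' \<in> borel_measurable borel" by (rule borel_measurable_linear[OF linear_vec_mult])
    have "K (affine_act N A' (\<lambda>i. - (A' i *v vec_tuple b i)) v) = \<phi> (vec_mult A' (m - b))" for b
    proof -
      have "vec_tuple (vec_mult A' (m - b)) = (\<lambda>i. A' i *v group_avg N v i + - (A' i *v vec_tuple b i))"
        by (simp add: fun_eq_iff m_def matrix_vector_mult_diff_distrib)
      then show ?thesis
        unfolding \<phi>_def by (subst v) (simp only: affine_act_affine_act[where N=N, OF N0])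
    qed
    then have "(\<integral>\<^sup>+b. K (affine_act N A' (\<lambda>i. - (A' i *v vec_tuple b i)) v) \<partial>lborel) = (\<integral>\<^sup>+b. \<phi> (vec_mult A' (m + - b)) \<partial>lborel)"
      by simp
    also have "\<dots> = (\<integral>\<^sup>+b. \<phi> (vec_mult A' (m + b)) \<partial>lborel)"
      by (rule nn_integral_lborel_uminus) simp
    also have "\<dots> = (\<integral>\<^sup>+b. \<phi> (vec_mult A' b) \<partial>lborel)"
      by (rule nn_integral_lborel_translate) simp
    also have "\<dots> = ennreal (\<Prod>i\<in>UNIV. \<bar>det (mat_tuple A i)\<bar>) * (\<integral>\<^sup>+b. \<phi> (vec_mult A' (vec_mult (mat_tuple A) b)) \<partial>lborel)"
      using A by (intro nn_integral_vec_mult) auto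
    also have "(\<integral>\<^sup>+b. \<phi> (vec_mult A' (vec_mult (mat_tuple A) b)) \<partial>lborel) = (\<integral>\<^sup>+b. \<phi> b \<partial>lborel)"
    proof -
      have "vec_mult A' (vec_mult (mat_tuple A) b) = b" for b
        by (simp add: vec_tuple_eq_iff fun_eq_iff matrix_vector_mul_assoc A'(1))
      then show ?thesis by simp
    qed
    finally show ?thesis by (simp add: A'_def \<psi>_def \<phi>_def)
  qed
  \<comment> \<open>Replacing A by B A turns A^-1 B into A^-1, after which v is visible only in the
    determinants of B.\<close>
  have left: "\<psi> (left_mult B A) = sqrt_det_cov N v * (ennreal (\<Prod>i\<in>UNIV. \<bar>det (mat_tuple A i)\<bar>) *
     (\<integral>\<^sup>+b. K (affine_act N (\<lambda>i. cramer_inv (mat_tuple A i)) (vec_tuple b) (std_stat N)) \<partial>lborel))"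
    if A: "\<forall>i. invertible (mat_tuple A i)" for A
  proof -
    have "cramer_inv (B i ** mat_tuple A i) ** B i = cramer_inv (mat_tuple A i)" for i
    proof -
      have inv: "invertible (B i ** mat_tuple A i)" using A B by (simp add: invertible_det_nz det_mul)
      have "mat_tuple A i ** (matrix_inv (B i ** mat_tuple A i) ** B i) = mat 1"
      proof -
        have "(B i ** mat_tuple A i) ** matrix_inv (B i ** mat_tuple A i) = mat 1" by (rule matrix_inv_right[OF inv])
        then have "B i ** (mat_tuple A i ** matrix_inv (B i ** mat_tuple A i)) = mat 1"
          by (simp only: matrix_mul_assoc)
        then have "(mat_tuple A i ** matrix_inv (B i ** mat_tuple A i)) ** B i = mat 1"
          by (rule iffD1[OF matrix_left_right_inverse])
        then show ?thesis by (simp only: matrix_mul_assoc)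
      qed
      from matrix_inv_unique[OF this] show ?thesis
        using A by (simp add: matrix_inv_eq_cramer_inv[symmetric] inv)
    qed
    moreover have "sqrt_det_cov N v = ennreal (\<Prod>i\<in>UNIV. \<bar>det (B i)\<bar>)"
      by (simp add: sqrt_det_cov_def BC det_mult_transpose)
    ultimately show ?thesis
      unfolding \<psi>_def by (simp add: det_mul abs_mult prod.distrib ennreal_mult prod_nonneg mult.assoc)
  qed
  have "(\<integral>\<^sup>+A. haar_density A * (\<integral>\<^sup>+b. K (affine_act N (\<lambda>i. cramer_inv (mat_tuple A i))
     (\<lambda>i. - (cramer_inv (mat_tuple A i) *v vec_tuple b i)) v) \<partial>lborel) \<partial>lborel) = (\<integral>\<^sup>+A. haar_density A * \<psi> A \<partial>lborel)"
  proof (intro nn_integral_cong)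
    fix A
    show "haar_density A * (\<integral>\<^sup>+b. K (affine_act N (\<lambda>i. cramer_inv (mat_tuple A i))
     (\<lambda>i. - (cramer_inv (mat_tuple A i) *v vec_tuple b i)) v) \<partial>lborel) = haar_density A * \<psi> A"
      by (cases "\<forall>i. invertible (mat_tuple A i)") (simp_all add: inner haar_density_singular)
  qed
  also have "\<dots> = (\<integral>\<^sup>+A. haar_density A * \<psi> (left_mult B A) \<partial>lborel)"
    by (rule nn_integral_haar_left_mult[OF B, symmetric]) simp
  also have "\<dots> = (\<integral>\<^sup>+A. sqrt_det_cov N v * (haar_density A * (ennreal (\<Prod>i\<in>UNIV. \<bar>det (mat_tuple A i)\<bar>) *
     (\<integral>\<^sup>+b. K (affine_act N (\<lambda>i. cramer_inv (mat_tuple A i)) (vec_tuple b) (std_stat N)) \<partial>lborel))) \<partial>lborel)"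
  proof (intro nn_integral_cong)
    fix A
    show "haar_density A * \<psi> (left_mult B A) = sqrt_det_cov N v * (haar_density A * (ennreal (\<Prod>i\<in>UNIV. \<bar>det (mat_tuple A i)\<bar>) *
     (\<integral>\<^sup>+b. K (affine_act N (\<lambda>i. cramer_inv (mat_tuple A i)) (vec_tuple b) (std_stat N)) \<partial>lborel)))"
      by (cases "\<forall>i. invertible (mat_tuple A i)") (simp_all add: left haar_density_singular mult_ac)
  qed
  also have "\<dots> = sqrt_det_cov N v * orbit_inv_integral N K"
    unfolding orbit_inv_integral_def
    by (rule nn_integral_cmult) measurable
  finally show ?thesis .
qed

text \<open>The weight that turns a measure scaling by |det A|^q into an invariant one, by
  \<open>det_cov_weight_affine_act\<close>. It vanishes off the set on which the action is
  transitive.\<close>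

definition det_cov_weight :: "('k \<Rightarrow> real) \<Rightarrow> ('k \<Rightarrow> nat) \<Rightarrow> ('k::finite, 'p::finite) param \<Rightarrow> ennreal" where
  "det_cov_weight N q v = (if \<forall>i. pos_def (group_cov N v i)
     then ennreal (\<Prod>i\<in>UNIV. det (group_cov N v i) powr (- real (q i) / 2)) else 0)"

lemma borel_measurable_det_cov_weight [measurable]:
  "(det_cov_weight N q :: ('k::finite, 'p::finite) param \<Rightarrow> ennreal) \<in> borel_measurable borel"
  unfolding det_cov_weight_def[abs_def] by measurable

lemma borel_measurable_sqrt_det_cov [measurable]:
  "(sqrt_det_cov N :: ('k::finite, 'p::finite) param \<Rightarrow> ennreal) \<in> borel_measurable borel"
  unfolding sqrt_det_cov_def[abs_def] by measurable

lemma det_cov_weight_affine_act: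
  fixes v :: "('k::finite, 'p::finite) param"
  assumes N: "\<And>i. N i > 0" and A: "\<And>i. invertible (A i)"
  shows "ennreal (\<Prod>i\<in>UNIV. \<bar>det (A i)\<bar> ^ q i) * det_cov_weight N q (affine_act N A b v) = det_cov_weight N q v"
proof -
  have N0: "N i \<noteq> 0" for i using N[of i] by simp
  have c: "group_cov N (affine_act N A b v) i = A i ** group_cov N v i ** transpose (A i)" for i
    by (rule group_cov_affine_act[OF N0])
  have pd: "pos_def (A i ** group_cov N v i ** transpose (A i)) \<longleftrightarrow> pos_def (group_cov N v i)" for i
  proof
    assume "pos_def (A i ** group_cov N v i ** transpose (A i))"
    then have "pos_def (matrix_inv (A i) ** (A i ** group_cov N v i ** transpose (A i)) ** transpose (matrix_inv (A i)))"
      by (rule pos_def_congruence[OF _ invertible_matrix_inv[OF A]])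
    moreover have "matrix_inv (A i) ** (A i ** group_cov N v i ** transpose (A i)) ** transpose (matrix_inv (A i))
       = (matrix_inv (A i) ** A i) ** group_cov N v i ** (transpose (A i) ** transpose (matrix_inv (A i)))"
      by (simp only: matrix_mul_assoc)
    moreover have "transpose (A i) ** transpose (matrix_inv (A i)) = mat 1"
      by (simp add: matrix_transpose_mul[symmetric] matrix_inv_left A)
    ultimately show "pos_def (group_cov N v i)" by (simp add: matrix_inv_left A)
  qed (rule pos_def_congruence[OF _ A])
  show ?thesis
  proof (cases "\<forall>i. pos_def (group_cov N v i)")
    case True
    have "\<bar>det (A i)\<bar> ^ q i * det (A i ** group_cov N v i ** transpose (A i)) powr (- real (q i) / 2) =
       det (group_cov N v i) powr (- real (q i) / 2)" for i
    proof -
      have a: "\<bar>det (A i)\<bar> > 0" using A[of i] by (simp add: invertible_det_nz)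
      have d: "det (group_cov N v i) > 0" using True pos_def_det_pos by blast
      have "det (A i ** group_cov N v i ** transpose (A i)) = \<bar>det (A i)\<bar> powr 2 * det (group_cov N v i)"
        using a by (simp add: det_mul power2_eq_square)
      then have "det (A i ** group_cov N v i ** transpose (A i)) powr (- real (q i) / 2)
        = (\<bar>det (A i)\<bar> powr 2) powr (- real (q i) / 2) * det (group_cov N v i) powr (- real (q i) / 2)"
        using a d by (simp only: powr_mult)
      also have "(\<bar>det (A i)\<bar> powr 2) powr (- real (q i) / 2) = \<bar>det (A i)\<bar> powr (- real (q i))"
        by (simp only: powr_powr) simp
      also have "\<dots> = inverse (\<bar>det (A i)\<bar> ^ q i)"
        using a by (simp add: powr_minus powr_realpow)
      finally show ?thesis using a by (simp add: field_simps)
    qed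
    then show ?thesis
      using True by (simp add: det_cov_weight_def c pd ennreal_mult[symmetric] prod_nonneg prod.distrib[symmetric])
  next
    case False
    then show ?thesis by (simp only: det_cov_weight_def c pd if_False mult_zero_right)
  qed
qed

lemma nn_integral_haar_swap:
  fixes G :: "'x \<times> ((real^('k::finite \<times> 'p::finite \<times> 'p)) \<times> (real^('k \<times> 'p))) \<Rightarrow> ennreal"
  assumes sf: "sigma_finite_measure \<nu>" and [measurable]: "F \<in> borel_measurable \<nu>"
    "G \<in> borel_measurable (\<nu> \<Otimes>\<^sub>M (borel \<Otimes>\<^sub>M borel))"
  shows "(\<integral>\<^sup>+x. F x * (\<integral>\<^sup>+A. haar_density A * (\<integral>\<^sup>+b. G (x, A, b) \<partial>lborel) \<partial>lborel) \<partial>\<nu>) =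
     (\<integral>\<^sup>+z. haar_density (fst z) * (\<integral>\<^sup>+x. F x * G (x, z) \<partial>\<nu>) \<partial>(lborel \<Otimes>\<^sub>M lborel))"
proof -
  interpret \<nu>: sigma_finite_measure \<nu> by (rule sf)
  interpret L: pair_sigma_finite "lborel :: (real^('k \<times> 'p \<times> 'p)) measure" "lborel :: (real^('k \<times> 'p)) measure" ..
  interpret P: pair_sigma_finite \<nu> "(lborel :: (real^('k \<times> 'p \<times> 'p)) measure) \<Otimes>\<^sub>M (lborel :: (real^('k \<times> 'p)) measure)"
    by (intro pair_sigma_finite.intro sf sigma_finite_pair_measure lborel.sigma_finite_measure_axioms)
  have "F x * (\<integral>\<^sup>+A. haar_density A * (\<integral>\<^sup>+b. G (x, A, b) \<partial>lborel) \<partial>lborel) =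
      (\<integral>\<^sup>+z. F x * (haar_density (fst z) * G (x, z)) \<partial>(lborel \<Otimes>\<^sub>M lborel))" if [measurable]: "x \<in> space \<nu>" for x
  proof -
    have "F x * (\<integral>\<^sup>+A. haar_density A * (\<integral>\<^sup>+b. G (x, A, b) \<partial>lborel) \<partial>lborel) =
      (\<integral>\<^sup>+A. \<integral>\<^sup>+b. F x * (haar_density A * G (x, A, b)) \<partial>lborel \<partial>lborel)"
      by (simp add: nn_integral_cmult)
    also have "\<dots> = (\<integral>\<^sup>+z. F x * (haar_density (fst z) * G (x, z)) \<partial>(lborel \<Otimes>\<^sub>M lborel))"
      using lborel.nn_integral_fst[of "\<lambda>z. F x * (haar_density (fst z) * G (x, z))" lborel] by simp
    finally show ?thesis .
  qed
  then have "(\<integral>\<^sup>+x. F x * (\<integral>\<^sup>+A. haar_density A * (\<integral>\<^sup>+b. G (x, A, b) \<partial>lborel) \<partial>lborel) \<partial>\<nu>) =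
     (\<integral>\<^sup>+x. (\<integral>\<^sup>+z. F x * (haar_density (fst z) * G (x, z)) \<partial>(lborel \<Otimes>\<^sub>M lborel)) \<partial>\<nu>)"
    by (intro nn_integral_cong) simp
  also have "\<dots> = (\<integral>\<^sup>+z. (\<integral>\<^sup>+x. F x * (haar_density (fst z) * G (x, z)) \<partial>\<nu>) \<partial>(lborel \<Otimes>\<^sub>M lborel))"
    using P.Fubini'[of "\<lambda>x z. F x * (haar_density (fst z) * G (x, z))"] by simp
  also have "\<dots> = (\<integral>\<^sup>+z. haar_density (fst z) * (\<integral>\<^sup>+x. F x * G (x, z) \<partial>\<nu>) \<partial>(lborel \<Otimes>\<^sub>M lborel))"
  proof (intro nn_integral_cong)
    fix z :: "(real^('k \<times> 'p \<times> 'p)) \<times> (real^('k \<times> 'p))"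
    have [measurable]: "(\<lambda>x. G (x, z)) \<in> borel_measurable \<nu>"
      by (rule measurable_compose[OF measurable_Pair2' assms(3)]) (simp add: space_pair_measure)
    show "(\<integral>\<^sup>+x. F x * (haar_density (fst z) * G (x, z)) \<partial>\<nu>) = haar_density (fst z) * (\<integral>\<^sup>+x. F x * G (x, z) \<partial>\<nu>)"
      by (simp add: nn_integral_cmult[symmetric] mult_ac)
  qed
  finally show ?thesis .
qed

text \<open>Uniqueness of relatively invariant measures: integrate \<open>f (g x) K (x)\<close> over \<open>x\<close> and over the
  affine group in both orders. Transitivity of the action on positive definite covariances makes
  either inner integral explicit.\<close>

lemma affine_invariant_integral:
  fixes U :: "'x \<Rightarrow> ('k::finite, 'p::finite) param"
  assumes N: "\<And>i. N i > 0" and sf: "sigma_finite_measure \<nu>" and [measurable]: "U \<in> borel_measurable \<nu>"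
    and inv: "\<And>f A b. f \<in> borel_measurable borel \<Longrightarrow> (\<And>i. invertible (A i)) \<Longrightarrow>
      (\<integral>\<^sup>+x. f (U x) \<partial>\<nu>) = ennreal (\<Prod>i\<in>UNIV. \<bar>det (A i)\<bar> ^ q i) * (\<integral>\<^sup>+x. f (affine_act N A b (U x)) \<partial>\<nu>)"
    and [measurable]: "f \<in> borel_measurable borel" "K \<in> borel_measurable borel"
  shows "(\<integral>\<^sup>+x. K (U x) * det_cov_weight N q (U x) \<partial>\<nu>) * orbit_integral N f =
    orbit_inv_integral N K * (\<integral>\<^sup>+x. f (U x) * det_cov_weight N q (U x) * sqrt_det_cov N (U x) \<partial>\<nu>)"
proof -
  define w where "w x = det_cov_weight N q (U x)" for x
  have [measurable]: "w \<in> borel_measurable \<nu>" unfolding w_def[abs_def] by measurable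
  define g where "g z = affine_act N (mat_tuple (fst z)) (vec_tuple (snd z))"
    for z :: "(real^('k \<times> 'p \<times> 'p)) \<times> (real^('k \<times> 'p))"
  define g' where "g' z = affine_act N (\<lambda>i. cramer_inv (mat_tuple (fst z) i)) (\<lambda>i. - (cramer_inv (mat_tuple (fst z) i) *v vec_tuple (snd z) i))"
    for z :: "(real^('k \<times> 'p \<times> 'p)) \<times> (real^('k \<times> 'p))"
  have mg: "(\<lambda>y. f (g (snd y) (U (fst y)))) \<in> borel_measurable (\<nu> \<Otimes>\<^sub>M (borel \<Otimes>\<^sub>M borel))"
    unfolding g_def by measurable
  have mg': "(\<lambda>y. K (g' (snd y) (U (fst y)))) \<in> borel_measurable (\<nu> \<Otimes>\<^sub>M (borel \<Otimes>\<^sub>M borel))"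
    unfolding g'_def by measurable
  have N0: "N i \<noteq> 0" for i using N[of i] by simp
  have "(\<integral>\<^sup>+x. K (U x) * w x \<partial>\<nu>) * orbit_integral N f = (\<integral>\<^sup>+x. (w x * K (U x)) * orbit_integral N f \<partial>\<nu>)"
    by (subst nn_integral_multc) (simp_all add: mult.commute)
  also have "\<dots> = (\<integral>\<^sup>+x. (w x * K (U x)) * (\<integral>\<^sup>+A. haar_density A * (\<integral>\<^sup>+b. f (g (A, b) (U x)) \<partial>lborel) \<partial>lborel) \<partial>\<nu>)"
  proof (intro nn_integral_cong)
    fix x
    show "(w x * K (U x)) * orbit_integral N f =
        (w x * K (U x)) * (\<integral>\<^sup>+A. haar_density A * (\<integral>\<^sup>+b. f (g (A, b) (U x)) \<partial>lborel) \<partial>lborel)"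
      \<comment> \<open>Where some covariance is not positive definite, w is 0, so the orbit formula
        is needed only on the transitive part.\<close>
      using orbit_integral_eq[where N=N and v="U x" and f=f, OF N]
      by (cases "\<forall>i. pos_def (group_cov N (U x) i)") (simp_all add: g_def w_def det_cov_weight_def)
  qed
  also have "\<dots> = (\<integral>\<^sup>+z. haar_density (fst z) * (\<integral>\<^sup>+x. (w x * K (U x)) * f (g z (U x)) \<partial>\<nu>) \<partial>(lborel \<Otimes>\<^sub>M lborel))"
    by (rule nn_integral_haar_swap[OF sf, where F="\<lambda>x. w x * K (U x)" and G="\<lambda>y. f (g (snd y) (U (fst y)))",
          OF _ mg, unfolded fst_conv snd_conv]) simp
  also have "\<dots> = (\<integral>\<^sup>+z. haar_density (fst z) * (\<integral>\<^sup>+x. (w x * f (U x)) * K (g' z (U x)) \<partial>\<nu>) \<partial>(lborel \<Otimes>\<^sub>M lborel))"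
  proof (intro nn_integral_cong)
    fix z :: "(real^('k \<times> 'p \<times> 'p)) \<times> (real^('k \<times> 'p))"
    show "haar_density (fst z) * (\<integral>\<^sup>+x. (w x * K (U x)) * f (g z (U x)) \<partial>\<nu>) =
       haar_density (fst z) * (\<integral>\<^sup>+x. (w x * f (U x)) * K (g' z (U x)) \<partial>\<nu>)"
    proof (cases "\<forall>i. invertible (mat_tuple (fst z) i)")
      case True
      let ?c = "ennreal (\<Prod>i\<in>UNIV. \<bar>det (mat_tuple (fst z) i)\<bar> ^ q i)"
      have [measurable]: "g z \<in> borel_measurable borel" "g' z \<in> borel_measurable borel"
        unfolding g_def g'_def by measurable
      have "g' z (g z v) = v" for v
      proof -
        have "cramer_inv (mat_tuple (fst z) i) ** mat_tuple (fst z) i = mat 1" for i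
          using True by (simp add: matrix_inv_eq_cramer_inv[symmetric] matrix_inv_left)
        then show ?thesis
          unfolding g'_def g_def by (simp add: affine_act_affine_act[where N=N, OF N0] affine_act_id[where N=N, OF N0])
      qed
      \<comment> \<open>Relative invariance, applied to the product of f, K after g', and the
        weight. As g' undoes g, the transformation moves from the argument of K to that of f, and
        the weight absorbs ?c.\<close>
      then have "?c * (\<integral>\<^sup>+x. f (g z (U x)) * K (U x) * det_cov_weight N q (g z (U x)) \<partial>\<nu>) =
          (\<integral>\<^sup>+x. f (U x) * K (g' z (U x)) * det_cov_weight N q (U x) \<partial>\<nu>)"
        using inv[of "\<lambda>v. f v * K (g' z v) * det_cov_weight N q v" "mat_tuple (fst z)" "vec_tuple (snd z)"] True
        by (simp add: g_def[symmetric])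
      moreover have "?c * (\<integral>\<^sup>+x. f (g z (U x)) * K (U x) * det_cov_weight N q (g z (U x)) \<partial>\<nu>) =
          (\<integral>\<^sup>+x. f (g z (U x)) * K (U x) * (?c * det_cov_weight N q (g z (U x))) \<partial>\<nu>)"
        by (simp add: nn_integral_cmult[symmetric] mult_ac)
      moreover have "?c * det_cov_weight N q (g z v) = det_cov_weight N q v" for v
        unfolding g_def using True by (intro det_cov_weight_affine_act N) auto
      ultimately show ?thesis by (simp add: w_def mult_ac)
    qed (simp add: haar_density_singular)
  qed
  also have "\<dots> = (\<integral>\<^sup>+x. (w x * f (U x)) * (\<integral>\<^sup>+A. haar_density A * (\<integral>\<^sup>+b. K (g' (A, b) (U x)) \<partial>lborel) \<partial>lborel) \<partial>\<nu>)"
    by (rule nn_integral_haar_swap[OF sf, where F="\<lambda>x. w x * f (U x)" and G="\<lambda>y. K (g' (snd y) (U (fst y)))",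
          OF _ mg', unfolded fst_conv snd_conv, symmetric]) simp
  also have "\<dots> = (\<integral>\<^sup>+x. orbit_inv_integral N K * (f (U x) * w x * sqrt_det_cov N (U x)) \<partial>\<nu>)"
  proof (intro nn_integral_cong)
    fix x
    show "(w x * f (U x)) * (\<integral>\<^sup>+A. haar_density A * (\<integral>\<^sup>+b. K (g' (A, b) (U x)) \<partial>lborel) \<partial>lborel) =
       orbit_inv_integral N K * (f (U x) * w x * sqrt_det_cov N (U x))"
      using orbit_inv_integral_eq[where N=N and v="U x" and K=K, OF N]
      by (cases "\<forall>i. pos_def (group_cov N (U x) i)") (simp_all add: g'_def w_def det_cov_weight_def mult_ac)
  qed
  also have "\<dots> = orbit_inv_integral N K * (\<integral>\<^sup>+x. f (U x) * w x * sqrt_det_cov N (U x) \<partial>\<nu>)"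
    by (rule nn_integral_cmult) simp
  finally show ?thesis unfolding w_def .
qed

section \<open>Positivity and finiteness of the orbit constants\<close>

lemma continuous_on_mat_tuple: "continuous_on S (\<lambda>A. mat_tuple A i)"
  unfolding mat_tuple_def by (intro continuous_on_vec_lambda continuous_intros)

lemma continuous_on_trace: "continuous_on S f \<Longrightarrow> continuous_on S (\<lambda>x. trace (f x :: real^'n^'n))"
  unfolding trace_def by (intro continuous_intros)

lemma
  assumes "N i \<noteq> 0"
  shows group_avg_affine_std: "group_avg N (affine_act N A b (std_stat N)) i = b i"
    and group_cov_affine_std: "group_cov N (affine_act N A b (std_stat N)) i = A i ** transpose (A i)"
  using assms by (simp_all add: group_avg_affine_act group_cov_affine_act std_stat_def group_avg_of_avg_cov
      group_cov_of_avg_cov)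

lemma orbit_integral_one_pos: "orbit_integral N (\<lambda>_ :: ('k::finite, 'p::finite) param. 1) > 0"
proof -
  let ?S = "\<Inter>i. (\<lambda>A :: real^('k \<times> 'p \<times> 'p). mat_tuple A i) -` {X. invertible X}"
  have "open ?S"
    by (intro open_INT open_vimage open_invertible continuous_on_mat_tuple ballI) auto
  moreover have "of_mat_tuple (\<lambda>_. mat 1) \<in> ?S" by (simp add: invertible_det_nz)
  then have "?S \<noteq> {}" by blast
  moreover have "(\<lambda>A. haar_density A * (\<integral>\<^sup>+b. 1 \<partial>(lborel :: (real^('k \<times> 'p)) measure))) \<in> borel_measurable borel"
    by (intro borel_measurable_times_ennreal borel_measurable_haar_density borel_measurable_const)
  ultimately show ?thesis
    unfolding orbit_integral_def
  proof (intro nn_integral_pos_open[of _ ?S])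
    fix A :: "real^('k \<times> 'p \<times> 'p)" assume "A \<in> ?S"
    then have "0 < haar_density A"
      by (auto simp: haar_density_def invertible_det_nz intro!: prod_pos)
    then show "0 < haar_density A * (\<integral>\<^sup>+b. 1 \<partial>(lborel :: (real^('k \<times> 'p)) measure))"
      by (simp add: ennreal_zero_less_mult_iff)
  qed auto
qed

text \<open>A neighbourhood of the base point over which the orbit map has relatively compact preimage.\<close>

definition base_nbhd :: "('k \<Rightarrow> real) \<Rightarrow> ('k::finite, 'p::finite) param set" where
  "base_nbhd N = {v. \<forall>i. pos_def (group_cov N v i)} \<inter>
    (\<Inter>i. {v. norm (group_avg N v i) < 1} \<inter> {v. trace (group_cov N v i) < CARD('p) + 1} \<inter> {v. 1 / 2 < det (group_cov N v i)})"

lemma open_base_nbhd: "open (base_nbhd N)"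
  unfolding base_nbhd_def
  by (intro open_Int open_INT open_pos_def_group_cov open_Collect_less continuous_on_norm continuous_on_group_avg
      continuous_on_trace continuous_on_det continuous_on_group_cov continuous_on_const ballI) auto

lemma std_stat_in_base_nbhd: "(\<And>i. N i \<noteq> 0) \<Longrightarrow> std_stat N \<in> base_nbhd N"
  by (simp add: base_nbhd_def std_stat_def group_avg_of_avg_cov group_cov_of_avg_cov trace_I pos_def_mat_1)

text \<open>Over \<open>base_nbhd\<close> the trace of A A^T bounds the entries of A, the average
  bounds b, and the bound on the determinant keeps A away from the singular matrices near which the
  Haar density is unbounded.\<close>

lemma orbit_integral_base_nbhd_finite:
  assumes N: "\<And>i. N i \<noteq> 0"
  shows "orbit_integral N (indicator (base_nbhd N :: ('k::finite, 'p::finite) param set)) < \<infinity>"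
proof -
  \<comment> \<open>Norms are bounded by sums of absolute entries; those of A are at most p + 1 and
    those of b at most 1.\<close>
  define R1 where "R1 = (CARD('p) + 1) * real CARD('k \<times> 'p \<times> 'p)"
  define R2 where "R2 = real CARD('k \<times> 'p)"
  \<comment> \<open>From (det A)^2 > 1/2 follows |det A| >= 1/2, so the density is at most 2^p per
    group.\<close>
  define c :: ennreal where "c = ennreal (\<Prod>i\<in>(UNIV :: 'k set). 2 ^ CARD('p))"
  have bound: "haar_density A * indicator (base_nbhd N) (affine_act N (mat_tuple A) (vec_tuple b) (std_stat N))
      \<le> c * indicator (cball 0 R1) A * indicator (cball 0 R2) b" for A :: "real^('k \<times> 'p \<times> 'p)" and b :: "real^('k \<times> 'p)"
  proof (cases "affine_act N (mat_tuple A) (vec_tuple b) (std_stat N) \<in> base_nbhd N")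
    case True
    then have h: "norm (vec_tuple b i) < 1" "trace (mat_tuple A i ** transpose (mat_tuple A i)) < CARD('p) + 1"
      "1 / 2 < (det (mat_tuple A i))^2" for i
      by (auto simp: base_nbhd_def group_avg_affine_std[OF N] group_cov_affine_std[OF N] det_mult_transpose)
    have "\<bar>b $ z\<bar> \<le> 1" for z
    proof -
      obtain i a where z: "z = (i, a)" by (cases z)
      have "\<bar>vec_tuple b i $ a\<bar> \<le> norm (vec_tuple b i)" by (rule component_le_norm_cart)
      then show ?thesis using h(1)[of i] by (simp add: vec_tuple_def z)
    qed
    then have "norm b \<le> (\<Sum>z\<in>(UNIV :: ('k \<times> 'p) set). 1)"
      by (intro order_trans[OF norm_le_l1_cart] sum_mono) simp
    then have bb: "b \<in> cball 0 R2" by (simp add: R2_def)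
    have "\<bar>A $ z\<bar> \<le> CARD('p) + 1" for z
    proof -
      obtain i a b' where z: "z = (i, a, b')" by (metis prod_cases3)
      have "(A $ z)^2 \<le> (\<Sum>k\<in>UNIV. (mat_tuple A i $ a $ k)^2)"
        unfolding z by (rule order_trans[OF _ member_le_sum[of b']]) (auto simp: mat_tuple_def)
      also have "\<dots> \<le> (\<Sum>a\<in>UNIV. \<Sum>k\<in>UNIV. (mat_tuple A i $ a $ k)^2)"
        by (rule member_le_sum[of a]) (auto intro: sum_nonneg)
      also have "\<dots> = trace (mat_tuple A i ** transpose (mat_tuple A i))"
        by (simp add: trace_def matrix_matrix_mult_def transpose_def power2_eq_square)
      also have "\<dots> \<le> (CARD('p) + 1)^2"
      proof -
        have "(real CARD('p) + 1) * 1 \<le> (real CARD('p) + 1) * (real CARD('p) + 1)"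
          by (intro mult_left_mono) auto
        moreover have "trace (mat_tuple A i ** transpose (mat_tuple A i)) < real CARD('p) + 1" using h(2)[of i] by simp
        ultimately show ?thesis by (simp only: power2_eq_square mult_1_right of_nat_mult of_nat_add of_nat_1)
      qed
      finally show ?thesis by (simp add: abs_le_square_iff[symmetric])
    qed
    then have "norm A \<le> (\<Sum>z\<in>(UNIV :: ('k \<times> 'p \<times> 'p) set). CARD('p) + 1)"
      by (intro order_trans[OF norm_le_l1_cart]) (simp add: sum_mono del: sum_constant)
    then have AA: "A \<in> cball 0 R1" by (simp add: R1_def algebra_simps)
    have "inverse \<bar>det (mat_tuple A i)\<bar> \<le> 2" for i
    proof -
      have "1 / 2 \<le> \<bar>det (mat_tuple A i)\<bar>"
      proof (rule ccontr)
        assume "\<not> ?thesis"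
        then have "\<bar>det (mat_tuple A i)\<bar> * \<bar>det (mat_tuple A i)\<bar> \<le> (1 / 2) * (1 / 2)"
          by (intro mult_mono) auto
        then show False using h(3)[of i] by (simp add: power2_eq_square abs_mult[symmetric])
      qed
      then show ?thesis using le_imp_inverse_le[of "1/2" "\<bar>det (mat_tuple A i)\<bar>"] by simp
    qed
    then have "haar_density A \<le> c"
      unfolding haar_density_def c_def by (intro ennreal_leI prod_mono conjI power_mono) auto
    then show ?thesis using AA bb True by simp
  qed simp
  have [measurable]: "base_nbhd N \<in> sets borel" using open_base_nbhd by (rule borel_open)
  have "orbit_integral N (indicator (base_nbhd N :: ('k, 'p) param set)) \<le>
     (\<integral>\<^sup>+A. c * indicator (cball (0 :: real^('k \<times> 'p \<times> 'p)) R1) A * emeasure lborel (cball (0 :: real^('k \<times> 'p)) R2) \<partial>lborel)"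
    unfolding orbit_integral_def
  proof (intro nn_integral_mono)
    fix A :: "real^('k \<times> 'p \<times> 'p)"
    have "haar_density A * (\<integral>\<^sup>+b. indicator (base_nbhd N) (affine_act N (mat_tuple A) (vec_tuple b) (std_stat N)) \<partial>lborel)
      = (\<integral>\<^sup>+b. haar_density A * indicator (base_nbhd N) (affine_act N (mat_tuple A) (vec_tuple b) (std_stat N)) \<partial>lborel)"
      by (rule nn_integral_cmult[symmetric]) measurable
    also have "\<dots> \<le> (\<integral>\<^sup>+b. c * indicator (cball 0 R1) A * indicator (cball 0 R2) (b :: real^('k \<times> 'p)) \<partial>lborel)"
      by (intro nn_integral_mono bound)
    also have "\<dots> = c * indicator (cball 0 R1) A * emeasure lborel (cball (0 :: real^('k \<times> 'p)) R2)"
      by (subst nn_integral_cmult) (auto intro!: borel_measurable_indicator)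
    finally show "haar_density A * (\<integral>\<^sup>+b. indicator (base_nbhd N) (affine_act N (mat_tuple A) (vec_tuple b) (std_stat N)) \<partial>lborel)
      \<le> c * indicator (cball 0 R1) A * emeasure lborel (cball (0 :: real^('k \<times> 'p)) R2)" .
  qed
  also have "\<dots> = c * emeasure lborel (cball (0 :: real^('k \<times> 'p \<times> 'p)) R1) * emeasure lborel (cball (0 :: real^('k \<times> 'p)) R2)"
  proof -
    have i: "indicator (cball (0 :: real^('k \<times> 'p \<times> 'p)) R1) \<in> borel_measurable lborel"
      by (intro borel_measurable_indicator) simp
    then have m: "(\<lambda>A :: real^('k \<times> 'p \<times> 'p). c * indicator (cball 0 R1) A) \<in> borel_measurable lborel"
      by (intro borel_measurable_times_ennreal borel_measurable_const)
    show ?thesis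
      unfolding nn_integral_multc[OF m] nn_integral_cmult[OF i] by simp
  qed
  also have "\<dots> < \<infinity>"
    using emeasure_bounded_finite[OF bounded_cball[of "0 :: real^('k \<times> 'p \<times> 'p)" R1]]
      emeasure_bounded_finite[OF bounded_cball[of "0 :: real^('k \<times> 'p)" R2]]
    by (simp add: c_def ennreal_mult_less_top)
  finally show ?thesis .
qed

text \<open>Lebesgue measure on the moments is relatively invariant with exponent p + 2 and serves
  as reference measure. The point is a K for which both constants are positive and finite, so that
  they can be cancelled in \<open>ennreal\<close>.\<close>

lemma orbit_inv_integral_finite:
  fixes N :: "'k::finite \<Rightarrow> real"
  assumes N: "\<And>i. N i > 0"
  obtains K :: "('k, 'p::finite) param \<Rightarrow> ennreal" and a where "K \<in> borel_measurable borel"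
    "0 < orbit_inv_integral N K" "orbit_inv_integral N K < \<infinity>" "0 < a" "a < \<infinity>"
    "\<And>f :: ('k, 'p) param \<Rightarrow> ennreal. f \<in> borel_measurable borel \<Longrightarrow> a * orbit_integral N f =
      orbit_inv_integral N K * (\<integral>\<^sup>+v. f v * det_cov_weight N (\<lambda>_. CARD('p) + 2) v * sqrt_det_cov N v \<partial>lborel)"
proof -
  have N0: "N i \<noteq> 0" for i using N[of i] by simp
  define w :: "('k, 'p) param \<Rightarrow> ennreal" where "w = det_cov_weight N (\<lambda>_. CARD('p) + 2)"
  have [measurable]: "w \<in> borel_measurable borel" by (simp add: w_def)
  have w: "w v < \<infinity>" for v by (simp add: w_def det_cov_weight_def)
  have w_pos: "w v > 0" and s_pos: "sqrt_det_cov N v > 0" if "\<forall>i. pos_def (group_cov N v i)" for v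
  proof -
    have d: "det (group_cov N v i) > 0" for i using that pos_def_det_pos by blast
    show "sqrt_det_cov N v > 0" using d by (simp add: sqrt_det_cov_def prod_pos)
    have "det (group_cov N v i) \<noteq> 0" for i using d[of i] by simp
    then show "w v > 0" using that by (auto simp: w_def det_cov_weight_def intro!: prod_pos)
  qed
  have main: "(\<integral>\<^sup>+v. K v * w v \<partial>lborel) * orbit_integral N f = orbit_inv_integral N K * (\<integral>\<^sup>+v. f v * w v * sqrt_det_cov N v \<partial>lborel)"
    if "f \<in> borel_measurable borel" "K \<in> borel_measurable borel" for f K :: "('k, 'p) param \<Rightarrow> ennreal"
  proof -
    have inv: "(\<integral>\<^sup>+v. f v \<partial>lborel) = ennreal (\<Prod>i\<in>UNIV. \<bar>det (A i)\<bar> ^ (CARD('p) + 2)) * (\<integral>\<^sup>+v. f (affine_act N A b v) \<partial>lborel)"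
      if "f \<in> borel_measurable borel" "\<And>i. invertible (A i)" for f :: "('k, 'p) param \<Rightarrow> ennreal" and A b
      by (rule nn_integral_affine_act[OF that(2,1)])
    show ?thesis unfolding w_def
      by (rule affine_invariant_integral[where N=N and \<nu>=lborel and U="\<lambda>v. v" and q="\<lambda>_. CARD('p) + 2" and f=f and K=K,
          OF N lborel.sigma_finite_measure_axioms _ inv that]) simp
  qed
  obtain k where k [measurable]: "k \<in> borel_measurable (borel :: ('k, 'p) param measure)"
    and k1: "(\<integral>\<^sup>+v. k v \<partial>lborel) \<noteq> \<infinity>" and k2: "\<And>v. 0 < k v" "\<And>v. k v < \<infinity>"
    using sigma_finite_measure.Ex_finite_integrable_function[OF lborel.sigma_finite_measure_axioms[where ?'a="('k, 'p) param"]] by auto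
  \<comment> \<open>k is positive and integrable; dividing by 1 + w keeps the integral of K w below
    that of k.\<close>
  define K where "K v = k v / (1 + w v)" for v
  have [measurable]: "K \<in> borel_measurable borel" unfolding K_def[abs_def] by measurable
  define a where "a = (\<integral>\<^sup>+v. K v * w v \<partial>lborel)"
  have K_pos: "K v > 0" for v
    using k2[of v] w[of v] by (simp add: K_def ennreal_zero_less_divide ennreal_add_less_top)
  have "K v * w v \<le> k v" for v
  proof -
    have "K v * w v \<le> K v * (1 + w v)" by (intro mult_left_mono) auto
    also have "\<dots> = k v"
      using w[of v] unfolding K_def by (subst ennreal_divide_times) (simp add: ennreal_divide_self less_top)
    finally show ?thesis .
  qed
  then have "a \<le> (\<integral>\<^sup>+v. k v \<partial>lborel)" unfolding a_def by (intro nn_integral_mono)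
  then have a_fin: "a < \<infinity>" using k1 by (metis infinity_ennreal_def le_less_trans less_top)
  have a_pos: "0 < a"
    unfolding a_def
    by (rule nn_integral_pos_open[OF _ open_pos_def_group_cov[of N]])
       (use K_pos w_pos std_stat_in_base_nbhd[of N, OF N0] in \<open>auto simp: ennreal_zero_less_mult_iff base_nbhd_def\<close>)
  have eq: "a * orbit_integral N f = orbit_inv_integral N K * (\<integral>\<^sup>+v. f v * w v * sqrt_det_cov N v \<partial>lborel)"
    if "f \<in> borel_measurable borel" for f :: "('k, 'p) param \<Rightarrow> ennreal"
    unfolding a_def by (rule main[OF that]) simp
  \<comment> \<open>Taking f = 1 excludes that the constant is 0. The indicator of
    \<open>base_nbhd\<close> excludes infinity: there the left side is finite while the integral on
    the right is positive.\<close>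
  have "0 < a * orbit_integral N (\<lambda>_ :: ('k, 'p) param. 1)"
    using a_pos orbit_integral_one_pos by (simp add: ennreal_zero_less_mult_iff)
  then have c_pos: "0 < orbit_inv_integral N K"
    using eq[of "\<lambda>_. 1"] by (auto simp: zero_less_iff_neq_zero)
  have [measurable]: "base_nbhd N \<in> sets borel" using open_base_nbhd by (rule borel_open)
  have m: "(\<lambda>v. indicator (base_nbhd N) v * w v * sqrt_det_cov N v) \<in> borel_measurable borel" by measurable
  have ne: "(base_nbhd N :: ('k, 'p) param set) \<noteq> {}" using std_stat_in_base_nbhd[of N, OF N0] by blast
  have "0 < (\<integral>\<^sup>+v. indicator (base_nbhd N) v * w v * sqrt_det_cov N v \<partial>lborel)"
  proof (rule nn_integral_pos_open[OF m open_base_nbhd ne])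
    fix v :: "('k, 'p) param" assume v: "v \<in> base_nbhd N"
    then have "\<forall>i. pos_def (group_cov N v i)" by (simp add: base_nbhd_def)
    then show "0 < indicator (base_nbhd N) v * w v * sqrt_det_cov N v"
      using w_pos s_pos v by (simp add: ennreal_zero_less_mult_iff)
  qed
  moreover have "a * orbit_integral N (indicator (base_nbhd N :: ('k, 'p) param set)) < \<infinity>"
  proof -
    have "orbit_integral N (indicator (base_nbhd N :: ('k, 'p) param set)) < \<infinity>"
      by (rule orbit_integral_base_nbhd_finite[of N, OF N0])
    then show ?thesis using a_fin by (simp add: ennreal_mult_less_top)
  qed
  ultimately have c_fin: "orbit_inv_integral N K < \<infinity>"
    using eq[of "indicator (base_nbhd N :: ('k, 'p) param set)"] by (auto simp: ennreal_mult_less_top)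
  show ?thesis
    using that[of K a] c_pos c_fin a_pos a_fin eq by (simp add: w_def)
qed

text \<open>Both nu and Lebesgue measure are expressed through the same orbit integral; eliminating
  it leaves one constant C, which may be infinite at this stage. The modular factor stands on both
  sides of the comparison.\<close>

lemma affine_invariant_density:
  fixes U :: "'x \<Rightarrow> ('k::finite, 'p::finite) param" and n :: "'k \<Rightarrow> nat"
  defines "N \<equiv> \<lambda>i. real (n i)"
  assumes n: "\<And>i. n i > 0" and sf: "sigma_finite_measure \<nu>" and U [measurable]: "U \<in> borel_measurable \<nu>"
    and inv: "\<And>f A b. f \<in> borel_measurable borel \<Longrightarrow> (\<And>i. invertible (A i)) \<Longrightarrow>
      (\<integral>\<^sup>+x. f (U x) \<partial>\<nu>) = ennreal (\<Prod>i\<in>UNIV. \<bar>det (A i)\<bar> ^ n i) * (\<integral>\<^sup>+x. f (affine_act N A b (U x)) \<partial>\<nu>)"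
  shows "\<exists>C. \<forall>f\<in>borel_measurable borel.
    (\<integral>\<^sup>+x. f (U x) * indicator {v. \<forall>i. pos_def (group_cov N v i)} (U x) \<partial>\<nu>) =
      C * (\<integral>\<^sup>+v. f v * ennreal (stat_weight N v) \<partial>lborel)"
proof -
  have N: "N i > 0" for i using n[of i] by (simp add: N_def)
  obtain K :: "('k, 'p) param \<Rightarrow> ennreal" and a where K [measurable]: "K \<in> borel_measurable borel"
    and c: "0 < orbit_inv_integral N K" "orbit_inv_integral N K < \<infinity>" and a: "0 < a" "a < \<infinity>"
    and leb: "\<And>f :: ('k, 'p) param \<Rightarrow> ennreal. f \<in> borel_measurable borel \<Longrightarrow> a * orbit_integral N f =
      orbit_inv_integral N K * (\<integral>\<^sup>+v. f v * det_cov_weight N (\<lambda>_. CARD('p) + 2) v * sqrt_det_cov N v \<partial>lborel)"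
    by (rule orbit_inv_integral_finite[where N=N, OF N]) (rule that)
  define C where "C = (\<integral>\<^sup>+x. K (U x) * det_cov_weight N n (U x) \<partial>\<nu>) / a"
  have dens: "(\<integral>\<^sup>+x. f (U x) * det_cov_weight N n (U x) * sqrt_det_cov N (U x) \<partial>\<nu>) =
     C * (\<integral>\<^sup>+v. f v * det_cov_weight N (\<lambda>_. CARD('p) + 2) v * sqrt_det_cov N v \<partial>lborel)"
    if f: "f \<in> borel_measurable borel" for f :: "('k, 'p) param \<Rightarrow> ennreal"
  proof -
    let ?L = "\<integral>\<^sup>+x. f (U x) * det_cov_weight N n (U x) * sqrt_det_cov N (U x) \<partial>\<nu>"
    let ?R = "\<integral>\<^sup>+v. f v * det_cov_weight N (\<lambda>_. CARD('p) + 2) v * sqrt_det_cov N v \<partial>lborel"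
    let ?c = "orbit_inv_integral N K" and ?k = "\<integral>\<^sup>+x. K (U x) * det_cov_weight N n (U x) \<partial>\<nu>"
    have 1: "?k * orbit_integral N f = ?c * ?L"
      by (rule affine_invariant_integral[where N=N and \<nu>=\<nu> and U=U and q=n and f=f and K=K, OF N sf U inv f K])
    have "?c * (?k * ?R) = ?k * (?c * ?R)" by (rule mult.left_commute)
    also have "\<dots> = ?k * (a * orbit_integral N f)" by (simp only: leb[OF f])
    also have "\<dots> = a * (?c * ?L)" by (simp only: mult.left_commute[of ?k] 1)
    also have "\<dots> = ?c * (a * ?L)" by (rule mult.left_commute)
    finally have "?c * (?k * ?R) = ?c * (a * ?L)" .
    then have "?k * ?R = a * ?L" using c by (auto simp: ennreal_mult_cancel_left)
    then have "(?k * ?R) / a = ?L"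
      using a by (simp add: ennreal_mult_divide_eq mult.commute[of a] less_top[symmetric])
    then show ?thesis by (simp add: C_def divide_ennreal_def mult_ac)
  qed
  have "(\<integral>\<^sup>+x. f (U x) * indicator {v. \<forall>i. pos_def (group_cov N v i)} (U x) \<partial>\<nu>) =
      C * (\<integral>\<^sup>+v. f v * ennreal (stat_weight N v) \<partial>lborel)" if [measurable]: "f \<in> borel_measurable borel" for f
  proof -
    \<comment> \<open>The exponent (n - 1)/2 makes r times det^(-n/2) times det^(1/2) equal to 1;
      with the weight for p + 2 it leaves (n - p - 2)/2.\<close>
    define r where "r v = ennreal (\<Prod>i\<in>UNIV. det (group_cov N v i) powr ((N i - 1) / 2))" for v :: "('k, 'p) param"
    have [measurable]: "r \<in> borel_measurable borel" unfolding r_def[abs_def] by measurable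
    have r: "r v * det_cov_weight N n v * sqrt_det_cov N v = indicator {v. \<forall>i. pos_def (group_cov N v i)} v"
      "r v * det_cov_weight N (\<lambda>_. CARD('p) + 2) v * sqrt_det_cov N v = ennreal (stat_weight N v)" for v
    proof -
      have "r v * det_cov_weight N q v * sqrt_det_cov N v = ennreal (\<Prod>i\<in>UNIV. det (group_cov N v i) powr ((N i - real (q i)) / 2))"
        if C: "\<forall>i. pos_def (group_cov N v i)" for q
      proof -
        have d: "det (group_cov N v i) > 0" for i using C pos_def_det_pos by blast
        have "det (group_cov N v i) powr ((N i - 1) / 2) * det (group_cov N v i) powr (- real (q i) / 2) * sqrt (det (group_cov N v i))
          = det (group_cov N v i) powr ((N i - real (q i)) / 2)" for i
        proof -
          have "sqrt (det (group_cov N v i)) = det (group_cov N v i) powr (1 / 2)"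
            using d[of i] by (simp add: powr_half_sqrt)
          then show ?thesis
            by (simp only: powr_add[symmetric]) (rule arg_cong2[where f="(powr)", OF refl], simp add: field_simps)
        qed
        then show ?thesis
          using C d by (simp add: r_def det_cov_weight_def sqrt_det_cov_def ennreal_mult[symmetric] prod_nonneg
              prod.distrib[symmetric] less_imp_le)
      qed
      note eq = this
      show "r v * det_cov_weight N n v * sqrt_det_cov N v = indicator {v. \<forall>i. pos_def (group_cov N v i)} v"
      proof (cases "\<forall>i. pos_def (group_cov N v i)")
        case True
        then have "det (group_cov N v i) \<noteq> 0" for i by (metis pos_def_det_pos less_irrefl)
        then show ?thesis using eq[OF True, of n] True by (simp add: N_def)
      qed (auto simp: det_cov_weight_def)
      show "r v * det_cov_weight N (\<lambda>_. CARD('p) + 2) v * sqrt_det_cov N v = ennreal (stat_weight N v)"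
      proof (cases "\<forall>i. pos_def (group_cov N v i)")
        case True
        have "r v * det_cov_weight N (\<lambda>_. CARD('p) + 2) v * sqrt_det_cov N v =
          ennreal (\<Prod>i\<in>UNIV. det (group_cov N v i) powr ((N i - real (CARD('p) + 2)) / 2))"
          by (rule eq[OF True])
        then show ?thesis using True by (simp only: stat_weight_def if_True) (simp add: diff_diff_eq add.commute)
      qed (auto simp: det_cov_weight_def stat_weight_def)
    qed
    have "(\<lambda>v. f v * r v) \<in> borel_measurable borel" by measurable
    from dens[OF this] show ?thesis by (simp only: mult.assoc r[unfolded mult.assoc])
  qed
  then show ?thesis by blast
qed

section \<open>Radial coordinates\<close>

text \<open>Coordinates in which \<open>radial\<close> is diagonal: slot k holds the total, which
  stays fixed, the others hold deviations from the pooled statistic, which are multiplied by r. The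
  deviation of group k is determined by the others.\<close>

definition contrast_map :: "('k \<Rightarrow> real) \<Rightarrow> 'k \<Rightarrow> ('k::finite, 'p::finite) param \<Rightarrow> ('k, 'p) param" where
  "contrast_map N k v = (\<chi> z. if fst z = k then (\<Sum>j\<in>UNIV. v $ (j, snd z)) else v $ z - pooled N v $ z)"

lemma linear_contrast_map: "linear (contrast_map N k)"
  by (simp add: linear_iff contrast_map_def pooled_def vec_eq_iff sum.distrib sum_distrib_left algebra_simps)

lemma bij_contrast_map:
  fixes N :: "'k::finite \<Rightarrow> real"
  shows "bij (contrast_map N k :: ('k, 'p::finite) param \<Rightarrow> _)"
proof -
  have "inj (contrast_map N k :: ('k, 'p) param \<Rightarrow> _)"
    unfolding linear_injective_0[OF linear_contrast_map]
  proof (intro allI impI)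
    fix v :: "('k, 'p) param" assume 0: "contrast_map N k v = 0"
    have T: "(\<Sum>j\<in>UNIV. v $ (j, x)) = 0" for x
      using arg_cong[OF 0, of "\<lambda>w. w $ (k, x)"] by (simp add: contrast_map_def)
    then have "pooled N v = 0" by (simp add: pooled_def vec_eq_iff)
    then have i: "v $ (i, x) = 0" if "i \<noteq> k" for i x
      using arg_cong[OF 0, of "\<lambda>w. w $ (i, x)"] that by (simp add: contrast_map_def)
    have "(\<Sum>j\<in>UNIV. v $ (j, x)) = v $ (k, x)" for x
      by (subst sum.remove[of _ k]) (auto simp: i)
    then have "v $ (i, x) = 0" for i x using T i by (cases "i = k") auto
    then show "v = 0" by (simp add: vec_eq_iff split_paired_all)
  qed
  then show ?thesis
    using linear_injective_imp_surjective[OF linear_contrast_map] by (simp add: bij_def)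
qed

lemma linear_radial: "linear (radial N r)"
  by (simp add: linear_iff radial_def linear_add[OF linear_pooled] linear_scale[OF linear_pooled] algebra_simps)

lemma bij_radial:
  assumes N: "\<And>i. N i > 0" and r: "r \<noteq> 0"
  shows "bij (radial N r)"
  by (rule o_bij[of "radial N (1 / r)"]) (use r in \<open>auto simp: fun_eq_iff radial_radial[where N=N, OF N]\<close>)

text \<open>The dilated coordinates are p + p (p + 1)/2 in each of k - 1 groups. This number is the
  count d of constraints, which is how t^(d - 1) in the p-value becomes a Jacobian.\<close>

lemma lin_scale_radial:
  fixes N :: "'k::finite \<Rightarrow> real"
  assumes N: "\<And>i. N i > 0" and r: "r > 0"
  shows "lin_scale (radial N r :: ('k, 'p::finite) param \<Rightarrow> _) = r ^ (CARD('p) * (CARD('p) + 3) * (CARD('k) - 1) div 2)"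
proof -
  define k :: 'k where "k = undefined"
  define e :: "'k \<times> ('p + 'p uprod) \<Rightarrow> real" where "e z = (if fst z = k then 1 else r)" for z
  let ?S = "contrast_map N k :: ('k, 'p) param \<Rightarrow> _"
  have e: "e z \<noteq> 0" for z using r by (simp add: e_def)
  have "?S \<circ> radial N r = coord_scale e \<circ> ?S"
  proof (rule ext)
    fix v :: "('k, 'p) param"
    have T: "(\<Sum>j\<in>UNIV. pooled N v $ (j, x)) = (\<Sum>j\<in>UNIV. v $ (j, x))" for x
      using sum_weights_pos[where N=N, OF N] by (simp add: pooled_def sum_distrib_right[symmetric] sum_divide_distrib[symmetric])
    have "(\<Sum>j\<in>UNIV. radial N r v $ (j, x)) = (\<Sum>j\<in>UNIV. v $ (j, x))" for x
      by (simp add: radial_def sum.distrib sum_distrib_left[symmetric] sum_subtractf T)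
    moreover have diff: "radial N r v - pooled N (radial N r v) = r *\<^sub>R (v - pooled N v)"
      unfolding pooled_radial[where N=N, OF N] by (simp add: radial_def)
    have "radial N r v $ z - pooled N (radial N r v) $ z = r * (v $ z - pooled N v $ z)" for z
      using arg_cong[OF diff, of "\<lambda>w. w $ z"] by simp
    ultimately show "(?S \<circ> radial N r) v = (coord_scale e \<circ> ?S) v"
      by (simp add: contrast_map_def coord_scale_def e_def vec_eq_iff)
  qed
  then have "lin_scale (?S \<circ> radial N r) = lin_scale (coord_scale e \<circ> ?S)" by simp
  then have "lin_scale ?S * lin_scale (radial N r :: ('k, 'p) param \<Rightarrow> _) = lin_scale (coord_scale e) * lin_scale ?S"
    using N r e by (simp add: lin_scale_comp linear_contrast_map bij_contrast_map linear_radial bij_radial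
        linear_coord_scale bij_coord_scale)
  then have "lin_scale (radial N r :: ('k, 'p) param \<Rightarrow> _) = lin_scale (coord_scale e)"
  proof -
    have "lin_scale ?S > 0" by (rule lin_scale_pos[OF linear_contrast_map bij_contrast_map])
    with \<open>lin_scale ?S * _ = _\<close> show ?thesis by simp
  qed
  also have "\<dots> = (\<Prod>z\<in>UNIV. \<bar>e z\<bar>)"
    unfolding coord_scale_def[abs_def] by (rule lin_scale_scaling) (rule e)
  also have "\<dots> = (\<Prod>z\<in>(- {k}) \<times> (UNIV :: ('p + 'p uprod) set). r)"
    using r by (intro prod.mono_neutral_cong_right) (auto simp: e_def)
  also have "\<dots> = r ^ ((CARD('k) - 1) * (CARD('p) + CARD('p) * (CARD('p) + 1) div 2))"
    by (simp add: card_cartesian_product Compl_eq_Diff_UNIV card_Diff_singleton card_UNIV_uprod UNIV_Plus_UNIV[symmetric] card_Plus del: UNIV_Plus_UNIV)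
  \<comment> \<open>Natural-number division: p (p + 1) is even, so both halves are exact.\<close>
  also have "(CARD('k) - 1) * (CARD('p) + CARD('p) * (CARD('p) + 1) div 2) = CARD('p) * (CARD('p) + 3) * (CARD('k) - 1) div 2"
  proof -
    have "even (CARD('p) * (CARD('p) + 1))" by simp
    then obtain m where m: "CARD('p) * (CARD('p) + 1) = 2 * m" by (elim evenE)
    have "CARD('p) * (CARD('p) + 3) = 2 * (CARD('p) + m)" using m by (simp add: algebra_simps)
    then have "CARD('p) * (CARD('p) + 3) * (CARD('k) - 1) = ((CARD('p) + m) * (CARD('k) - 1)) * 2"
      by (simp only: mult_ac)
    then have "CARD('p) * (CARD('p) + 3) * (CARD('k) - 1) div 2 = (CARD('p) + m) * (CARD('k) - 1)"
      by (simp only: nonzero_mult_div_cancel_right)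
    moreover have "CARD('p) * (CARD('p) + 1) div 2 = m" by (simp only: m)
    ultimately show ?thesis by (simp only: mult.commute)
  qed
  finally show ?thesis .
qed

lemma AE_not_pooled:
  fixes N :: "'k::finite \<Rightarrow> real"
  assumes N: "\<And>i. N i > 0" and k: "CARD('k) \<ge> 2"
  shows "AE v in lborel. (v :: ('k, 'p::finite) param) \<noteq> pooled N v"
proof -
  obtain i j :: 'k where ij: "i \<noteq> j"
    using k by (metis (full_types) UNIV_I card_1_singleton_iff card_le_Suc0_iff_eq finite numeral_2_eq_2 not_less_eq_eq le_refl)
  define x :: "'p + 'p uprod" where "x = undefined"
  \<comment> \<open>Pooled statistics lie in the hyperplane N j v_i = N i v_j, for two distinct
    groups i, j and one coordinate x.\<close>
  define a :: "('k, 'p) param" where "a = axis (i, x) (N j) - axis (j, x) (N i)"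
  have "a $ (i, x) = N j" using ij by (simp add: a_def axis_def)
  then have "a \<noteq> 0" using N[of j] by (metis less_irrefl zero_index)
  then have neg: "negligible {v. a \<bullet> v = 0}" by (intro negligible_hyperplane) simp
  have sub: "{v. v = pooled N v} \<subseteq> {v. a \<bullet> v = 0}"
  proof safe
    fix v :: "('k, 'p) param" assume v: "v = pooled N v"
    have "a \<bullet> v = N j * v $ (i, x) - N i * v $ (j, x)"
      by (simp add: a_def inner_diff_left inner_axis' )
    also have "\<dots> = 0" by (subst (1 2) v) (simp add: pooled_def)
    finally show "a \<bullet> v = 0" .
  qed
  have "closed {v. a \<bullet> v = 0}" by (rule closed_hyperplane)
  then have "{v. a \<bullet> v = 0} \<in> null_sets lborel"
    using neg by (subst null_sets_completion_iff[symmetric]) (auto simp: negligible_iff_null_sets)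
  then show ?thesis
    by (rule AE_I') (use sub in auto)
qed

lemma constraint_count_pos:
  assumes k: "CARD('k::finite) \<ge> 2"
  shows "0 < CARD('p::finite) * (CARD('p) + 3) * (CARD('k) - 1) div 2"
proof -
  have "1 * 4 * 1 \<le> CARD('p) * (CARD('p) + 3) * (CARD('k) - 1)"
  proof (intro mult_le_mono)
    show "1 \<le> CARD('p)" by (simp add: Suc_leI)
    then show "4 \<le> CARD('p) + 3" by simp
    show "1 \<le> CARD('k) - 1" using k by simp
  qed
  then show ?thesis by simp
qed

text \<open>Integration in polar coordinates around the pooled statistic, with the angular measure
  replaced by \<open>\<theta> v dv\<close>: insert \<open>1 = \<integral> \<rho> / (\<rho> + s)\<^sup>2 ds\<close> with \<open>\<rho> = |v - pooled v|\<close> and rescale \<open>v\<close> by \<open>s\<close>.\<close>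

lemma polar_integral:
  fixes N :: "'k::finite \<Rightarrow> real"
  defines "d \<equiv> CARD('p) * (CARD('p) + 3) * (CARD('k) - 1) div 2"
  assumes N: "\<And>i. N i > 0" and k: "CARD('k) \<ge> 2"
  obtains \<theta> :: "('k, 'p::finite) param \<Rightarrow> ennreal" where "\<theta> \<in> borel_measurable borel" "AE v in lborel. \<theta> v > 0"
    "\<And>H. H \<in> borel_measurable borel \<Longrightarrow> (\<integral>\<^sup>+v. H v \<partial>lborel) =
      (\<integral>\<^sup>+v. \<theta> v * (\<integral>\<^sup>+s. ennreal (s ^ (d - 1)) * H (radial N s v) * indicator {0<..} s \<partial>lborel) \<partial>lborel)"
proof -
  have d: "d > 0" unfolding d_def by (rule constraint_count_pos[OF k])
  define \<rho> where "\<rho> v = norm (v - pooled N v)" for v :: "('k, 'p) param"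
  have [measurable]: "(pooled N :: ('k, 'p) param \<Rightarrow> _) \<in> borel_measurable borel"
    by (rule borel_measurable_linear[OF linear_pooled])
  have [measurable]: "\<rho> \<in> borel_measurable borel" unfolding \<rho>_def[abs_def] by measurable
  have rho_radial: "\<rho> (radial N s v) = s * \<rho> v" if "s > 0" for s v
    unfolding \<rho>_def pooled_radial[where N=N, OF N] using that by (simp add: radial_def)
  define \<theta> where "\<theta> v = ennreal (\<rho> v / (\<rho> v + 1)^2)" for v
  have rho0: "\<rho> v \<ge> 0" for v by (simp add: \<rho>_def)
  have AE: "AE v in lborel. \<rho> v > 0"
    using AE_not_pooled[where N=N and ?'p='p, OF N k] by (auto simp: \<rho>_def)
  show thesis
  proof (rule that[of \<theta>])
    show [measurable]: "\<theta> \<in> borel_measurable borel" unfolding \<theta>_def[abs_def] by measurable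
    show "AE v in lborel. \<theta> v > 0"
      using AE by eventually_elim (simp add: \<theta>_def)
    fix H :: "('k, 'p) param \<Rightarrow> ennreal" assume [measurable]: "H \<in> borel_measurable borel"
    have one: "(\<integral>\<^sup>+s. ennreal (\<rho> v / (\<rho> v + s)^2) * indicator {0..} s \<partial>lborel) = 1" if v: "\<rho> v > 0" for v
    proof -
      have "(\<integral>\<^sup>+s. ennreal (\<rho> v / (\<rho> v + s)^2) * indicator {0..} s \<partial>lborel) = ennreal (0 - (- (\<rho> v / (\<rho> v + 0))))"
      proof (rule nn_integral_FTC_atLeast)
        show "(\<lambda>s. \<rho> v / (\<rho> v + s)^2) \<in> borel_measurable borel" by measurable
        show "((\<lambda>s. - (\<rho> v / (\<rho> v + s))) has_real_derivative \<rho> v / (\<rho> v + x)^2) (at x)" if "0 \<le> x" for x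
          using v that by (auto intro!: derivative_eq_intros simp: power2_eq_square)
        show "0 \<le> \<rho> v / (\<rho> v + x)^2" for x using v by simp
        have "((\<lambda>s. - (\<rho> v / (\<rho> v + s))) \<longlongrightarrow> - 0) at_top"
          by (intro tendsto_minus tendsto_divide_0[OF tendsto_const] filterlim_at_top_imp_at_infinity
              filterlim_tendsto_add_at_top[OF tendsto_const] filterlim_ident)
        then show "((\<lambda>s. - (\<rho> v / (\<rho> v + s))) \<longlongrightarrow> 0) at_top" by simp
      qed
      then show ?thesis using v by simp
    qed
    have "(\<integral>\<^sup>+v. H v \<partial>lborel) = (\<integral>\<^sup>+v. H v * (\<integral>\<^sup>+s. ennreal (\<rho> v / (\<rho> v + s)^2) * indicator {0<..} s \<partial>lborel) \<partial>lborel)"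
    proof (rule nn_integral_cong_AE)
      show "AE v in lborel. H v = H v * (\<integral>\<^sup>+s. ennreal (\<rho> v / (\<rho> v + s)^2) * indicator {0<..} s \<partial>lborel)"
        using AE
      proof eventually_elim
        case (elim v)
        have "(\<integral>\<^sup>+s. ennreal (\<rho> v / (\<rho> v + s)^2) * indicator {0<..} s \<partial>lborel) = (\<integral>\<^sup>+s. ennreal (\<rho> v / (\<rho> v + s)^2) * indicator {0..} s \<partial>lborel)"
          using AE_lborel_singleton[of "0::real"] by (intro nn_integral_cong_AE) (auto split: split_indicator)
        then show ?case using one[OF elim] by simp
      qed
    qed
    also have "\<dots> = (\<integral>\<^sup>+v. (\<integral>\<^sup>+s. H v * ennreal (\<rho> v / (\<rho> v + s)^2) * indicator {0<..} s \<partial>lborel) \<partial>lborel)"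
      by (simp add: nn_integral_cmult[symmetric] mult.assoc)
    also have "\<dots> = (\<integral>\<^sup>+s. (\<integral>\<^sup>+v. H v * ennreal (\<rho> v / (\<rho> v + s)^2) * indicator {0<..} s \<partial>lborel) \<partial>lborel)"
      by (rule lborel_pair.Fubini'[symmetric]) simp
    also have "\<dots> = (\<integral>\<^sup>+s. (\<integral>\<^sup>+v. \<theta> v * (ennreal (s ^ (d - 1)) * H (radial N s v) * indicator {0<..} s) \<partial>lborel) \<partial>lborel)"
    proof (rule nn_integral_cong)
      fix s :: real
      show "(\<integral>\<^sup>+v. H v * ennreal (\<rho> v / (\<rho> v + s)^2) * indicator {0<..} s \<partial>lborel) =
        (\<integral>\<^sup>+v. \<theta> v * (ennreal (s ^ (d - 1)) * H (radial N s v) * indicator {0<..} s) \<partial>lborel)"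
      proof (cases "s > 0")
        case True
        have [measurable]: "(radial N s :: ('k, 'p) param \<Rightarrow> _) \<in> borel_measurable borel"
          by (rule borel_measurable_linear[OF linear_radial])
        have "(\<integral>\<^sup>+v. H v * ennreal (\<rho> v / (\<rho> v + s)^2) \<partial>lborel) =
           ennreal (s ^ d) * (\<integral>\<^sup>+v. H (radial N s v) * ennreal (\<rho> (radial N s v) / (\<rho> (radial N s v) + s)^2) \<partial>lborel)"
          unfolding d_def lin_scale_radial[where N=N and r=s and ?'p='p, OF N True, symmetric]
          using True by (intro nn_integral_lin_scale linear_radial bij_radial N) auto
        also have "\<dots> = (\<integral>\<^sup>+v. ennreal (s ^ d) * (H (radial N s v) * ennreal (\<rho> (radial N s v) / (\<rho> (radial N s v) + s)^2)) \<partial>lborel)"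
          by (rule nn_integral_cmult[symmetric]) measurable
        also have "\<dots> = (\<integral>\<^sup>+v. \<theta> v * (ennreal (s ^ (d - 1)) * H (radial N s v)) \<partial>lborel)"
        proof (intro nn_integral_cong)
          fix v
          have "s ^ d * (\<rho> (radial N s v) / (\<rho> (radial N s v) + s)^2) = (\<rho> v / (\<rho> v + 1)^2) * s ^ (d - 1)"
          proof -
            have "s * \<rho> v + s = s * (\<rho> v + 1)" by (simp add: algebra_simps)
            then have e1: "s * (\<rho> (radial N s v) / (\<rho> (radial N s v) + s)^2) = \<rho> v / (\<rho> v + 1)^2"
              using True by (simp add: rho_radial power_mult_distrib) (simp add: power2_eq_square)
            have e2: "s ^ d = s ^ (d - 1) * s" using power_minus_mult[OF d, of s] by (rule sym)
            show ?thesis unfolding e2 mult.assoc e1 by (rule mult.commute)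
          qed
          then have "ennreal (s ^ d) * ennreal (\<rho> (radial N s v) / (\<rho> (radial N s v) + s)^2) = \<theta> v * ennreal (s ^ (d - 1))"
            using True rho0 by (simp add: \<theta>_def ennreal_mult[symmetric])
          then show "ennreal (s ^ d) * (H (radial N s v) * ennreal (\<rho> (radial N s v) / (\<rho> (radial N s v) + s)^2)) =
             \<theta> v * (ennreal (s ^ (d - 1)) * H (radial N s v))"
            by (metis mult.assoc mult.commute)
        qed
        finally show ?thesis using True by simp
      qed simp
    qed
    also have "\<dots> = (\<integral>\<^sup>+v. (\<integral>\<^sup>+s. \<theta> v * (ennreal (s ^ (d - 1)) * H (radial N s v) * indicator {0<..} s) \<partial>lborel) \<partial>lborel)"
      by (rule lborel_pair.Fubini'[symmetric]) simp
    also have "\<dots> = (\<integral>\<^sup>+v. \<theta> v * (\<integral>\<^sup>+s. ennreal (s ^ (d - 1)) * H (radial N s v) * indicator {0<..} s \<partial>lborel) \<partial>lborel)"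
      by (simp add: nn_integral_cmult)
    finally show "(\<integral>\<^sup>+v. H v \<partial>lborel) =
      (\<integral>\<^sup>+v. \<theta> v * (\<integral>\<^sup>+s. ennreal (s ^ (d - 1)) * H (radial N s v) * indicator {0<..} s \<partial>lborel) \<partial>lborel)" .
  qed
qed

text \<open>The probability integral transform for the measure with density w on the positive
  half-line. Its tail is continuous and decreases from T 0 to 0, so the value a T 0 is taken; since
  the tail may be flat, the least such point is used.\<close>

lemma uniform_tail:
  fixes w :: "real \<Rightarrow> ennreal"
  defines "T \<equiv> \<lambda>s. \<integral>\<^sup>+t. w t * indicator {s<..} t \<partial>lborel"
  assumes w [measurable]: "w \<in> borel_measurable borel" and M: "0 < T 0" "T 0 < \<infinity>" and a: "0 < a" "a < 1"
  shows "(\<integral>\<^sup>+s. w s * indicator {0<..} s * indicator {s. enn2real (T s) / enn2real (T 0) \<le> a} s \<partial>lborel) = ennreal a * T 0"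
proof -
  define D where "D = density lborel (\<lambda>t. w t * indicator {0<..} t)"
  have em: "emeasure D A = (\<integral>\<^sup>+t. w t * indicator {0<..} t * indicator A t \<partial>lborel)" if "A \<in> sets borel" for A
    using that by (simp add: D_def emeasure_density)
  have sD [measurable_cong, simp]: "sets D = sets borel" by (simp add: D_def)
  have spD [simp]: "space D = UNIV" by (simp add: D_def)
  have UN: "emeasure D UNIV = T 0" by (simp add: em T_def)
  interpret D: finite_borel_measure D
    by (intro finite_borel_measure.intro finite_measureI finite_borel_measure_axioms.intro) (use UN M in \<open>auto simp: less_top\<close>)
  have tail: "emeasure D {s<..} = T s" if "s \<ge> 0" for s
    unfolding T_def using that by (subst em) (auto intro!: nn_integral_cong split: split_indicator)
  define m where "m = measure D UNIV"
  define R where "R s = measure D {s<..}" for s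
  have R_eq: "R s = m - cdf D s" for s
  proof -
    have "UNIV - {..s} = {s<..}" by auto
    then show ?thesis
      using D.finite_measure_compl[of "{..s}"] by (simp add: R_def m_def cdf_def)
  qed
  have R_T: "enn2real (T s) = R s" if "s \<ge> 0" for s
    using tail[OF that] by (simp add: R_def measure_def)
  have T0: "T 0 = ennreal m" "m = R 0"
    using UN tail[of 0] M(2) by (simp_all add: m_def R_def measure_def less_top)
  have m: "m > 0" using M(1) T0 by simp
  \<comment> \<open>A measure with a density has no atoms, hence its tail is continuous.\<close>
  have single: "measure D {s} = 0" for s
  proof -
    have "emeasure D {s} = (\<integral>\<^sup>+t. w t * indicator {0<..} t * indicator {s} t \<partial>lborel)"
      by (rule em) simp
    also have "\<dots> = (\<integral>\<^sup>+(t::real). 0 \<partial>lborel)"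
    proof (intro nn_integral_cong_AE)
      show "AE t in lborel. w t * indicator {0<..} t * indicator {s} t = 0"
        using AE_lborel_singleton[of s] by eventually_elim simp
    qed
    finally show ?thesis by (simp add: measure_def)
  qed
  have cont: "continuous_on UNIV R"
    unfolding R_eq[abs_def] using D.isCont_cdf single
    by (intro continuous_intros continuous_at_imp_continuous_on) auto
  have mono: "R t \<le> R s" if "s \<le> t" for s t
    unfolding R_eq using D.cdf_nondecreasing[OF that] by simp
  have lim: "(R \<longlongrightarrow> 0) at_top"
    using tendsto_diff[OF tendsto_const[of m] D.cdf_lim_at_top] unfolding R_eq[abs_def] by (simp add: m_def)
  \<comment> \<open>On the positive axis the set to be measured is the half-line from s0, the least
    point of S. The intermediate value theorem gives the tail at s0 the exact value a m.\<close>
  define S where "S = {0..} \<inter> {s. R s \<le> a * m}"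
  have "closed S"
    unfolding S_def by (intro closed_Int closed_Collect_le cont continuous_on_const) auto
  moreover have "S \<noteq> {}"
  proof -
    have "eventually (\<lambda>s. R s < a * m) at_top"
      using order_tendstoD(2)[OF lim, of "a * m"] a m by simp
    then have "eventually (\<lambda>s. R s < a * m \<and> 0 \<le> s) at_top"
      using eventually_ge_at_top[of "0::real"] by eventually_elim simp
    then have "\<exists>s. R s < a * m \<and> 0 \<le> s"
      by (rule eventually_happens'[OF trivial_limit_at_top_linorder])
    then obtain s where "R s < a * m" "0 \<le> s" by (elim exE conjE)
    then show ?thesis by (auto simp: S_def intro!: exI[of _ s])
  qed
  moreover have bdd: "bdd_below S" by (auto simp: S_def bdd_below_def)
  ultimately have s0S: "Inf S \<in> S" by (intro closed_contains_Inf)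
  define s0 where "s0 = Inf S"
  have s0: "0 \<le> s0" "R s0 \<le> a * m" using s0S by (auto simp: S_def s0_def)
  have least: "s0 \<le> s" if "s \<in> S" for s unfolding s0_def using that bdd by (intro cInf_lower)
  have "a * m < 1 * m" using a m by (intro mult_strict_right_mono)
  then have "a * m \<le> R 0" using T0 by simp
  then obtain s where s: "0 \<le> s" "s \<le> s0" "R s = a * m"
    using IVT2'[of R s0 "a * m" 0] s0 cont by (auto intro: continuous_on_subset)
  then have "s = s0" using least[of s] by (simp add: S_def)
  then have Rs0: "R s0 = a * m" using s by simp
  have "s0 \<noteq> 0" using Rs0 T0(2) a m by auto
  then have s0p: "s0 > 0" using s0 by simp
  have iff: "R s \<le> a * m \<longleftrightarrow> s0 \<le> s" if "s > 0" for s
    using least[of s] mono[of s0 s] Rs0 that by (auto simp: S_def)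
  have "(\<integral>\<^sup>+s. w s * indicator {0<..} s * indicator {s. enn2real (T s) / enn2real (T 0) \<le> a} s \<partial>lborel) =
     (\<integral>\<^sup>+s. w s * indicator {0<..} s * indicator {s0..} s \<partial>lborel)"
  proof (intro nn_integral_cong)
    fix s :: real
    have "s > 0 \<Longrightarrow> enn2real (T s) / enn2real (T 0) \<le> a \<longleftrightarrow> s0 \<le> s"
      using iff[of s] m T0 by (simp add: R_T divide_le_eq)
    then show "w s * indicator {0<..} s * indicator {s. enn2real (T s) / enn2real (T 0) \<le> a} s = w s * indicator {0<..} s * indicator {s0..} s"
      by (auto split: split_indicator)
  qed
  also have "\<dots> = emeasure D {s0..}" by (rule em[symmetric]) simp
  also have "\<dots> = ennreal (measure D ({s0} \<union> {s0<..}))"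
    by (simp add: D.emeasure_eq_measure) (rule arg_cong[of _ _ "measure D"], auto)
  also have "measure D ({s0} \<union> {s0<..}) = R s0"
    by (subst D.finite_measure_Union) (auto simp: single R_def)
  finally show ?thesis using a m by (simp add: Rs0 T0(1) ennreal_mult)
qed

section \<open>The tail ratio along a ray\<close>

lemma borel_measurable_tail_mass [measurable]:
  "(tail_mass d N a :: ('k::finite, 'p::finite) param \<Rightarrow> ennreal) \<in> borel_measurable borel"
  unfolding tail_mass_def[abs_def] by measurable

definition tail_ratio :: "nat \<Rightarrow> ('k \<Rightarrow> real) \<Rightarrow> ('k::finite, 'p::finite) param \<Rightarrow> real" where
  "tail_ratio d N v = enn2real (tail_mass d N 1 v) / enn2real (tail_mass d N 0 v)"

lemma borel_measurable_tail_ratio [measurable]: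
  "(tail_ratio d N :: ('k::finite, 'p::finite) param \<Rightarrow> real) \<in> borel_measurable borel"
  unfolding tail_ratio_def[abs_def] by measurable

text \<open>Substitute u = t s. The power of s is the same for every c, so it cancels in a ratio of
  tails: moving along a ray only moves the point at which one fixed normalized tail is
  evaluated.\<close>

lemma tail_mass_radial:
  fixes v :: "('k::finite, 'p::finite) param"
  assumes N: "\<And>i. N i > 0" and s: "s > 0" and c: "c \<ge> 0" and d: "d > 0"
  shows "tail_mass d N c (radial N s v) = ennreal (1 / s ^ d) * tail_mass d N (c * s) v"
proof -
  have "tail_mass d N c (radial N s v) = (\<integral>\<^sup>+t. ennreal (t ^ (d - 1) * stat_weight N (radial N (t * s) v)) * indicator {c<..} t \<partial>lborel)"
    by (simp add: tail_mass_def radial_radial[where N=N, OF N])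
  also have "\<dots> = ennreal \<bar>1 / s\<bar> * (\<integral>\<^sup>+u. ennreal ((0 + 1 / s * u) ^ (d - 1) * stat_weight N (radial N ((0 + 1 / s * u) * s) v)) * indicator {c<..} (0 + 1 / s * u) \<partial>lborel)"
    by (rule nn_integral_real_affine) (use s in auto)
  also have "\<dots> = ennreal (1 / s) * (\<integral>\<^sup>+u. ennreal (1 / s ^ (d - 1)) * (ennreal (u ^ (d - 1) * stat_weight N (radial N u v)) * indicator {c * s<..} u) \<partial>lborel)"
  proof -
    have "ennreal ((0 + 1 / s * u) ^ (d - 1) * stat_weight N (radial N ((0 + 1 / s * u) * s) v)) * indicator {c<..} (0 + 1 / s * u)
      = ennreal (1 / s ^ (d - 1)) * (ennreal (u ^ (d - 1) * stat_weight N (radial N u v)) * indicator {c * s<..} u)" for u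
    proof (cases "c * s < u")
      case True
      then have "u > 0" using s c by (meson le_less_trans less_imp_le mult_nonneg_nonneg)
      then show ?thesis
        using True s stat_weight_nonneg[of N "radial N u v"]
        by (simp add: ennreal_mult[symmetric] power_divide field_simps)
    next
      case False
      then show ?thesis using s by (simp add: field_simps)
    qed
    then show ?thesis using s by simp
  qed
  also have "\<dots> = ennreal (1 / s) * ennreal (1 / s ^ (d - 1)) * tail_mass d N (c * s) v"
    unfolding tail_mass_def by (subst nn_integral_cmult) (simp_all add: mult.assoc)
  also have "ennreal (1 / s) * ennreal (1 / s ^ (d - 1)) = ennreal (1 / s ^ d)"
    using s power_minus_mult[OF d, of s] by (simp add: ennreal_mult[symmetric] mult.commute)
  finally show ?thesis .
qed

lemma tail_ratio_radial:
  fixes v :: "('k::finite, 'p::finite) param"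
  assumes N: "\<And>i. N i > 0" and s: "s > 0" and d: "d > 0"
  shows "tail_ratio d N (radial N s v) = enn2real (tail_mass d N s v) / enn2real (tail_mass d N 0 v)"
  using s unfolding tail_ratio_def tail_mass_radial[where N=N, OF N s zero_le_one d] tail_mass_radial[where N=N, OF N s order_refl d]
  by (simp add: enn2real_mult)

text \<open>As g is constant on rays it leaves the inner integral in polar coordinates, and there
  \<open>uniform_tail\<close> produces the factor a for almost every v.\<close>

lemma tail_ratio_uniform:
  fixes N :: "'k::finite \<Rightarrow> real" and g :: "('k, 'p::finite) param \<Rightarrow> ennreal"
  defines "d \<equiv> CARD('p) * (CARD('p) + 3) * (CARD('k) - 1) div 2"
  assumes N: "\<And>i. N i > 0" and k: "CARD('k) \<ge> 2" and g [measurable]: "g \<in> borel_measurable borel"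
    and g_radial: "\<And>s v. s > 0 \<Longrightarrow> g (radial N s v) = g v"
    and fin: "(\<integral>\<^sup>+v. g v * ennreal (stat_weight N v) \<partial>lborel) < \<infinity>" and a: "0 < a" "a < 1"
  shows "(\<integral>\<^sup>+v. g v * ennreal (stat_weight N v) * indicator {v. tail_ratio d N v \<le> a} v \<partial>lborel) =
    ennreal a * (\<integral>\<^sup>+v. g v * ennreal (stat_weight N v) \<partial>lborel)"
proof -
  have d: "d > 0" unfolding d_def by (rule constraint_count_pos[OF k])
  obtain \<theta> :: "('k, 'p) param \<Rightarrow> ennreal" where \<theta> [measurable]: "\<theta> \<in> borel_measurable borel"
    and \<theta>_pos: "AE v in lborel. \<theta> v > 0"
    and polar: "\<And>H. H \<in> borel_measurable borel \<Longrightarrow> (\<integral>\<^sup>+v. H v \<partial>lborel) =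
      (\<integral>\<^sup>+v. \<theta> v * (\<integral>\<^sup>+s. ennreal (s ^ (d - 1)) * H (radial N s v) * indicator {0<..} s \<partial>lborel) \<partial>lborel)"
    by (rule polar_integral[where N=N and ?'p='p, OF N k, folded d_def]) (rule that)
  define w where "w v s = ennreal (s ^ (d - 1) * stat_weight N (radial N s v))" for v :: "('k, 'p) param" and s
  have [measurable]: "w v \<in> borel_measurable borel" for v unfolding w_def[abs_def] by measurable
  have tm: "tail_mass d N c v = (\<integral>\<^sup>+t. w v t * indicator {c<..} t \<partial>lborel)" for c v
    by (simp add: tail_mass_def w_def)
  have w_pos: "ennreal (s ^ (d - 1)) * ennreal (stat_weight N (radial N s v)) = w v s" if "s > 0" for s v
    using that by (simp add: w_def ennreal_mult stat_weight_nonneg)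
  have total: "(\<integral>\<^sup>+v. g v * ennreal (stat_weight N v) \<partial>lborel) = (\<integral>\<^sup>+v. \<theta> v * (g v * tail_mass d N 0 v) \<partial>lborel)"
  proof (subst polar, simp, intro nn_integral_cong)
    fix v
    have "(\<integral>\<^sup>+s. ennreal (s ^ (d - 1)) * (g (radial N s v) * ennreal (stat_weight N (radial N s v))) * indicator {0<..} s \<partial>lborel)
      = (\<integral>\<^sup>+s. g v * (w v s * indicator {0<..} s) \<partial>lborel)"
      by (intro nn_integral_cong) (auto simp: w_pos[symmetric] g_radial mult_ac split: split_indicator)
    then show "\<theta> v * (\<integral>\<^sup>+s. ennreal (s ^ (d - 1)) * (g (radial N s v) * ennreal (stat_weight N (radial N s v))) * indicator {0<..} s \<partial>lborel)
       = \<theta> v * (g v * tail_mass d N 0 v)"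
      by (simp add: tm nn_integral_cmult)
  qed
  have part: "(\<integral>\<^sup>+v. g v * ennreal (stat_weight N v) * indicator {v. tail_ratio d N v \<le> a} v \<partial>lborel) =
    (\<integral>\<^sup>+v. \<theta> v * (g v * (\<integral>\<^sup>+s. w v s * indicator {0<..} s *
       indicator {s. enn2real (tail_mass d N s v) / enn2real (tail_mass d N 0 v) \<le> a} s \<partial>lborel)) \<partial>lborel)"
  proof (subst polar, simp, rule nn_integral_cong)
    fix v
    have "(\<integral>\<^sup>+s. ennreal (s ^ (d - 1)) * (g (radial N s v) * ennreal (stat_weight N (radial N s v)) *
         indicator {v. tail_ratio d N v \<le> a} (radial N s v)) * indicator {0<..} s \<partial>lborel)
      = (\<integral>\<^sup>+s. g v * (w v s * indicator {0<..} s *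
       indicator {s. tail_ratio d N (radial N s v) \<le> a} s) \<partial>lborel)"
      by (intro nn_integral_cong) (auto simp: w_pos[symmetric] g_radial mult_ac split: split_indicator)
    also have "\<dots> = g v * (\<integral>\<^sup>+s. w v s * indicator {0<..} s * indicator {s. tail_ratio d N (radial N s v) \<le> a} s \<partial>lborel)"
      by (rule nn_integral_cmult) measurable
    also have "(\<integral>\<^sup>+s. w v s * indicator {0<..} s * indicator {s. tail_ratio d N (radial N s v) \<le> a} s \<partial>lborel) =
       (\<integral>\<^sup>+s. w v s * indicator {0<..} s * indicator {s. enn2real (tail_mass d N s v) / enn2real (tail_mass d N 0 v) \<le> a} s \<partial>lborel)"
      by (intro nn_integral_cong) (auto simp: tail_ratio_radial[where N=N, OF N _ d] split: split_indicator)
    finally show "\<theta> v * (\<integral>\<^sup>+s. ennreal (s ^ (d - 1)) * (g (radial N s v) * ennreal (stat_weight N (radial N s v)) *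
         indicator {v. tail_ratio d N v \<le> a} (radial N s v)) * indicator {0<..} s \<partial>lborel)
       = \<theta> v * (g v * (\<integral>\<^sup>+s. w v s * indicator {0<..} s *
       indicator {s. enn2real (tail_mass d N s v) / enn2real (tail_mass d N 0 v) \<le> a} s \<partial>lborel))" by simp
  qed
  \<comment> \<open>Finite total mass makes almost every ray with positive g and theta one of finite
    mass, as \<open>uniform_tail\<close> demands.\<close>
  have "AE v in lborel. \<theta> v * (g v * tail_mass d N 0 v) \<noteq> \<infinity>"
    using fin unfolding total by (intro nn_integral_PInf_AE) auto
  then have "AE v in lborel. \<theta> v * (g v * (\<integral>\<^sup>+s. w v s * indicator {0<..} s *
       indicator {s. enn2real (tail_mass d N s v) / enn2real (tail_mass d N 0 v) \<le> a} s \<partial>lborel)) =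
       ennreal a * (\<theta> v * (g v * tail_mass d N 0 v))"
    using \<theta>_pos
  proof eventually_elim
    case (elim v)
    let ?I = "\<integral>\<^sup>+s. w v s * indicator {0<..} s *
       indicator {s. enn2real (tail_mass d N s v) / enn2real (tail_mass d N 0 v) \<le> a} s \<partial>lborel"
    consider "g v = 0" | "tail_mass d N 0 v = 0" | "g v \<noteq> 0" "0 < tail_mass d N 0 v" by (auto simp: zero_less_iff_neq_zero)
    then show ?case
    proof cases
      \<comment> \<open>A ray without mass contributes 0 to both sides.\<close>
      case 2
      have "?I \<le> tail_mass d N 0 v" unfolding tm by (intro nn_integral_mono) (auto split: split_indicator)
      then show ?thesis using 2 by simp
    next
      case 3
      then have "tail_mass d N 0 v < \<infinity>" using elim by (auto simp: ennreal_mult_eq_top_iff less_top)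
      then have "?I = ennreal a * tail_mass d N 0 v"
        using uniform_tail[of "w v" a] 3 a by (simp add: tm)
      then show ?thesis by (simp add: mult_ac)
    qed simp
  qed
  then have "(\<integral>\<^sup>+v. \<theta> v * (g v * (\<integral>\<^sup>+s. w v s * indicator {0<..} s *
       indicator {s. enn2real (tail_mass d N s v) / enn2real (tail_mass d N 0 v) \<le> a} s \<partial>lborel)) \<partial>lborel) =
     (\<integral>\<^sup>+v. ennreal a * (\<theta> v * (g v * tail_mass d N 0 v)) \<partial>lborel)"
    by (rule nn_integral_cong_AE)
  then show ?thesis
    unfolding part total by (simp add: nn_integral_cmult)
qed

section \<open>Lebesgue measure on the data\<close>

lemma nn_integral_lborel_affine:
  fixes A :: "real^'p::finite^'p"
  assumes A: "invertible A" and f [measurable]: "f \<in> borel_measurable borel"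
  shows "(\<integral>\<^sup>+x. f x \<partial>lborel) = ennreal \<bar>det A\<bar> * (\<integral>\<^sup>+x. f (A *v x + b) \<partial>lborel)"
proof -
  have "(\<integral>\<^sup>+x. f x \<partial>lborel) = (\<integral>\<^sup>+x. f (x + b) \<partial>lborel)"
    by (rule nn_integral_lborel_translate'[symmetric]) fact
  also have "\<dots> = ennreal \<bar>det A\<bar> * (\<integral>\<^sup>+x. f (A *v x + b) \<partial>lborel)"
    using nn_integral_lin_scale[of "(*v) A" "\<lambda>x. f (x + b)"] linear_bij_matrix[OF A]
    by (simp add: lin_scale_matrix[OF A])
  finally show ?thesis .
qed

text \<open>The two measures are compared on boxes, where the claim splits into changes of variables
  for single vectors.\<close>

lemma nn_integral_PiM_affine:
  fixes A :: "'i \<Rightarrow> real^'p::finite^'p"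
  defines "P \<equiv> \<lambda>I. Pi\<^sub>M I (\<lambda>_. lborel :: (real^'p) measure)"
  assumes fin: "finite I" and A: "\<And>i. i \<in> I \<Longrightarrow> invertible (A i)" and F [measurable]: "F \<in> borel_measurable (P I)"
  shows "(\<integral>\<^sup>+y. F y \<partial>P I) = ennreal (\<Prod>i\<in>I. \<bar>det (A i)\<bar>) * (\<integral>\<^sup>+y. F (\<lambda>i\<in>I. A i *v y i + b i) \<partial>P I)"
proof -
  interpret product_sigma_finite "\<lambda>_ :: 'i. lborel :: (real^'p) measure"
    by standard
  define c where "c = ennreal (\<Prod>i\<in>I. \<bar>det (A i)\<bar>)"
  define T where "T y = (\<lambda>i\<in>I. A i *v y i + b i)" for y
  have vm: "(*v) B \<in> borel_measurable borel" for B :: "real^'p^'p"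
    by (rule borel_measurable_linear) simp
  have T [measurable]: "T \<in> measurable (P I) (P I)"
    unfolding T_def[abs_def] P_def
    by (intro measurable_restrict)
       (auto intro!: borel_measurable_add measurable_compose[OF measurable_component_singleton] simp: vm)
  have sP [measurable_cong]: "sets (density (distr (P I) (P I) T) (\<lambda>_. c)) = sets (P I)" by simp
  have "density (distr (P I) (P I) T) (\<lambda>_. c) = Pi\<^sub>M I (\<lambda>_. lborel)"
  proof (rule PiM_eqI)
    fix E :: "'i \<Rightarrow> (real^'p) set" assume E: "\<And>i. i \<in> I \<Longrightarrow> E i \<in> sets lborel"
    have preE: "(\<lambda>x. A i *v x + b i) -` E i \<in> sets lborel" if "i \<in> I" for i
    proof -
      have "(\<lambda>x. A i *v x + b i) \<in> measurable lborel lborel" using vm[of "A i"] by simp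
      from measurable_sets[OF this E[OF that]] show ?thesis by simp
    qed
    have PE: "Pi\<^sub>E I E \<in> sets (P I)" unfolding P_def using E fin by (intro sets_PiM_I_finite) auto
    have "emeasure (density (distr (P I) (P I) T) (\<lambda>_. c)) (Pi\<^sub>E I E) = c * emeasure (distr (P I) (P I) T) (Pi\<^sub>E I E)"
      using PE by (subst emeasure_density_const) auto
    also have "emeasure (distr (P I) (P I) T) (Pi\<^sub>E I E) = emeasure (P I) (T -` Pi\<^sub>E I E \<inter> space (P I))"
      using PE by (subst emeasure_distr) auto
    also have "T -` Pi\<^sub>E I E \<inter> space (P I) = Pi\<^sub>E I (\<lambda>i. (\<lambda>x. A i *v x + b i) -` E i)"
      by (auto simp: T_def P_def space_PiM PiE_iff)
    also have "emeasure (P I) \<dots> = (\<Prod>i\<in>I. emeasure lborel ((\<lambda>x. A i *v x + b i) -` E i))"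
      unfolding P_def using fin preE by (subst emeasure_PiM) auto
    also have "c * \<dots> = (\<Prod>i\<in>I. ennreal \<bar>det (A i)\<bar> * emeasure lborel ((\<lambda>x. A i *v x + b i) -` E i))"
      by (simp add: c_def prod.distrib prod_ennreal)
    also have "\<dots> = (\<Prod>i\<in>I. emeasure lborel (E i))"
    proof (rule prod.cong[OF refl])
      fix i assume i: "i \<in> I"
      have "emeasure lborel (E i) = (\<integral>\<^sup>+x. indicator (E i) x \<partial>lborel)" using E[OF i] by simp
      also have "\<dots> = ennreal \<bar>det (A i)\<bar> * (\<integral>\<^sup>+x. indicator (E i) (A i *v x + b i) \<partial>lborel)"
        by (rule nn_integral_lborel_affine[OF A[OF i]]) (use E[OF i] in simp)
      also have "(\<integral>\<^sup>+x. indicator (E i) (A i *v x + b i) \<partial>lborel) = (\<integral>\<^sup>+x. indicator ((\<lambda>x. A i *v x + b i) -` E i) x \<partial>lborel)"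
        by (rule nn_integral_cong) (simp add: indicator_def)
      also have "\<dots> = emeasure lborel ((\<lambda>x. A i *v x + b i) -` E i)" using preE[OF i] by simp
      finally show "ennreal \<bar>det (A i)\<bar> * emeasure lborel ((\<lambda>x. A i *v x + b i) -` E i) = emeasure lborel (E i)" ..
    qed
    finally show "emeasure (density (distr (P I) (P I) T) (\<lambda>_. c)) (Pi\<^sub>E I E) = (\<Prod>i\<in>I. emeasure lborel (E i))" .
  qed (use fin in \<open>auto simp: P_def\<close>)
  then have "(\<integral>\<^sup>+y. F y \<partial>P I) = (\<integral>\<^sup>+y. F y \<partial>density (distr (P I) (P I) T) (\<lambda>_. c))" by (simp add: P_def)
  also have "\<dots> = (\<integral>\<^sup>+y. c * F y \<partial>distr (P I) (P I) T)"
    by (rule nn_integral_density) auto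
  also have "\<dots> = (\<integral>\<^sup>+y. c * F (T y) \<partial>P I)"
    by (rule nn_integral_distr) auto
  also have "\<dots> = c * (\<integral>\<^sup>+y. F (T y) \<partial>P I)"
    by (rule nn_integral_cmult) measurable
  finally show ?thesis by (simp add: c_def T_def)
qed

section \<open>The statistic as a function of the data\<close>

definition obs_index :: "('k \<Rightarrow> nat) \<Rightarrow> ('k \<times> nat) set" where
  "obs_index n = (SIGMA i:UNIV. {..<n i})"

lemma finite_obs_index [simp]: "finite (obs_index n)" for n :: "'k::finite \<Rightarrow> nat"
  by (simp add: obs_index_def)

lemma mem_obs_index [simp]: "(i, j) \<in> obs_index n \<longleftrightarrow> j < n i"
  by (simp add: obs_index_def)

lemma prod_obs_index:
  fixes f :: "'k::finite \<times> nat \<Rightarrow> 'a::comm_monoid_mult"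
  shows "(\<Prod>z\<in>obs_index n. f z) = (\<Prod>i\<in>UNIV. \<Prod>j<n i. f (i, j))"
  unfolding obs_index_def by (simp add: prod.Sigma)

abbreviation data_space :: "('k \<Rightarrow> nat) \<Rightarrow> ('k \<times> nat \<Rightarrow> real^'p::finite) measure" where
  "data_space n \<equiv> Pi\<^sub>M (obs_index n) (\<lambda>_. lborel)"

definition data_stat :: "('k::finite \<Rightarrow> nat) \<Rightarrow> ('k \<times> nat \<Rightarrow> real^'p::finite) \<Rightarrow> ('k, 'p) param" where
  "data_stat n y = suff_stat n (\<lambda>i j. y (i, j))"

lemma data_stat_cong: "(\<And>i j. j < n i \<Longrightarrow> y (i, j) = z (i, j)) \<Longrightarrow> data_stat n y = data_stat n z"
  by (rule param_eqI) (simp_all add: data_stat_def)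

text \<open>Points of the product space are undefined off the index set. The statistic reads only
  indices inside it, so affine images may be written with or without restriction.\<close>

lemma data_stat_restrict [simp]: "data_stat n (restrict f (obs_index n)) = data_stat n f"
  by (rule data_stat_cong) simp

lemma borel_measurable_data_stat [measurable]:
  "(data_stat n :: _ \<Rightarrow> ('k::finite, 'p::finite) param) \<in> borel_measurable (data_space n)"
proof (rule borel_measurable_vecI)
  have m: "(\<lambda>y. y (i, j) $ a) \<in> borel_measurable (data_space n)" if "j < n i" for i j and a :: 'p
    by (rule borel_measurable_vec_nth, rule measurable_compose[OF measurable_component_singleton[of "(i, j)"]])
       (use that in auto)
  fix z :: "'k \<times> ('p + 'p uprod)"
  obtain i x where z: "z = (i, x)" by (cases z)
  show "(\<lambda>y. (data_stat n y :: ('k, 'p) param) $ z) \<in> borel_measurable (data_space n)"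
  proof (cases x)
    case (Inl a)
    have "(data_stat n y :: ('k, 'p) param) $ z = xi (suff_stat n (\<lambda>i j. y (i, j))) i $ a" for y
      by (simp only: data_stat_def xi_def z Inl vec_lambda_beta)
    then have "(data_stat n y :: ('k, 'p) param) $ z = (\<Sum>j<n i. y (i, j)) $ a" for y
      by (simp only: xi_suff_stat)
    then show ?thesis
      by (simp only:) (auto simp: intro!: borel_measurable_sum m)
  next
    case (Inr u)
    obtain a c where u: "u = Upair a c" by (cases u)
    have "(data_stat n y :: ('k, 'p) param) $ z = conc (suff_stat n (\<lambda>i j. y (i, j))) i $ a $ c" for y
      by (simp only: data_stat_def conc_def z Inr u vec_lambda_beta)
    then have "(data_stat n y :: ('k, 'p) param) $ z = (\<Sum>j<n i. outer (y (i, j)) (y (i, j))) $ a $ c" for y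
      by (simp only: conc_suff_stat)
    then show ?thesis
      by (simp only:) (auto simp: outer_def intro!: borel_measurable_sum borel_measurable_times m)
  qed
qed

lemma data_stat_affine:
  "data_stat n (\<lambda>(i, j). A i *v y (i, j) + b i) = affine_act (\<lambda>i. real (n i)) A b (data_stat n y)"
proof (rule param_eqI)
  fix i
  have s: "(\<Sum>j<n i. A i *v y (i, j)) = A i *v (\<Sum>j<n i. y (i, j))"
    by (rule linear_sum[symmetric]) simp
  show "xi (data_stat n (\<lambda>(i, j). A i *v y (i, j) + b i)) i = xi (affine_act (\<lambda>i. real (n i)) A b (data_stat n y)) i"
    by (simp add: data_stat_def sum.distrib s sum_constant_scaleR del: sum_constant)
  have o1: "(\<Sum>j<n i. outer (A i *v y (i, j)) (b i)) = outer (A i *v (\<Sum>j<n i. y (i, j))) (b i)"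
    unfolding s[symmetric] by (rule bounded_bilinear.sum_left[OF bounded_bilinear_outer, symmetric])
  have o2: "(\<Sum>j<n i. outer (b i) (A i *v y (i, j))) = outer (b i) (A i *v (\<Sum>j<n i. y (i, j)))"
    unfolding s[symmetric] by (rule bounded_bilinear.sum_right[OF bounded_bilinear_outer, symmetric])
  have o3: "(\<Sum>j<n i. outer (A i *v y (i, j)) (A i *v y (i, j))) = A i ** (\<Sum>j<n i. outer (y (i, j)) (y (i, j))) ** transpose (A i)"
    by (simp add: outer_mult[symmetric] matrix_mult_sum_right
        bounded_bilinear.sum_left[OF bounded_bilinear_matrix_mult])
  show "conc (data_stat n (\<lambda>(i, j). A i *v y (i, j) + b i)) i = conc (affine_act (\<lambda>i. real (n i)) A b (data_stat n y)) i"
    by (simp add: data_stat_def outer_add_left outer_add_right sum.distrib o1 o2 o3 sum_constant_scaleR del: sum_constant)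
qed

section \<open>Almost sure positive definiteness of the sample covariances\<close>

lemma group_cov_data_stat:
  fixes y :: "'k::finite \<times> nat \<Rightarrow> real^'p::finite" and n :: "'k \<Rightarrow> nat"
  defines "N \<equiv> \<lambda>i. real (n i)"
  assumes n: "n i > 0"
  shows "group_cov N (data_stat n y) i = (1 / N i) *\<^sub>R (\<Sum>j<n i. outer (y (i, j) - group_avg N (data_stat n y) i) (y (i, j) - group_avg N (data_stat n y) i))"
proof -
  define m where "m = group_avg N (data_stat n y) i"
  have sum: "(\<Sum>j<n i. y (i, j)) = N i *\<^sub>R m" using n by (simp add: m_def N_def group_avg_def data_stat_def)
  have o: "outer (x - m) (x - m) = outer x x - outer x m - outer m x + outer m m" for x :: "real^'p"
    by (simp add: outer_def vec_eq_iff algebra_simps)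
  have "(\<Sum>j<n i. outer (y (i, j)) m) = N i *\<^sub>R outer m m" "(\<Sum>j<n i. outer m (y (i, j))) = N i *\<^sub>R outer m m"
    unfolding bounded_bilinear.sum_left[OF bounded_bilinear_outer, symmetric] bounded_bilinear.sum_right[OF bounded_bilinear_outer, symmetric] sum
    by (simp_all add: outer_scaleR_left outer_scaleR_right)
  then have "(\<Sum>j<n i. outer (y (i, j) - m) (y (i, j) - m)) = (\<Sum>j<n i. outer (y (i, j)) (y (i, j))) - N i *\<^sub>R outer m m"
    by (simp add: o sum.distrib sum_subtractf sum_constant_scaleR N_def del: sum_constant)
  moreover have "group_cov N (data_stat n y) i = (1 / N i) *\<^sub>R conc (data_stat n y) i - outer m m"
    by (simp add: group_cov_def m_def)
  moreover have "conc (data_stat n y) i = (\<Sum>j<n i. outer (y (i, j)) (y (i, j)))"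
    by (simp add: data_stat_def)
  ultimately show ?thesis
    using n unfolding m_def[symmetric] by (simp add: scaleR_diff_right N_def)
qed

text \<open>The quadratic form at x is the mean of the squared components of the deviations along x,
  so it can be nonpositive only if they all vanish.\<close>

lemma quadratic_group_cov_data_stat:
  fixes y :: "'k::finite \<times> nat \<Rightarrow> real^'p::finite" and n :: "'k \<Rightarrow> nat"
  defines "N \<equiv> \<lambda>i. real (n i)"
  assumes n: "n i > 0" and z: "x \<bullet> (group_cov N (data_stat n y) i *v x) \<le> 0" and j: "j < n i"
  shows "x \<bullet> (y (i, j) - group_avg N (data_stat n y) i) = 0"
proof -
  define D where "D j = y (i, j) - group_avg N (data_stat n y) i" for j
  have "group_cov N (data_stat n y) i *v x = (1 / N i) *\<^sub>R (\<Sum>j<n i. (D j \<bullet> x) *\<^sub>R D j)"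
    unfolding group_cov_data_stat[of n i y, OF n, folded N_def] D_def[symmetric]
    by (simp add: N_def scaleR_matrix_vector_assoc[symmetric] outer_mult_vec
        linear_sum[of "\<lambda>M. M *v x"] linear_iff matrix_vector_mult_add_rdistrib)
  then have "x \<bullet> (group_cov N (data_stat n y) i *v x) = (1 / N i) * (\<Sum>j<n i. (x \<bullet> D j)^2)"
    by (simp add: inner_sum_right power2_eq_square inner_commute)
  with z have "(\<Sum>j<n i. (x \<bullet> D j)^2) \<le> 0" using n by (simp add: N_def divide_le_0_iff)
  moreover have "(\<Sum>j<n i. (x \<bullet> D j)^2) \<ge> 0" by (intro sum_nonneg) simp
  ultimately have "(\<Sum>j<n i. (x \<bullet> D j)^2) = 0" by simp
  then have "(x \<bullet> D j)^2 = 0" using j by (subst (asm) sum_nonneg_eq_0_iff) auto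
  then show ?thesis by (simp add: D_def)
qed

text \<open>A sample covariance is positive semidefinite, so the exceptional data are described by
  the single polynomial equation det = 0.\<close>

lemma pos_def_group_cov_data_stat:
  fixes y :: "'k::finite \<times> nat \<Rightarrow> real^'p::finite" and n :: "'k \<Rightarrow> nat"
  defines "N \<equiv> \<lambda>i. real (n i)"
  assumes n: "n i > 0" and d: "det (group_cov N (data_stat n y) i) \<noteq> 0"
  shows "pos_def (group_cov N (data_stat n y) i)"
  unfolding pos_def_def
proof (intro conjI allI impI)
  fix x :: "real^'p" assume x: "x \<noteq> 0"
  show "0 < x \<bullet> (group_cov N (data_stat n y) i *v x)"
  proof (rule ccontr)
    assume "\<not> ?thesis"
    then have z: "(y (i, j) - group_avg N (data_stat n y) i) \<bullet> x = 0" if "j < n i" for j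
      using quadratic_group_cov_data_stat[of n i x y j, folded N_def] n that by (simp add: inner_commute)
    have "group_cov N (data_stat n y) i *v x = 0"
      unfolding group_cov_data_stat[of n i y, OF n, folded N_def]
      by (simp add: scaleR_matrix_vector_assoc[symmetric] outer_mult_vec z
          linear_sum[of "\<lambda>M. M *v x"] linear_iff matrix_vector_mult_add_rdistrib)
    then show False
      using invertible_mult_nonzero[of "group_cov N (data_stat n y) i" x] d x by (simp add: invertible_det_nz)
  qed
qed simp

text \<open>The p unit vectors together with the origin span affinely, which takes p + 1
  observations.\<close>

lemma group_cov_generic:
  fixes n :: "'k::finite \<Rightarrow> nat"
  assumes "n i \<ge> CARD('p::finite) + 1"
  obtains e :: "'k \<times> nat \<Rightarrow> real^'p" where "pos_def (group_cov (\<lambda>i. real (n i)) (data_stat n e) i)"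
proof -
  obtain h :: "nat \<Rightarrow> 'p" where h: "bij_betw h {..<CARD('p)} UNIV"
    using ex_bij_betw_nat_finite[of "UNIV :: 'p set"] by (auto simp: lessThan_atLeast0)
  define e :: "'k \<times> nat \<Rightarrow> real^'p" where "e z = (if snd z < CARD('p) then axis (h (snd z)) 1 else 0)" for z
  have "0 < x \<bullet> (group_cov (\<lambda>i. real (n i)) (data_stat n e) i *v x)" if x: "x \<noteq> 0" for x
  proof (rule ccontr)
    let ?m = "group_avg (\<lambda>i. real (n i)) (data_stat n e) i"
    assume "\<not> ?thesis"
    then have z: "x \<bullet> (e (i, j) - ?m) = 0" if "j < n i" for j
      using quadratic_group_cov_data_stat[of n i x e j] that assms by simp
    \<comment> \<open>Observation p, counted from 0, is the origin and exists because n i is at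
      least p + 1; it forces the mean itself to be orthogonal to x.\<close>
    have m: "x \<bullet> ?m = 0" using z[of "CARD('p)"] assms by (simp add: e_def)
    have "x $ a = 0" for a
    proof -
      obtain j where j: "j < CARD('p)" "h j = a" using h by (metis UNIV_I bij_betw_def imageE lessThan_iff)
      have "x \<bullet> e (i, j) = 0" using z[of j] m j assms by (simp add: inner_diff_right)
      then show ?thesis using j by (simp add: e_def inner_axis)
    qed
    then show False using x by (simp add: vec_eq_iff)
  qed
  then have "pos_def (group_cov (\<lambda>i. real (n i)) (data_stat n e) i)"
    by (simp add: pos_def_def)
  then show ?thesis by (rule that)
qed

text \<open>By the Leibniz formula the determinant is the value at t of one polynomial, nonzero
  because of t0.\<close>

lemma det_poly_roots_finite:
  fixes P :: "'p::finite \<Rightarrow> 'p \<Rightarrow> real poly"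
  assumes "det (\<chi> a b. poly (P a b) t0) \<noteq> 0"
  shows "finite {t. det (\<chi> a b. poly (P a b) t) = 0}"
proof -
  define q where "q = (\<Sum>p\<in>{p. p permutes (UNIV :: 'p set)}. smult (of_int (sign p)) (\<Prod>a\<in>UNIV. P a (p a)))"
  have q: "poly q t = det (\<chi> a b. poly (P a b) t)" for t
    by (simp add: q_def det_def poly_sum poly_prod)
  then have "q \<noteq> 0" using assms by (metis poly_0)
  then show ?thesis using poly_roots_finite[of q] by (simp add: q)
qed

text \<open>Along t y + e the determinant is a polynomial in t, and at t = 0 it is the nonzero
  determinant for e.\<close>

lemma finite_singular_line:
  fixes y e :: "'k::finite \<times> nat \<Rightarrow> real^'p::finite" and n :: "'k \<Rightarrow> nat"
  defines "N \<equiv> \<lambda>i. real (n i)"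
  assumes "det (group_cov N (data_stat n e) i) \<noteq> 0"
  shows "finite {t. det (group_cov N (data_stat n (\<lambda>z. t *\<^sub>R y z + e z)) i) = 0}"
proof -
  define P where "P a b = smult (1 / N i) (\<Sum>j<n i. [:e (i, j) $ a, y (i, j) $ a:] * [:e (i, j) $ b, y (i, j) $ b:])
     - smult (1 / N i) (\<Sum>j<n i. [:e (i, j) $ a, y (i, j) $ a:]) * smult (1 / N i) (\<Sum>j<n i. [:e (i, j) $ b, y (i, j) $ b:])" for a b
  have P: "group_cov N (data_stat n (\<lambda>z. t *\<^sub>R y z + e z)) i = (\<chi> a b. poly (P a b) t)" for t
    by (simp add: group_cov_def group_avg_def data_stat_def P_def outer_def vec_eq_iff poly_sum algebra_simps)
  show ?thesis
    unfolding P by (rule det_poly_roots_finite[of _ 0]) (use assms P[of 0] in simp)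
qed

text \<open>Let m be the measure of the data with singular covariance. The substitution y -> t y + e
  with 0 < t < 1 has Jacobian at most 1, so m is at most the measure of those y for which t y + e is
  singular. Integrating over t and exchanging the order gives 0, since each y has only finitely many
  bad t.\<close>

lemma AE_pos_def_group_cov:
  fixes n :: "'k::finite \<Rightarrow> nat"
  defines "N \<equiv> \<lambda>i. real (n i)"
  assumes n: "\<And>i. n i \<ge> CARD('p::finite) + 1"
  shows "AE y in (data_space n :: ('k \<times> nat \<Rightarrow> real^'p) measure). \<forall>i. pos_def (group_cov N (data_stat n y) i)"
proof -
  have "AE y in (data_space n :: ('k \<times> nat \<Rightarrow> real^'p) measure). pos_def (group_cov N (data_stat n y) i)" for i
  proof -
    let ?P = "data_space n :: ('k \<times> nat \<Rightarrow> real^'p) measure"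
    interpret P: product_sigma_finite "\<lambda>_ :: 'k \<times> nat. lborel :: (real^'p) measure"
      by standard
    interpret P: sigma_finite_measure ?P by (rule P.sigma_finite) simp
    interpret pair_sigma_finite ?P "lborel :: real measure" ..
    obtain e :: "'k \<times> nat \<Rightarrow> real^'p" where "pos_def (group_cov N (data_stat n e) i)"
      unfolding N_def by (rule group_cov_generic[where n=n and i=i and ?'p='p, OF n])
    then have e: "det (group_cov N (data_stat n e) i) \<noteq> 0" by (metis less_irrefl pos_def_det_pos)
    define Z where "Z v = (indicator {v :: ('k, 'p) param. det (group_cov N v i) = 0} v :: ennreal)" for v
    have [measurable]: "Z \<in> borel_measurable borel" unfolding Z_def[abs_def] by measurable
    have [measurable]: "(\<lambda>x. x (i, j) :: real^'p) \<in> borel_measurable ?P" if "j < n i" for i j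
      using measurable_component_singleton[of "(i, j)" "obs_index n" "\<lambda>_. lborel :: (real^'p) measure"] that by simp
    have meas: "(\<lambda>x. data_stat n (\<lambda>z. snd x *\<^sub>R fst x z + e z)) \<in> borel_measurable (?P \<Otimes>\<^sub>M lborel)"
    proof -
      have "(\<lambda>x. \<lambda>z\<in>obs_index n. snd x *\<^sub>R fst x z + e z) \<in> measurable (?P \<Otimes>\<^sub>M (lborel :: real measure)) ?P"
        by (intro measurable_restrict) auto
      from measurable_compose[OF this borel_measurable_data_stat] show ?thesis by simp
    qed
    define m where "m = (\<integral>\<^sup>+y. Z (data_stat n y) \<partial>?P)"
    \<comment> \<open>The interval has length 1, so m is its own average over t, even if it were
      infinite.\<close>
    have "m = (\<integral>\<^sup>+t. m * indicator {0<..<1} t \<partial>(lborel :: real measure))"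
      by (subst nn_integral_cmult_indicator) auto
    also have "\<dots> \<le> (\<integral>\<^sup>+t. (\<integral>\<^sup>+y. Z (data_stat n (\<lambda>z. t *\<^sub>R y z + e z)) \<partial>?P) * indicator {0<..<1} t \<partial>lborel)"
    proof (rule nn_integral_mono)
      fix t :: real
      show "m * indicator {0<..<1} t \<le> (\<integral>\<^sup>+y. Z (data_stat n (\<lambda>z. t *\<^sub>R y z + e z)) \<partial>?P) * indicator {0<..<1} t"
      proof (cases "t \<in> {0<..<1}")
        case True
        define A where "A z = t *\<^sub>R (mat 1 :: real^'p^'p)" for z :: "'k \<times> nat"
        have Av: "A z *v x = t *\<^sub>R x" for z x by (simp add: A_def scaleR_matrix_vector_assoc[symmetric])
        have detA: "det (A z) = t ^ CARD('p)" for z by (simp add: A_def det_diagonal mat_def)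
        have "m = ennreal (\<Prod>z\<in>obs_index n. \<bar>det (A z)\<bar>) * (\<integral>\<^sup>+y. Z (data_stat n (\<lambda>z\<in>obs_index n. A z *v y z + e z)) \<partial>?P)"
          unfolding m_def
        proof (rule nn_integral_PiM_affine)
          show "invertible (A z)" for z using True by (simp add: invertible_det_nz detA)
        qed (simp, measurable)
        also have "\<dots> \<le> 1 * (\<integral>\<^sup>+y. Z (data_stat n (\<lambda>z. t *\<^sub>R y z + e z)) \<partial>?P)"
        proof (rule mult_mono)
          show "ennreal (\<Prod>z\<in>obs_index n. \<bar>det (A z)\<bar>) \<le> 1"
            using True by (auto simp: detA intro!: prod_le_1 power_le_one)
        qed (auto simp: Av)
        finally show ?thesis using True by simp
      qed simp
    qed
    also have "\<dots> = (\<integral>\<^sup>+t. \<integral>\<^sup>+y. Z (data_stat n (\<lambda>z. t *\<^sub>R y z + e z)) * indicator {0<..<1} t \<partial>?P \<partial>lborel)"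
    proof (rule nn_integral_cong)
      fix t :: real
      have "(\<lambda>y. data_stat n (\<lambda>z. t *\<^sub>R y z + e z)) \<in> borel_measurable ?P"
        using measurable_compose[OF measurable_Pair[OF measurable_ident measurable_const] meas, of t] by simp
      then have "(\<lambda>y. Z (data_stat n (\<lambda>z. t *\<^sub>R y z + e z))) \<in> borel_measurable ?P"
        by (rule measurable_compose) measurable
      then show "(\<integral>\<^sup>+y. Z (data_stat n (\<lambda>z. t *\<^sub>R y z + e z)) \<partial>?P) * indicator {0<..<1} t =
         (\<integral>\<^sup>+y. Z (data_stat n (\<lambda>z. t *\<^sub>R y z + e z)) * indicator {0<..<1} t \<partial>?P)"
        by (rule nn_integral_multc[symmetric])
    qed
    also have "\<dots> = (\<integral>\<^sup>+y. \<integral>\<^sup>+t. Z (data_stat n (\<lambda>z. t *\<^sub>R y z + e z)) * indicator {0<..<1} t \<partial>lborel \<partial>?P)"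
    proof -
      have "(\<lambda>x. Z (data_stat n (\<lambda>z. snd x *\<^sub>R fst x z + e z)) * indicator {0<..<1} (snd x)) \<in> borel_measurable (?P \<Otimes>\<^sub>M (lborel :: real measure))"
        using meas by measurable
      then show ?thesis by (intro Fubini') (simp add: split_beta')
    qed
    also have "\<dots> = (\<integral>\<^sup>+y. 0 \<partial>?P)"
    proof (rule nn_integral_cong)
      fix y :: "'k \<times> nat \<Rightarrow> real^'p"
      have fin: "finite {t. det (group_cov N (data_stat n (\<lambda>z. t *\<^sub>R y z + e z)) i) = 0}"
        using finite_singular_line[of n e i y, folded N_def] e by simp
      have "AE t in lborel. t \<notin> {t. det (group_cov N (data_stat n (\<lambda>z. t *\<^sub>R y z + e z)) i) = 0}"
        using AE_not_in[OF finite_imp_null_set_lborel[OF fin]] .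
      then have "(\<integral>\<^sup>+t. Z (data_stat n (\<lambda>z. t *\<^sub>R y z + e z)) * indicator {0<..<1} t \<partial>lborel) = (\<integral>\<^sup>+(t::real). 0 \<partial>lborel)"
        by (intro nn_integral_cong_AE) (auto simp: Z_def)
      then show "(\<integral>\<^sup>+t. Z (data_stat n (\<lambda>z. t *\<^sub>R y z + e z)) * indicator {0<..<1} t \<partial>lborel) = 0" by simp
    qed
    finally have "m = 0" by simp
    then have "AE y in ?P. Z (data_stat n y) = 0"
      unfolding m_def by (subst (asm) nn_integral_0_iff_AE) auto
    then show ?thesis
    proof eventually_elim
      case (elim y)
      have "n i > 0" using n[of i] by simp
      then show ?case
        using pos_def_group_cov_data_stat[of n i y, folded N_def] elim by (auto simp: Z_def split: split_indicator_asm)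
    qed
  qed
  then show ?thesis by (simp add: AE_all_countable)
qed

section \<open>The law of the p-value\<close>

lemma PiM_density:
  fixes f :: "'i \<Rightarrow> 'a::euclidean_space \<Rightarrow> ennreal"
  assumes fin: "finite I" and f [measurable]: "\<And>i. f i \<in> borel_measurable borel"
    and sf: "\<And>i. sigma_finite_measure (density lborel (f i))"
  shows "Pi\<^sub>M I (\<lambda>i. density lborel (f i)) = density (Pi\<^sub>M I (\<lambda>_. lborel)) (\<lambda>y. \<Prod>i\<in>I. f i (y i))"
proof -
  interpret P: product_sigma_finite "\<lambda>i. density lborel (f i)" by (rule product_sigma_finite.intro) (rule sf)
  interpret L: product_sigma_finite "\<lambda>_ :: 'i. lborel :: 'a measure" by standard
  have sets_eq: "sets (Pi\<^sub>M I (\<lambda>_. lborel)) = sets (Pi\<^sub>M I (\<lambda>i. density lborel (f i)))"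
    by (rule sets_PiM_cong) simp_all
  have "density (Pi\<^sub>M I (\<lambda>_. lborel)) (\<lambda>y. \<Prod>i\<in>I. f i (y i)) = Pi\<^sub>M I (\<lambda>i. density lborel (f i))"
  proof (rule P.PiM_eqI[OF fin])
    show "sets (density (Pi\<^sub>M I (\<lambda>_. lborel)) (\<lambda>y. \<Prod>i\<in>I. f i (y i))) = sets (Pi\<^sub>M I (\<lambda>i. density lborel (f i)))"
      using sets_eq by simp
    fix E assume "\<And>i. i \<in> I \<Longrightarrow> E i \<in> sets (density lborel (f i))"
    then have E [measurable]: "E i \<in> sets borel" if "i \<in> I" for i using that by simp
    have PE [measurable]: "Pi\<^sub>E I E \<in> sets (Pi\<^sub>M I (\<lambda>_. lborel :: 'a measure))" using fin E by (intro sets_PiM_I_finite) auto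
    have fm: "(\<lambda>y. \<Prod>i\<in>I. f i (y i)) \<in> borel_measurable (Pi\<^sub>M I (\<lambda>_. lborel))"
      by (intro borel_measurable_prod_ennreal measurable_compose[OF measurable_component_singleton]) auto
    have "emeasure (density (Pi\<^sub>M I (\<lambda>_. lborel)) (\<lambda>y. \<Prod>i\<in>I. f i (y i))) (Pi\<^sub>E I E) =
      (\<integral>\<^sup>+y. (\<Prod>i\<in>I. f i (y i)) * indicator (Pi\<^sub>E I E) y \<partial>Pi\<^sub>M I (\<lambda>_. lborel))"
      by (rule emeasure_density[OF fm PE])
    also have "\<dots> = (\<integral>\<^sup>+y. (\<Prod>i\<in>I. f i (y i) * indicator (E i) (y i)) \<partial>Pi\<^sub>M I (\<lambda>_. lborel))"
    proof (rule nn_integral_cong)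
      fix y assume "y \<in> space (Pi\<^sub>M I (\<lambda>_. lborel :: 'a measure))"
      then have y: "y \<in> extensional I" by (simp add: space_PiM PiE_iff)
      show "(\<Prod>i\<in>I. f i (y i)) * indicator (Pi\<^sub>E I E) y = (\<Prod>i\<in>I. f i (y i) * indicator (E i) (y i))"
      proof (cases "\<forall>i\<in>I. y i \<in> E i")
        case True
        then show ?thesis using y by (simp add: PiE_iff indicator_def)
      next
        case False
        then obtain i where i: "i \<in> I" "y i \<notin> E i" by blast
        then have "(\<Prod>i\<in>I. f i (y i) * indicator (E i) (y i)) = 0"
          using fin by (intro prod_zero) (auto intro!: bexI[of _ i])
        moreover have "y \<notin> Pi\<^sub>E I E" using i by auto
        ultimately show ?thesis by simp
      qed
    qed
    also have "\<dots> = (\<Prod>i\<in>I. \<integral>\<^sup>+x. f i x * indicator (E i) x \<partial>lborel)"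
      by (rule L.product_nn_integral_prod[OF fin]) simp
    also have "\<dots> = (\<Prod>i\<in>I. emeasure (density lborel (f i)) (E i))"
      by (intro prod.cong refl emeasure_density[symmetric]) simp_all
    finally show "emeasure (density (Pi\<^sub>M I (\<lambda>_. lborel)) (\<lambda>y. \<Prod>i\<in>I. f i (y i))) (Pi\<^sub>E I E) =
      (\<Prod>i\<in>I. emeasure (density lborel (f i)) (E i))" .
  qed
  then show ?thesis ..
qed

text \<open>Joins the uniqueness of relatively invariant measures with almost sure positive
  definiteness, which removes the indicator. The exponent n i arises because A i acts on each of the
  n i observations of its group.\<close>

lemma data_stat_density:
  fixes n :: "'k::finite \<Rightarrow> nat"
  defines "N \<equiv> \<lambda>i. real (n i)"
  assumes n: "\<And>i. n i \<ge> CARD('p::finite) + 1"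
  obtains C where "\<And>f. f \<in> borel_measurable borel \<Longrightarrow>
    (\<integral>\<^sup>+y. f (data_stat n y) \<partial>data_space n) = C * (\<integral>\<^sup>+v. f v * ennreal (stat_weight N v) \<partial>(lborel :: ('k, 'p) param measure))"
proof -
  let ?P = "data_space n :: ('k \<times> nat \<Rightarrow> real^'p) measure"
  interpret P: product_sigma_finite "\<lambda>_ :: 'k \<times> nat. lborel :: (real^'p) measure"
    by standard
  have n0: "n i > 0" for i using n[of i] by simp
  have "\<exists>C. \<forall>f\<in>borel_measurable borel.
    (\<integral>\<^sup>+y. f (data_stat n y) * indicator {v. \<forall>i. pos_def (group_cov N v i)} (data_stat n y) \<partial>?P) =
      C * (\<integral>\<^sup>+v. f v * ennreal (stat_weight N v) \<partial>lborel)"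
    unfolding N_def
  proof (rule affine_invariant_density[OF n0])
    show "sigma_finite_measure ?P" by (rule P.sigma_finite) simp
    show "data_stat n \<in> borel_measurable ?P" by (rule borel_measurable_data_stat)
    fix f :: "('k, 'p) param \<Rightarrow> ennreal" and A :: "'k \<Rightarrow> real^'p^'p" and b
    assume f [measurable]: "f \<in> borel_measurable borel" and A: "\<And>i. invertible (A i)"
    have "(\<integral>\<^sup>+y. f (data_stat n y) \<partial>?P) = ennreal (\<Prod>z\<in>obs_index n. \<bar>det (A (fst z))\<bar>) *
       (\<integral>\<^sup>+y. f (data_stat n (\<lambda>z\<in>obs_index n. A (fst z) *v y z + b (fst z))) \<partial>?P)"
      by (rule nn_integral_PiM_affine[where A="\<lambda>z. A (fst z)"]) (simp, rule A, measurable)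
    moreover have "data_stat n (\<lambda>z. A (fst z) *v y z + b (fst z)) = affine_act (\<lambda>i. real (n i)) A b (data_stat n y)" for y
      using data_stat_affine[of n A y b] by (simp add: split_beta')
    ultimately show "(\<integral>\<^sup>+y. f (data_stat n y) \<partial>?P) = ennreal (\<Prod>i\<in>UNIV. \<bar>det (A i)\<bar> ^ n i) *
       (\<integral>\<^sup>+y. f (affine_act (\<lambda>i. real (n i)) A b (data_stat n y)) \<partial>?P)"
      by (simp add: prod_obs_index)
  qed
  then obtain C where C: "\<And>f. f \<in> borel_measurable borel \<Longrightarrow>
    (\<integral>\<^sup>+y. f (data_stat n y) * indicator {v. \<forall>i. pos_def (group_cov N v i)} (data_stat n y) \<partial>?P) =
      C * (\<integral>\<^sup>+v. f v * ennreal (stat_weight N v) \<partial>lborel)" by (elim exE) (simp add: Ball_def)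
  show ?thesis
  proof (rule that)
    fix f :: "('k, 'p) param \<Rightarrow> ennreal" assume f: "f \<in> borel_measurable borel"
    have "(\<integral>\<^sup>+y. f (data_stat n y) \<partial>?P) =
      (\<integral>\<^sup>+y. f (data_stat n y) * indicator {v. \<forall>i. pos_def (group_cov N v i)} (data_stat n y) \<partial>?P)"
    proof (rule nn_integral_cong_AE)
      show "AE y in ?P. f (data_stat n y) = f (data_stat n y) * indicator {v. \<forall>i. pos_def (group_cov N v i)} (data_stat n y)"
        using AE_pos_def_group_cov[OF n, folded N_def] by eventually_elim (simp add: N_def)
    qed
    then show "(\<integral>\<^sup>+y. f (data_stat n y) \<partial>?P) = C * (\<integral>\<^sup>+v. f v * ennreal (stat_weight N v) \<partial>lborel)"
      using C[OF f] by simp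
  qed
qed

lemma mvn_density_pos: "pos_def S \<Longrightarrow> mvn_density \<mu> S x > 0"
  using pos_def_det_pos[of S] by (simp add: mvn_density_def)

lemma conc_natural_param: "pos_def (\<Lambda> i) \<Longrightarrow> conc (mk_param m \<Lambda>) i = \<Lambda> i"
  by (simp add: pos_def_def)

lemma mean_natural_param: "pos_def (\<Lambda> i) \<Longrightarrow> mean (mk_param (\<lambda>i. \<Lambda> i *v \<mu> i) \<Lambda>) i = \<mu> i"
  using matrix_inv_left[OF pos_def_invertible, of "\<Lambda> i"]
  by (simp add: mean_def conc_natural_param matrix_vector_mul_assoc)

text \<open>The joint density depends on the data only through the statistic; this is what allows
  the law of the p-value to be computed on the space of moments.\<close>

lemma prod_mvn_density:
  fixes \<mu> :: "'k::finite \<Rightarrow> real^'p::finite" and n :: "'k \<Rightarrow> nat"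
  assumes \<Lambda>: "\<And>i. pos_def (\<Lambda> i)"
  shows "(\<Prod>z\<in>obs_index n. ennreal (mvn_density (\<mu> (fst z)) (matrix_inv (\<Lambda> (fst z))) (y z))) =
    ennreal (exp (stat_loglik (\<lambda>i. real (n i)) (data_stat n y) (mk_param (\<lambda>i. \<Lambda> i *v \<mu> i) \<Lambda>)))"
proof -
  define \<phi> where "\<phi> = mk_param (\<lambda>i. \<Lambda> i *v \<mu> i) \<Lambda>"
  have conc: "conc \<phi> i = \<Lambda> i" and mean: "mean \<phi> i = \<mu> i" for i
    using \<Lambda>[of i] by (simp_all add: \<phi>_def conc_natural_param mean_natural_param)
  have "\<phi> \<in> param_space" using \<Lambda> by (simp add: param_space_def conc)
  then have "stat_loglik (\<lambda>i. real (n i)) (data_stat n y) \<phi> = mvn_loglik n (\<lambda>i j. y (i, j)) \<phi>"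
    by (simp add: mvn_loglik_eq_stat_loglik data_stat_def)
  also have "exp \<dots> = (\<Prod>i\<in>UNIV. \<Prod>j<n i. mvn_density (\<mu> i) (matrix_inv (\<Lambda> i)) (y (i, j)))"
    using mvn_density_pos[OF pos_def_matrix_inv[OF \<Lambda>]] by (simp add: mvn_loglik_def exp_sum conc mean)
  also have "\<dots> = (\<Prod>z\<in>obs_index n. mvn_density (\<mu> (fst z)) (matrix_inv (\<Lambda> (fst z))) (y z))"
    by (simp add: prod_obs_index)
  finally show ?thesis
    using mvn_density_pos[OF pos_def_matrix_inv[OF \<Lambda>]]
    by (simp add: \<phi>_def prod_ennreal less_imp_le)
qed

text \<open>The values on (0, 1) suffice, since monotonicity forces the distribution function to be
  0 below and 1 above.\<close>

lemma (in prob_space) distr_eq_uniformI: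
  assumes X [measurable]: "random_variable borel X"
    and cdf: "\<And>a. 0 < a \<Longrightarrow> a < 1 \<Longrightarrow> prob {\<omega> \<in> space M. X \<omega> \<le> a} = a"
  shows "distr M borel X = uniform_measure lborel {0<..<1::real}"
proof -
  have mono: "prob {\<omega> \<in> space M. X \<omega> \<le> a} \<le> prob {\<omega> \<in> space M. X \<omega> \<le> b}" if "a \<le> b" for a b
    using that by (intro finite_measure_mono) auto
  have low: "prob {\<omega> \<in> space M. X \<omega> \<le> a} = 0" if a: "a \<le> 0" for a
  proof (rule antisym[OF field_le_epsilon measure_nonneg])
    fix e :: real assume e: "e > 0"
    \<comment> \<open>The minimum with 1/2 keeps the comparison point inside (0, 1) even for large
      e.\<close>
    have "prob {\<omega> \<in> space M. X \<omega> \<le> a} \<le> prob {\<omega> \<in> space M. X \<omega> \<le> min e (1 / 2)}"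
      using a e by (intro mono) auto
    also have "\<dots> = min e (1 / 2)" using e by (intro cdf) auto
    finally show "prob {\<omega> \<in> space M. X \<omega> \<le> a} \<le> 0 + e" by simp
  qed
  have high: "prob {\<omega> \<in> space M. X \<omega> \<le> a} = 1" if a: "a \<ge> 1" for a
  proof (rule antisym[OF prob_le_1 field_le_epsilon])
    fix e :: real assume e: "e > 0"
    have "max (1 - e) (1 / 2) = prob {\<omega> \<in> space M. X \<omega> \<le> max (1 - e) (1 / 2)}" using e by (intro cdf[symmetric]) auto
    also have "\<dots> \<le> prob {\<omega> \<in> space M. X \<omega> \<le> a}" using a e by (intro mono) auto
    finally show "1 \<le> prob {\<omega> \<in> space M. X \<omega> \<le> a} + e" by simp
  qed
  have "distributed M lborel X (\<lambda>x. indicator {0<..<1} x / measure lborel {0<..<1::real})"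
  proof (rule uniform_distrI_borel[where r=1])
    fix a :: real
    consider "a \<le> 0" | "0 < a" "a < 1" | "a \<ge> 1" by linarith
    then show "emeasure M {x \<in> space M. X x \<le> a} = emeasure lborel ({0<..<1} \<inter> {..a}) / ennreal 1"
    proof cases
      case 1
      then have "{0<..<1} \<inter> {..a} = {}" by auto
      then show ?thesis using low[OF 1] by (simp add: emeasure_eq_measure)
    next
      case 2
      then have "{0<..<1} \<inter> {..a} = {0<..a}" by auto
      then show ?thesis using cdf[OF 2] 2 divide_ennreal[of a 1] by (simp add: emeasure_eq_measure)
    next
      case 3
      then have "{0<..<1} \<inter> {..a} = {0<..<1}" by auto
      then show ?thesis using high[OF 3] by (simp add: emeasure_eq_measure)
    qed
  qed auto
  then have "distr M lborel X = density lborel (\<lambda>x. indicator {0<..<1} x / measure lborel {0<..<1::real})"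
    by (rule distributed_distr_eq_density)
  moreover have "distr M borel X = distr M lborel X" by (rule distr_cong) simp_all
  moreover have "(\<lambda>x :: real. ennreal (indicator {0<..<1} x / measure lborel {0<..<1::real})) =
     (\<lambda>x. indicator {0<..<1} x / emeasure lborel {0<..<1::real})"
    by (auto simp: fun_eq_iff split: split_indicator)
  ultimately show ?thesis unfolding uniform_measure_def by (simp only:)
qed

theorem theorem2:
  fixes M :: "'w measure"
    and Y :: "'k::finite \<Rightarrow> nat \<Rightarrow> 'w \<Rightarrow> real^'p::finite"
    and n :: "'k \<Rightarrow> nat"
    and \<mu> :: "'k \<Rightarrow> real^'p"
    and \<Lambda> :: "'k \<Rightarrow> real^'p^'p"
    and c :: real
  assumes "prob_space M"
    and "CARD('k) \<ge> 2"
    and "\<And>i. n i \<ge> 3"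
    and "\<And>i. n i \<ge> CARD('p) + 2"
    and "\<And>i. pos_def (\<Lambda> i)"
    and "prob_space.indep_vars M (\<lambda>_. borel) (\<lambda>(i, j). Y i j) (SIGMA i:UNIV. {..<n i})"
    and "\<And>i j. j < n i \<Longrightarrow>
           distributed M lborel (Y i j) (mvn_density (\<mu> i) (matrix_inv (\<Lambda> i)))"
    and "H_psi \<mu> \<Lambda>"
    and "c > 0"
  shows "(\<lambda>\<omega>. mvn_pvalue c n (\<lambda>i j. Y i j \<omega>)) \<in> borel_measurable M \<and>
         distr M borel (\<lambda>\<omega>. mvn_pvalue c n (\<lambda>i j. Y i j \<omega>)) = uniform_measure lborel {0<..<1}"
  proof -
  interpret prob_space M by fact
  define N where "N = (\<lambda>i. real (n i))"
  define d where "d = CARD('p) * (CARD('p) + 3) * (CARD('k) - 1) div 2"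
  have n0: "n i > 0" and N: "N i > 0" for i using assms(3)[of i] by (simp_all add: N_def)
  define \<phi> where "\<phi> = mk_param (\<lambda>i. \<Lambda> i *v \<mu> i) \<Lambda>"
  have conc: "conc \<phi> i = \<Lambda> i" and mean: "mean \<phi> i = \<mu> i" for i
    using assms(5)[of i] by (simp_all add: \<phi>_def conc_natural_param mean_natural_param)
  have \<phi>: "\<phi> \<in> null_params"
  proof -
    have "mean \<phi> = \<mu>" "conc \<phi> = \<Lambda>" by (simp_all add: fun_eq_iff mean conc)
    then show ?thesis using assms(5,8) by (simp add: null_params_def param_space_def)
  qed
  define g where "g v = ennreal (exp (stat_loglik N v \<phi>))" for v
  have g [measurable]: "g \<in> borel_measurable borel"
  proof -
    have [measurable]: "(to_canonical :: ('k, 'p) param \<Rightarrow> _) \<in> borel_measurable borel"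
      by (rule borel_measurable_linear[OF linear_to_canonical])
    show ?thesis unfolding g_def[abs_def] stat_loglik_def by measurable
  qed
  \<comment> \<open>The hypothesis enters here: for a null parameter the likelihood sees only the
    pooled part of the statistic.\<close>
  have g_radial: "g (radial N s v) = g v" for s v
    using inner_to_canonical_pooled[where N=N, OF N \<phi>, of "radial N s v"]
      inner_to_canonical_pooled[where N=N, OF N \<phi>, of v]
    by (simp add: g_def stat_loglik_def pooled_radial[where N=N, OF N])

  let ?P = "data_space n :: ('k \<times> nat \<Rightarrow> real^'p) measure"
  define X where "X = (\<lambda>(i, j). Y i j)"
  define W where "W = (\<lambda>\<omega>. \<lambda>z\<in>obs_index n. X z \<omega>)"
  define f where "f = (\<lambda>(z :: 'k \<times> nat) x. ennreal (mvn_density (\<mu> (fst z)) (matrix_inv (\<Lambda> (fst z))) x))"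
  have law: "distr M lborel (X z) = density lborel (f z)" "X z \<in> borel_measurable M" "f z \<in> borel_measurable borel"
    if "z \<in> obs_index n" for z
    using that assms(7)[of "snd z" "fst z"] by (auto simp: X_def f_def obs_index_def distributed_def split: prod.split_asm)
  \<comment> \<open>\<open>PiM_density\<close> asks about every index pair, observed or not. As f
    depends only on the group, observation 0 of that group, which exists, can stand in.\<close>
  have f: "f z \<in> borel_measurable borel" "sigma_finite_measure (density lborel (f z))" for z
  proof -
    have z: "(fst z, 0) \<in> obs_index n" and eq: "f z = f (fst z, 0)" using n0 by (simp_all add: f_def)
    show "f z \<in> borel_measurable borel" unfolding eq by (rule law(3)[OF z])
    have "prob_space (distr M lborel (X (fst z, 0)))" using law(2)[OF z] by (intro prob_space_distr) simp
    then show "sigma_finite_measure (density lborel (f z))"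
      unfolding eq law(1)[OF z] by (simp add: prob_space_imp_sigma_finite)
  qed
  have W [measurable]: "W \<in> measurable M ?P"
    unfolding W_def by (intro measurable_restrict) (simp add: law(2))
  have "(undefined, 0) \<in> obs_index n" using n0 by simp
  then have ne: "obs_index n \<noteq> {}" by blast
  have "indep_vars (\<lambda>_. borel) X (obs_index n)" using assms(6) by (simp add: X_def obs_index_def)
  then have joint: "distr M (Pi\<^sub>M (obs_index n) (\<lambda>_. borel)) W = Pi\<^sub>M (obs_index n) (\<lambda>z. distr M borel (X z))"
    unfolding W_def by (subst (asm) indep_vars_iff_distr_eq_PiM'[OF ne law(2)]) simp_all
  have "distr M ?P W = distr M (Pi\<^sub>M (obs_index n) (\<lambda>_. borel)) W"
    by (intro distr_cong refl sets_PiM_cong) simp_all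
  also have "\<dots> = Pi\<^sub>M (obs_index n) (\<lambda>z. density lborel (f z))"
    unfolding joint
  proof (rule PiM_cong[OF refl])
    fix z assume z: "z \<in> obs_index n"
    have "distr M borel (X z) = distr M lborel (X z)" by (rule distr_cong) simp_all
    then show "distr M borel (X z) = density lborel (f z)" using law(1)[OF z] by simp
  qed
  also have "\<dots> = density ?P (\<lambda>y. \<Prod>z\<in>obs_index n. f z (y z))"
    by (rule PiM_density) (simp_all add: f)
  also have "\<dots> = density ?P (\<lambda>y. g (data_stat n y))"
    by (simp only: f_def g_def \<phi>_def N_def prod_mvn_density[where \<Lambda>=\<Lambda>, OF assms(5)])
  finally have distr_W: "distr M ?P W = density ?P (\<lambda>y. g (data_stat n y))" .

  define S where "S \<omega> = suff_stat n (\<lambda>i j. Y i j \<omega>)" for \<omega>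
  have S_W: "S \<omega> = data_stat n (W \<omega>)" for \<omega>
    by (simp add: S_def W_def) (simp add: data_stat_def X_def)
  have S [measurable]: "S \<in> borel_measurable M" unfolding S_W[abs_def] by measurable
  have card: "CARD('p) + 1 \<le> n i" for i using assms(4)[of i] by simp
  obtain C where C: "\<And>h. h \<in> borel_measurable borel \<Longrightarrow>
    (\<integral>\<^sup>+y. h (data_stat n y) \<partial>?P) = C * (\<integral>\<^sup>+v. h v * ennreal (stat_weight N v) \<partial>(lborel :: ('k, 'p) param measure))"
    by (rule data_stat_density[where n=n and ?'p='p, OF card, folded N_def]) (rule that)
  have S_integral: "(\<integral>\<^sup>+\<omega>. h (S \<omega>) \<partial>M) = C * (\<integral>\<^sup>+v. g v * ennreal (stat_weight N v) * h v \<partial>lborel)"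
    if h [measurable]: "h \<in> borel_measurable borel" for h
  proof -
    have "(\<integral>\<^sup>+\<omega>. h (S \<omega>) \<partial>M) = (\<integral>\<^sup>+y. h (data_stat n y) \<partial>distr M ?P W)"
      unfolding S_W by (rule nn_integral_distr[symmetric]) measurable
    also have "\<dots> = (\<integral>\<^sup>+y. g (data_stat n y) * h (data_stat n y) \<partial>?P)"
      unfolding distr_W by (rule nn_integral_density) measurable
    also have "\<dots> = C * (\<integral>\<^sup>+v. g v * h v * ennreal (stat_weight N v) \<partial>lborel)"
      by (rule C) measurable
    finally show ?thesis by (simp add: mult_ac)
  qed
  define Z where "Z = (\<integral>\<^sup>+v. g v * ennreal (stat_weight N v) \<partial>(lborel :: ('k, 'p) param measure))"
  \<comment> \<open>Total probability 1. This excludes an infinite Z although C is only known as an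
    element of \<open>ennreal\<close>, since a product with infinity is 0 or infinity.\<close>
  have CZ: "C * Z = 1" using S_integral[of "\<lambda>_. 1"] by (simp add: Z_def emeasure_space_1)
  have Z: "Z < \<infinity>"
  proof (rule ccontr)
    assume "\<not> Z < \<infinity>"
    then have "Z = \<infinity>" by (simp add: not_less top_unique)
    then show False using CZ by (simp add: ennreal_mult_top split: if_splits)
  qed

  \<comment> \<open>The exceptional outcomes are kept with their constant value because
    measurability is claimed on the whole sample space; they are then shown to have probability
    0.\<close>
  have pv: "mvn_pvalue c n (\<lambda>i j. Y i j \<omega>) =
     (if \<forall>i. pos_def (group_cov N (S \<omega>) i) then tail_ratio d N (S \<omega>) else undefined)" for \<omega>
    using mvn_pvalue_pos_def[of n c "\<lambda>i j. Y i j \<omega>", OF n0 assms(9)] mvn_pvalue_undefined[of n "\<lambda>i j. Y i j \<omega>" c, OF n0]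
    by (auto simp: N_def S_def d_def tail_ratio_def)
  have [measurable]: "Measurable.pred M (\<lambda>\<omega>. \<forall>i. pos_def (group_cov N (S \<omega>) i))"
    using measurable_compose[OF S measurable_pos_def_group_cov] .
  have meas [measurable]: "(\<lambda>\<omega>. mvn_pvalue c n (\<lambda>i j. Y i j \<omega>)) \<in> borel_measurable M"
    unfolding pv by measurable
  have "AE y in distr M ?P W. \<forall>i. pos_def (group_cov N (data_stat n y) i)"
    unfolding distr_W N_def using AE_pos_def_group_cov[where n=n and ?'p='p, OF card] by (subst AE_density) auto
  then have "AE \<omega> in M. \<forall>i. pos_def (group_cov N (S \<omega>) i)"
    unfolding S_W by (rule AE_distrD[OF W])
  then have AE_pv: "AE \<omega> in M. mvn_pvalue c n (\<lambda>i j. Y i j \<omega>) = tail_ratio d N (S \<omega>)"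
    by eventually_elim (simp add: pv)
  have "distr M borel (\<lambda>\<omega>. mvn_pvalue c n (\<lambda>i j. Y i j \<omega>)) = uniform_measure lborel {0<..<1}"
  proof (rule distr_eq_uniformI[OF meas])
    fix a :: real assume a: "0 < a" "a < 1"
    have "emeasure M {\<omega> \<in> space M. mvn_pvalue c n (\<lambda>i j. Y i j \<omega>) \<le> a} = emeasure M {\<omega> \<in> space M. tail_ratio d N (S \<omega>) \<le> a}"
      using AE_pv by (intro emeasure_eq_AE) auto
    also have "\<dots> = (\<integral>\<^sup>+\<omega>. indicator {v. tail_ratio d N v \<le> a} (S \<omega>) \<partial>M)"
    proof -
      have "(\<integral>\<^sup>+\<omega>. indicator {v. tail_ratio d N v \<le> a} (S \<omega>) \<partial>M) =
        (\<integral>\<^sup>+\<omega>. indicator {\<omega> \<in> space M. tail_ratio d N (S \<omega>) \<le> a} \<omega> \<partial>M)"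
        by (rule nn_integral_cong) (simp add: indicator_def)
      then show ?thesis by simp
    qed
    also have "\<dots> = C * (\<integral>\<^sup>+v. g v * ennreal (stat_weight N v) * indicator {v. tail_ratio d N v \<le> a} v \<partial>lborel)"
      by (rule S_integral) measurable
    also have "\<dots> = C * (ennreal a * Z)"
      unfolding Z_def d_def
      by (subst tail_ratio_uniform[where N=N and g=g, OF N assms(2) g g_radial Z[unfolded Z_def] a]) simp_all
    also have "\<dots> = ennreal a" using CZ by (metis mult.left_commute mult.right_neutral)
    finally show "prob {\<omega> \<in> space M. mvn_pvalue c n (\<lambda>i j. Y i j \<omega>) \<le> a} = a"
      using a by (simp add: measure_def)
  qed
  with meas show ?thesis by blast
qed

end
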